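(* Let $T:\mathbb{R}[x_1,\dots,x_n]\to\mathbb{R}[x_1,\dots,x_m]$ be a linear operator mapping polynomials with non-negative coefficients to polynomials with non-negative coefficients, such that for every fixed $x\in\mathbb{R}_+^m$ the power series $\mathrm{Symb}^\infty(T)(z,x)$ in $z$ belongs to $\mathcal{LP}_+[z_1,\dots,z_n]$. Let $\alpha\in\mathbb{R}_+^n$ and $\beta\in\mathbb{R}_+^m$. Then for every real stable $p\in\mathbb{R}_+[x_1,\dots,x_n]$ with $\alpha\in\mathrm{Newt}(p)$, $$\frac{\mathrm{Cap}_\beta(T(p))}{\mathrm{Cap}_\alpha(p)}\ \ge\ e^{-\alpha}\alpha^\alpha\,\mathrm{Cap}_{(\alpha,\beta)}\big(\mathrm{Symb}^\infty(T)\big).$$ Further, this bound is tight for fixed $T,\alpha,\beta$: the infimum of the left-hand side over all real stable $p\in\mathbb{R}_+[x_1,\dots,x_n]$ with $\alpha\in\mathrm{Newt}(p)$ equals the right-hand side.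
   Context: $\mathbb{R}_+$ denotes the non-negative reals, and $\mathbb{R}_+[x_1,\dots,x_n]$ the polynomials with non-negative coefficients. A real polynomial is real stable if it is identically zero or does not vanish when all variables lie in the open upper half-plane. $\mathcal{LP}_+[z_1,\dots,z_n]$ is the class of functions on $\mathbb{C}^n$ which are limits, uniformly on compact sets, of real stable polynomials with non-negative coefficients. Multi-index notation: $x^\alpha=\prod_kx_k^{\alpha_k}$, $\alpha^\alpha=\prod_k\alpha_k^{\alpha_k}$ with $0^0=1$, $e^{-\alpha}=\prod_ke^{-\alpha_k}$, $\mu!=\prod_k\mu_k!$. For a polynomial (or everywhere convergent power series) $p$ with non-negative coefficients, $\mathrm{Cap}_\alpha(p)=\inf_{x_1,\dots,x_n>0}p(x)/x^\alpha$. $\mathrm{Newt}(p)$ is the convex hull of the set of exponents of monomials with non-zero coefficient in $p$; for $\alpha\in\mathrm{Newt}(p)$ one has $\mathrm{Cap}_\alpha(p)>0$. The transcendental symbol of $T$ is $\mathrm{Symb}^\infty(T)(z,x)=\sum_{\mu\in\mathbb{Z}_+^n}\frac{1}{\mu!}z^\mu\,T(x^\mu)$, and $\mathrm{Cap}_{(\alpha,\beta)}(\mathrm{Symb}^\infty(T))=\inf_{z>0,\,x>0}\mathrm{Symb}^\infty(T)(z,x)/(z^\alpha x^\beta)$. *)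

theory Defs
  imports "HOL-Analysis.Analysis" "HOL-Analysis.Finite_Function_Topology"
begin

text \<open>
  Real polynomials in variables indexed by a finite type \<open>'n\<close>, as finitely supported maps from
  exponents to coefficients.
\<close>

type_synonym 'n rpoly = "('n \<Rightarrow>\<^sub>0 nat) \<Rightarrow>\<^sub>0 real"

definition monomial_at :: "('n::finite \<Rightarrow>\<^sub>0 nat) \<Rightarrow> 'a::comm_semiring_1 ^ 'n \<Rightarrow> 'a" where
  "monomial_at \<mu> x = (\<Prod>i\<in>UNIV. (x $ i) ^ Poly_Mapping.lookup \<mu> i)"

text \<open>Evaluation is polymorphic so that it covers both real and complex points.\<close>

definition eval_rpoly :: "'n::finite rpoly \<Rightarrow> 'a::{real_algebra_1,comm_ring_1} ^ 'n \<Rightarrow> 'a" where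
  "eval_rpoly p x =
    (\<Sum>\<mu>\<in>Poly_Mapping.keys p. of_real (Poly_Mapping.lookup p \<mu>) * monomial_at \<mu> x)"

definition nonneg_coeffs :: "'n::finite rpoly \<Rightarrow> bool" where
  "nonneg_coeffs p \<longleftrightarrow> (\<forall>\<mu>. 0 \<le> Poly_Mapping.lookup p \<mu>)"

definition real_stable :: "'n::finite rpoly \<Rightarrow> bool" where
  "real_stable p \<longleftrightarrow>
    p = 0 \<or> (\<forall>z :: complex ^ 'n. (\<forall>i. 0 < Im (z $ i)) \<longrightarrow> eval_rpoly p z \<noteq> 0)"

definition LP_plus :: "(complex ^ 'n::finite \<Rightarrow> complex) set" where
  "LP_plus = {f. \<exists>p :: nat \<Rightarrow> 'n rpoly.
     (\<forall>k. real_stable (p k) \<and> nonneg_coeffs (p k)) \<and>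
     (\<forall>K. compact K \<longrightarrow> uniform_limit K (\<lambda>k. eval_rpoly (p k)) f sequentially)}"

definition Newt :: "'n::finite rpoly \<Rightarrow> (real ^ 'n) set" where
  "Newt p = convex hull
    ((\<lambda>\<mu>. \<chi> i. real (Poly_Mapping.lookup \<mu> i)) ` Poly_Mapping.keys p)"

definition pos_orthant :: "(real ^ 'n::finite) set" where
  "pos_orthant = {x. \<forall>i. 0 < x $ i}"

definition vec_powr :: "real ^ 'n::finite \<Rightarrow> real ^ 'n \<Rightarrow> real" where
  "vec_powr x \<alpha> = (\<Prod>i\<in>UNIV. x $ i powr \<alpha> $ i)"

text \<open>
  \<open>\<alpha>\<^sup>\<alpha>\<close> with the convention \<open>0\<^sup>0 = 1\<close>; it is not \<open>vec_powr \<alpha> \<alpha>\<close>, since \<open>0 powr 0 = 0\<close> in HOL.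
\<close>

definition self_powr :: "real ^ 'n::finite \<Rightarrow> real" where
  "self_powr \<alpha> = (\<Prod>i\<in>UNIV. if \<alpha> $ i = 0 then 1 else \<alpha> $ i powr \<alpha> $ i)"

definition exp_neg :: "real ^ 'n::finite \<Rightarrow> real" where
  "exp_neg \<alpha> = (\<Prod>i\<in>UNIV. exp (- (\<alpha> $ i)))"

definition Cap :: "real ^ 'n::finite \<Rightarrow> (real ^ 'n \<Rightarrow> real) \<Rightarrow> real" where
  "Cap \<alpha> f = (INF x\<in>pos_orthant. f x / vec_powr x \<alpha>)"

definition Cap2 ::
  "real ^ 'n::finite \<Rightarrow> real ^ 'm::finite \<Rightarrow> (real ^ 'n \<Rightarrow> real ^ 'm \<Rightarrow> real) \<Rightarrow> real" where
  "Cap2 \<alpha> \<beta> F =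
    (INF (z, x)\<in>pos_orthant \<times> pos_orthant. F z x / (vec_powr z \<alpha> * vec_powr x \<beta>))"

definition mfact :: "('n::finite \<Rightarrow>\<^sub>0 nat) \<Rightarrow> nat" where
  "mfact \<mu> = (\<Prod>i\<in>UNIV. fact (Poly_Mapping.lookup \<mu> i))"

text \<open>
  The terms of the transcendental symbol, and its sum, for real \<open>x\<close> and real or complex \<open>z\<close>.
  As \<open>infsum\<close> is \<open>0\<close> for a family that is not summable, summability has to be required
  separately wherever convergence matters.
\<close>

definition Symb_term ::
  "('n::finite rpoly \<Rightarrow> 'm::finite rpoly) \<Rightarrow> ('n \<Rightarrow>\<^sub>0 nat) \<Rightarrow> 'a::real_normed_field ^ 'n \<Rightarrow> real ^ 'm \<Rightarrow> 'a" where
  "Symb_term T \<mu> z x =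
    1 / of_nat (mfact \<mu>) * monomial_at \<mu> z * of_real (eval_rpoly (T (Poly_Mapping.single \<mu> 1)) x)"

definition Symb ::
  "('n::finite rpoly \<Rightarrow> 'm::finite rpoly) \<Rightarrow> 'a::real_normed_field ^ 'n \<Rightarrow> real ^ 'm \<Rightarrow> 'a" where
  "Symb T z x = (\<Sum>\<^sub>\<infinity>\<mu>. Symb_term T \<mu> z x)"

end

theory Submission
  imports Defs "HOL-Complex_Analysis.Complex_Analysis"
    "HOL-Computational_Algebra.Fundamental_Theorem_Algebra"
begin

text \<open>
  Since \<open>T p (x) = \<Sum>\<^sub>\<mu> \<mu>! p\<^sub>\<mu> c\<^sub>\<mu>(x)\<close>, where \<open>c\<^sub>\<mu>(x)\<close> are the coefficients of the symbol at \<open>x\<close>, the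
  bound is an inequality \<open>\<Sum>\<^sub>\<mu> \<mu>! p\<^sub>\<mu> q\<^sub>\<mu> \<ge> e\<^sup>-\<^sup>\<alpha> \<alpha>\<^sup>\<alpha> Cap\<^sub>\<alpha>(p) Cap\<^sub>\<alpha>(q)\<close> for a real stable \<open>p\<close> and \<open>q\<close> in \<open>LP_plus\<close>.
  For multiaffine polynomials it follows by contracting one pair of variables at a time: if
  \<open>a + b y + c z + d y z\<close> does not vanish for \<open>y\<close> in the upper and \<open>z\<close> in the lower half-plane, then
  neither does \<open>a + d\<close> (or it is zero), and \<open>b c \<le> a d\<close> at positive points, so that AM-GM bounds
  \<open>a + d\<close> from below by the capacity in \<open>(y, z)\<close> at exponent \<open>\<theta>\<close> times \<open>\<theta>\<^sup>\<theta> (1 - \<theta>)\<^sup>1\<^sup>-\<^sup>\<theta>\<close>. A stable polynomial becomes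
  multiaffine in \<open>N\<close> copies of each variable by applying \<open>\<Prod> (1 + x\<^sub>i\<^sub>j \<partial>\<^sub>i)\<close> at \<open>0\<close>; splitting
  \<open>\<alpha>\<^sub>i\<close> evenly among the copies and letting \<open>N \<rightarrow> \<infinity>\<close> produces the constant \<open>e\<^sup>-\<^sup>\<alpha> \<alpha>\<^sup>\<alpha>\<close>.
  The polynomials \<open>\<Prod>\<^sub>i (1 + z\<^sub>i x\<^sub>i / N)\<^sup>N\<close> show that it is tight.
\<close>

section \<open>Stability-preserving operations\<close>

text \<open>The classical polarization sends \<open>x^k\<close> to
  \<open>e_k / (N choose k)\<close>, with \<open>e_k\<close> the elementary symmetric polynomial.
  Differentiation at 0 gives \<open>k! * e_k\<close> instead, so \<open>p\<close> and
  \<open>q\<close> each bring a factor \<open>\<mu>!\<close>. The diagonal sum of the contracted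
  product then carries \<open>(\<mu>!)^2\<close> times the binomials
  \<open>N choose \<mu>_i\<close>; rescaling the variables of \<open>q\<close> by
  \<open>1 / N\<close> leaves at most one \<open>\<mu>!\<close>, because
  \<open>k! * (N choose k) <= N^k\<close>. The ratio of the two sides of this inequality also
  measures the loss in comparing the capacity of a polynomial with that of its polarization, and it
  tends to 1 for each fixed \<open>k\<close>. The entropy weights of the contractions multiply to
  \<open>N^a * w(a / N)^N = a^a * (1 - a / N)^(N - a)\<close> in each variable, with
  \<open>w\<close> the weight of one contraction; this is at least \<open>a^a * e^(-a)\<close> for
  every \<open>N > a\<close> and converges to it. The operator is never interchanged with a limit:
  \<open>x\<close> is fixed, and only finitely many coefficients of the symbol at \<open>x\<close>
  meet \<open>p\<close>. Hence coefficientwise convergence of polynomial approximants is enough,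
  provided that their capacities do not drop in the limit.\<close>

lemma Im_logderiv_nonpos:
  fixes r :: "complex poly"
  assumes "\<And>t. Im t > 0 \<Longrightarrow> poly r t \<noteq> 0" and t: "Im t > 0"
  shows "Im (poly (pderiv r) t / poly r t) \<le> 0"
  using assms(1)
proof (induction "degree r" arbitrary: r rule: less_induct)
  case less
  show ?case
  proof (cases "degree r = 0")
    case True
    then have "pderiv r = 0" by (simp add: pderiv_eq_0_iff)
    then show ?thesis by simp
  next
    case False
    then obtain \<rho> where \<rho>: "poly r \<rho> = 0"
      using fundamental_theorem_of_algebra_alt[of r] False by (metis degree_pCons_0)
    then obtain q where q: "r = [:-\<rho>, 1:] * q"
      by (auto simp: poly_eq_0_iff_dvd)
    have "q \<noteq> 0" using q False by auto
    then have "degree q < degree r" unfolding q by (subst degree_mult_eq) auto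
    moreover have nz: "poly q s \<noteq> 0" if "Im s > 0" for s
      using less.prems[OF that] by (simp add: q)
    ultimately have IH: "Im (poly (pderiv q) t / poly q t) \<le> 0"
      using less.hyps by blast
    have "Im \<rho> \<le> 0" using less.prems[of \<rho>] \<rho> by force
    then have "Im (t - \<rho>) > 0" using t by simp
    then have "t - \<rho> \<noteq> 0" and *: "Im (1 / (t - \<rho>)) \<le> 0"
      by (auto simp: Im_divide intro!: divide_nonpos_nonneg)
    \<comment> \<open>The logarithmic derivative is additive over the factors; each root contributes
      \<open>1 / (t - \<rho>)\<close>, which points downwards since \<open>\<rho>\<close> lies in
      the closed lower half-plane.\<close>
    have "poly (pderiv r) t / poly r t = 1 / (t - \<rho>) + poly (pderiv q) t / poly q t"
    proof -
      have "poly (pderiv r) t = (t - \<rho>) * poly (pderiv q) t + poly q t"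
        unfolding q pderiv_mult by (simp add: pderiv_pCons algebra_simps)
      moreover have "poly r t = (t - \<rho>) * poly q t" by (simp add: q algebra_simps)
      ultimately show ?thesis using \<open>t - \<rho> \<noteq> 0\<close> nz[OF t] by (simp add: divide_simps)
    qed
    with * IH show ?thesis by simp
  qed
qed

text \<open>A zero at \<open>t\<close> would give the logarithmic derivative of \<open>r\<close> the
  value \<open>- 1 / x\<close>, whose imaginary part is positive, against
  \<open>Im_logderiv_nonpos\<close>.\<close>

lemma add_mult_pderiv_nonzero:
  fixes r :: "complex poly"
  assumes nz: "\<And>t. Im t > 0 \<Longrightarrow> poly r t \<noteq> 0" and t: "Im t > 0" and x: "Im x > 0"
  shows "poly (r + smult x (pderiv r)) t \<noteq> 0"
proof
  assume "poly (r + smult x (pderiv r)) t = 0"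
  moreover have "x \<noteq> 0" using x by auto
  ultimately have "poly (pderiv r) t / poly r t = - (1 / x)"
    using nz[OF t] by (simp add: field_simps) (metis add.commute add_eq_0_iff mult.commute)
  then have "Im (- (1 / x)) \<le> 0" using Im_logderiv_nonpos[OF nz t] by metis
  moreover have "Im (- (1 / x)) = Im x / ((Re x)\<^sup>2 + (Im x)\<^sup>2)"
    by (simp add: Im_divide)
  moreover have "Im x / ((Re x)\<^sup>2 + (Im x)\<^sup>2) > 0"
    using x by (auto intro!: divide_pos_pos simp: sum_power2_gt_zero_iff)
  ultimately show False by linarith
qed

text \<open>Uniform continuity on compact sets makes \<open>\<Phi> 0\<close> a locally uniform limit
  of zero-free functions, so Hurwitz leaves only the constant case. The conclusion is phrased as
  transport of a zero from \<open>t0\<close> to \<open>t1\<close>, since in the applications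
  \<open>t1\<close> is a reference point at which non-vanishing is known.\<close>

lemma Hurwitz_family:
  fixes \<Phi> :: "real \<Rightarrow> complex \<Rightarrow> complex"
  assumes S: "open S" "connected S"
    and cont: "continuous_on ({0..1} \<times> S) (\<lambda>(u, t). \<Phi> u t)"
    and hol: "\<And>u. \<Phi> u holomorphic_on S"
    and nz: "\<And>u t. 0 < u \<Longrightarrow> u \<le> 1 \<Longrightarrow> t \<in> S \<Longrightarrow> \<Phi> u t \<noteq> 0"
    and t: "t0 \<in> S" "\<Phi> 0 t0 = 0" "t1 \<in> S"
  shows "\<Phi> 0 t1 = 0"
proof -
  have "\<Phi> 0 constant_on S"
  proof (rule ccontr)
    assume nc: "\<not> \<Phi> 0 constant_on S"
    have "\<Phi> 0 t0 \<noteq> 0"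
    proof (rule Hurwitz_no_zeros[OF S, of "\<lambda>n. \<Phi> (inverse (real (Suc n)))", OF _ _ _ nc _ t(1)])
      fix K assume K: "compact K" "K \<subseteq> S"
      have "compact ({0..1::real} \<times> K)" using K by (intro compact_Times) auto
      moreover have "continuous_on ({0..1} \<times> K) (\<lambda>(u, t). \<Phi> u t)"
        by (rule continuous_on_subset[OF cont]) (use K in auto)
      ultimately have uc: "uniformly_continuous_on ({0..1} \<times> K) (\<lambda>(u, t). \<Phi> u t)"
        by (rule compact_uniformly_continuous[rotated])
      show "uniform_limit K (\<lambda>n. \<Phi> (inverse (real (Suc n)))) (\<Phi> 0) sequentially"
      proof (rule uniform_limitI)
        fix e :: real assume "e > 0"
        then obtain d where d: "d > 0" "\<And>a b. a \<in> {0..1} \<times> K \<Longrightarrow> b \<in> {0..1} \<times> K \<Longrightarrow>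
            dist b a < d \<Longrightarrow> dist ((\<lambda>(u, t). \<Phi> u t) b) ((\<lambda>(u, t). \<Phi> u t) a) < e"
          using uc unfolding uniformly_continuous_on_def by metis
        have "\<forall>\<^sub>F n in sequentially. inverse (real (Suc n)) < d"
          using LIMSEQ_inverse_real_of_nat d(1) by (auto simp: order_tendsto_iff)
        then show "\<forall>\<^sub>F n in sequentially. \<forall>x\<in>K. dist (\<Phi> (inverse (real (Suc n))) x) (\<Phi> 0 x) < e"
        proof eventually_elim
          case (elim n)
          have "inverse (real (Suc n)) \<le> 1"
            by (simp add: inverse_eq_divide)
          then show ?case
            using d(2)[of "(0, x)" "(inverse (real (Suc n)), x)" for x] elim
            by (auto simp: dist_Pair_Pair dist_real_def)
        qed
      qed
    next
      fix n t assume "t \<in> S"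
      then show "\<Phi> (inverse (real (Suc n))) t \<noteq> 0"
        by (intro nz) (auto simp: inverse_eq_divide)
    qed (auto intro: hol)
    with t show False by simp
  qed
  with t show ?thesis unfolding constant_on_def by metis
qed

section \<open>The capacity inequality for multiaffine polynomials\<close>

text \<open>Coefficients are indexed by two sets of variables, so that splitting off or contracting
  the pair \<open>i\<close> only replaces \<open>S\<close> and \<open>R\<close> by
  \<open>insert i S\<close> and \<open>insert i R\<close> in the coefficient function.\<close>

definition biaffine :: "'a set \<Rightarrow> ('a set \<Rightarrow> 'a set \<Rightarrow> 'b) \<Rightarrow> ('a \<Rightarrow> 'b) \<Rightarrow> ('a \<Rightarrow> 'b) \<Rightarrow> 'b::comm_semiring_1"
  where "biaffine I c y z = (\<Sum>S\<in>Pow I. \<Sum>R\<in>Pow I. c S R * (\<Prod>i\<in>S. y i) * (\<Prod>i\<in>R. z i))"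

lemma sum_Pow_insert:
  assumes "finite J" "i \<notin> J"
  shows "(\<Sum>S\<in>Pow (insert i J). f S) = (\<Sum>S\<in>Pow J. f S + f (insert i S))"
proof -
  have "inj_on (insert i) (Pow J)" using assms by (auto simp: inj_on_def)
  moreover have "Pow J \<inter> insert i ` Pow J = {}" using assms by auto
  ultimately show ?thesis using assms(1)
    by (simp add: Pow_insert sum.union_disjoint sum.reindex sum.distrib)
qed

lemma biaffine_insert:
  assumes "finite J" "i \<notin> J"
  shows "biaffine (insert i J) c y z =
    biaffine J c y z + y i * biaffine J (\<lambda>S R. c (insert i S) R) y z +
    z i * biaffine J (\<lambda>S R. c S (insert i R)) y z +
    y i * z i * biaffine J (\<lambda>S R. c (insert i S) (insert i R)) y z"
proof -
  have [simp]: "(\<Prod>k\<in>insert i S. y k) = y i * (\<Prod>k\<in>S. y k)" if "S \<subseteq> J" for S and y :: "'a \<Rightarrow> 'b"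
    using that assms finite_subset by (subst prod.insert) auto
  show ?thesis
    unfolding biaffine_def
    by (simp add: sum_Pow_insert[OF assms] sum.distrib sum_distrib_left algebra_simps)
qed

lemma biaffine_add: "biaffine J (\<lambda>S R. c S R + d S R) y z = biaffine J c y z + biaffine J d y z"
  unfolding biaffine_def by (simp add: sum.distrib algebra_simps)

lemma biaffine_cong:
  assumes "\<And>i. i \<in> J \<Longrightarrow> y i = y' i" "\<And>i. i \<in> J \<Longrightarrow> z i = z' i"
  shows "biaffine J c y z = biaffine J c y' z'"
  unfolding biaffine_def
  by (intro sum.cong refl arg_cong2[where f="(*)"] prod.cong) (use assms in auto)

lemma biaffine_of_real:
  "biaffine J (\<lambda>S R. of_real (c S R)) (\<lambda>i. of_real (y i)) (\<lambda>i. of_real (z i)) =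
   (of_real (biaffine J c y z) :: complex)"
  unfolding biaffine_def by simp

lemma biaffine_nonneg:
  fixes c :: "'a set \<Rightarrow> 'a set \<Rightarrow> real"
  assumes "\<And>S R. S \<subseteq> I \<Longrightarrow> R \<subseteq> I \<Longrightarrow> 0 \<le> c S R" "\<And>i. i \<in> I \<Longrightarrow> 0 \<le> y i" "\<And>i. i \<in> I \<Longrightarrow> 0 \<le> z i"
  shows "0 \<le> biaffine I c y z"
  unfolding biaffine_def by (intro sum_nonneg mult_nonneg_nonneg prod_nonneg) (use assms in auto)

lemma continuous_on_biaffine:
  fixes y z :: "'x::topological_space \<Rightarrow> 'a \<Rightarrow> complex"
  assumes "\<And>i. i \<in> I \<Longrightarrow> continuous_on X (\<lambda>x. y x i)" "\<And>i. i \<in> I \<Longrightarrow> continuous_on X (\<lambda>x. z x i)"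
  shows "continuous_on X (\<lambda>x. biaffine I c (y x) (z x))"
  unfolding biaffine_def by (intro continuous_intros) (use assms in auto)

lemma holomorphic_on_biaffine:
  assumes "\<And>i. i \<in> I \<Longrightarrow> (\<lambda>x. y x i) holomorphic_on X" "\<And>i. i \<in> I \<Longrightarrow> (\<lambda>x. z x i) holomorphic_on X"
  shows "(\<lambda>x. biaffine I c (y x) (z x)) holomorphic_on X"
  unfolding biaffine_def by (intro holomorphic_intros) (use assms in auto)

text \<open>Opposite half-planes are what the substitution \<open>z i = 1 / y i\<close> respects.
  For real coefficients, stability in \<open>z\<close> over the upper half-plane is the same as over
  the lower one, by conjugation.\<close>

definition bistable :: "'a set \<Rightarrow> ('a set \<Rightarrow> 'a set \<Rightarrow> real) \<Rightarrow> bool" where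
  "bistable I c \<longleftrightarrow> (\<forall>y z. (\<forall>i\<in>I. Im (y i) > 0 \<and> Im (z i) < 0) \<longrightarrow>
     biaffine I (\<lambda>S R. complex_of_real (c S R)) y z \<noteq> 0)"

text \<open>The parameters for which a complex line stays in a product of half-planes form a
  connected open set. This supplies the one-variable domain for
  \<open>Hurwitz_family\<close>.\<close>

lemma open_convex_Im_family:
  fixes a b :: "'a \<Rightarrow> complex"
  assumes "finite J"
  shows "open {t. \<forall>i\<in>J. 0 < Im (a i + t * b i)}" "convex {t. \<forall>i\<in>J. 0 < Im (a i + t * b i)}"
proof -
  have eq: "{t. \<forall>i\<in>J. 0 < Im (a i + t * b i)} = (\<Inter>i\<in>J. {t. 0 < Im (a i + t * b i)})" by auto
  show "open {t. \<forall>i\<in>J. 0 < Im (a i + t * b i)}" unfolding eq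
    using assms by (intro open_INT ballI open_Collect_less continuous_intros)
  show "convex {t. \<forall>i\<in>J. 0 < Im (a i + t * b i)}"
    unfolding convex_def
  proof (intro ballI allI impI, clarify)
    fix s t i and u v :: real
    assume *: "\<forall>i\<in>J. 0 < Im (a i + s * b i)" "\<forall>i\<in>J. 0 < Im (a i + t * b i)" "0 \<le> u" "0 \<le> v" "u + v = 1" "i \<in> J"
    have "a i + (u *\<^sub>R s + v *\<^sub>R t) * b i = u *\<^sub>R (a i + s * b i) + v *\<^sub>R (a i + t * b i)"
      using \<open>u + v = 1\<close> by (simp add: algebra_simps flip: scaleR_add_left)
    then have "Im (a i + (u *\<^sub>R s + v *\<^sub>R t) * b i) = u * Im (a i + s * b i) + v * Im (a i + t * b i)"
      by simp
    moreover have "\<dots> > 0"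
      using * by (metis add.commute add_0 add_nonneg_pos less_eq_real_def mult_nonneg_nonneg mult_pos_pos zero_neq_one)
    ultimately show "0 < Im (a i + (u *\<^sub>R s + v *\<^sub>R t) * b i)" by simp
  qed
qed

text \<open>
  Along \<open>z i = 1 / y i\<close> a bistable \<open>a + b y + c z + d y z\<close> becomes, up to a factor, the stable
  quadratic \<open>c + (a + d) y + b y\<^sup>2\<close>; the operator \<open>r + x r'\<close> at \<open>\<i>u\<close>, \<open>x = \<i>/u\<close> isolates its middle
  coefficient as \<open>u \<rightarrow> 0\<close>.
\<close>

lemma bistable_contract:
  assumes J: "finite J" "i \<notin> J" and st: "bistable (insert i J) c"
    and yz: "\<And>i. i \<in> J \<Longrightarrow> 0 < y1 i" "\<And>i. i \<in> J \<Longrightarrow> 0 < z1 i"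
    and nz: "biaffine J (\<lambda>S R. c S R + c (insert i S) (insert i R)) y1 z1 \<noteq> (0::real)"
  shows "bistable J (\<lambda>S R. c S R + c (insert i S) (insert i R))"
proof -
  define C where "C = (\<lambda>S R. complex_of_real (c S R))"
  define F where "F = biaffine J (\<lambda>S R. C S R + C (insert i S) (insert i R))"
  define g where "g = biaffine J (\<lambda>S R. C S (insert i R))"
  define h where "h = biaffine J (\<lambda>S R. C (insert i S) R)"
  have key: "F y z * (1 + complex_of_real u ^ 2) - \<i> * u * (g y z - 2 * h y z - h y z * u ^ 2) \<noteq> 0"
    if D: "\<And>i. i \<in> J \<Longrightarrow> Im (y i) > 0 \<and> Im (z i) < 0" and u: "0 < u" for y z u
  proof -
    have "poly [:g y z, F y z, h y z:] t \<noteq> 0" if t: "Im t > 0" for t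
    proof -
      let ?y = "y(i := t)" and ?z = "z(i := 1 / t)"
      have "t \<noteq> 0" using t by auto
      have "Im (1 / t) = - Im t / ((Re t)\<^sup>2 + (Im t)\<^sup>2)" by (simp add: Im_divide)
      moreover have "(Re t)\<^sup>2 + (Im t)\<^sup>2 > 0" using t by (auto simp: sum_power2_gt_zero_iff)
      ultimately have "Im (1 / t) < 0" using t by (simp add: divide_neg_pos)
      then have "biaffine (insert i J) C ?y ?z \<noteq> 0"
        using st D t J(2) unfolding bistable_def C_def by auto
      moreover have "biaffine J A ?y ?z = biaffine J A y z" for A
        by (rule biaffine_cong) (use J(2) in auto)
      ultimately have "biaffine J C y z + t * h y z + (1 / t) * g y z +
          biaffine J (\<lambda>S R. C (insert i S) (insert i R)) y z \<noteq> 0"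
        using J \<open>t \<noteq> 0\<close> by (simp add: biaffine_insert g_def h_def del: fun_upd_apply) (simp add: \<open>t \<noteq> 0\<close>)
      then have "t * (F y z + t * h y z + (1 / t) * g y z) \<noteq> 0"
        using \<open>t \<noteq> 0\<close> by (simp add: F_def biaffine_add ac_simps)
      moreover have "t * (F y z + t * h y z + (1 / t) * g y z) = poly [:g y z, F y z, h y z:] t"
        using \<open>t \<noteq> 0\<close> by (simp add: distrib_left)
      ultimately show ?thesis by (simp only: simp_thms)
    qed
    from add_mult_pderiv_nonzero[OF this, of "\<i> * u" "\<i> / u"] u
    have "poly ([:g y z, F y z, h y z:] + smult (\<i> / u) (pderiv [:g y z, F y z, h y z:])) (\<i> * u) \<noteq> 0"
      by (simp add: Im_divide power2_eq_square)
    then have "- \<i> * u * poly ([:g y z, F y z, h y z:] + smult (\<i> / u) (pderiv [:g y z, F y z, h y z:])) (\<i> * u) \<noteq> 0"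
      using u by simp
    moreover have "- \<i> * u * poly ([:g y z, F y z, h y z:] + smult (\<i> / u) (pderiv [:g y z, F y z, h y z:])) (\<i> * u) =
      F y z * (1 + complex_of_real u ^ 2) - \<i> * u * (g y z - 2 * h y z - h y z * u ^ 2)"
      using u by (simp add: pderiv_pCons field_simps power2_eq_square)
    ultimately show ?thesis by (simp only: simp_thms)
  qed
  have F_eq: "F = biaffine J (\<lambda>S R. complex_of_real (c S R + c (insert i S) (insert i R)))"
    by (simp add: F_def C_def)
  \<comment> \<open>Non-vanishing is given at a positive real point, which lies on the boundary of
    the domain; by continuity it persists at some point pushed into the half-planes.\<close>
  have "\<exists>e>0. F (\<lambda>i. of_real (y1 i) + \<i> * of_real e) (\<lambda>i. of_real (z1 i) - \<i> * of_real e) \<noteq> 0"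
  proof (rule ccontr)
    let ?f = "\<lambda>e. F (\<lambda>i. of_real (y1 i) + \<i> * of_real e) (\<lambda>i. of_real (z1 i) - \<i> * of_real e)"
    assume "\<not> ?thesis"
    then have *: "?f e = 0" if "e > 0" for e using that by auto
    have "continuous_on UNIV ?f" unfolding F_def
      by (intro continuous_on_biaffine continuous_intros)
    then have "(?f \<longlongrightarrow> ?f 0) (at 0)" unfolding continuous_on_def by blast
    then have "(?f \<longlongrightarrow> ?f 0) (at_right 0)"
      by (rule tendsto_mono[rotated]) (simp add: at_le)
    moreover have "(?f \<longlongrightarrow> 0) (at_right 0)"
      by (rule tendsto_eventually, rule eventually_at_rightI[of 0 1]) (simp_all only: * greaterThanLessThan_iff zero_less_one)
    ultimately have "?f 0 = 0" by (rule tendsto_unique[OF trivial_limit_at_right_real])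
    moreover have "?f 0 = of_real (biaffine J (\<lambda>S R. c S R + c (insert i S) (insert i R)) y1 z1)"
      by (simp add: F_eq biaffine_of_real del: of_real_add)
    ultimately show False using nz by simp
  qed
  then obtain e where e: "e > 0"
    "F (\<lambda>i. of_real (y1 i) + \<i> * of_real e) (\<lambda>i. of_real (z1 i) - \<i> * of_real e) \<noteq> 0" by auto
  define y2 where "y2 = (\<lambda>i. of_real (y1 i) + \<i> * of_real e)"
  define z2 where "z2 = (\<lambda>i. of_real (z1 i) - \<i> * of_real e)"
  show ?thesis
    unfolding bistable_def F_eq[symmetric]
  proof (intro allI impI notI)
    fix y z assume D: "\<forall>i\<in>J. Im (y i) > 0 \<and> Im (z i) < 0" and "F y z = 0"
    \<comment> \<open>The complex line from the supposed zero at \<open>t = 0\<close> to the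
      reference point at \<open>t = 1\<close>.\<close>
    define Y where "Y = (\<lambda>t i. y i + t * (y2 i - y i))"
    define Z where "Z = (\<lambda>t i. z i + t * (z2 i - z i))"
    define \<Phi> where "\<Phi> = (\<lambda>u t. F (Y t) (Z t) * (1 + complex_of_real u ^ 2) -
      \<i> * u * (g (Y t) (Z t) - 2 * h (Y t) (Z t) - h (Y t) (Z t) * u ^ 2))"
    define S where "S = {t. \<forall>i\<in>J. 0 < Im (Y t i)} \<inter> {t. \<forall>i\<in>J. 0 < Im (- Z t i)}"
    have Zm: "- Z t i = - z i + t * (z i - z2 i)" for t i by (simp add: Z_def algebra_simps)
    have S_eq: "S = {t. \<forall>i\<in>J. 0 < Im (y i + t * (y2 i - y i))} \<inter>
        {t. \<forall>i\<in>J. 0 < Im (- z i + t * (z i - z2 i))}"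
      by (simp only: S_def Y_def Zm)
    have S: "open S" "connected S"
      unfolding S_eq
      by (intro open_Int convex_connected convex_Int open_convex_Im_family[OF J(1)])+
    have inS: "\<And>i. i \<in> J \<Longrightarrow> Im (Y t i) > 0 \<and> Im (Z t i) < 0" if "t \<in> S" for t
      using that by (auto simp: S_def)
    have "\<Phi> 0 1 = 0"
    proof (rule Hurwitz_family[OF S, where \<Phi>=\<Phi>])
      show "continuous_on ({0..1} \<times> S) (\<lambda>(u, t). \<Phi> u t)"
        unfolding \<Phi>_def F_def g_def h_def case_prod_unfold Y_def Z_def
        by (intro continuous_intros continuous_on_biaffine)
      show "\<Phi> u holomorphic_on S" for u
        unfolding \<Phi>_def F_def g_def h_def Y_def Z_def
        by (intro holomorphic_intros holomorphic_on_biaffine)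
      show "\<Phi> u t \<noteq> 0" if "0 < u" "u \<le> 1" "t \<in> S" for u t
        unfolding \<Phi>_def by (intro key inS that)
      show "0 \<in> S" using D by (auto simp: S_def Y_def Z_def)
      show "1 \<in> S" using e by (auto simp: S_def Y_def Z_def y2_def z2_def)
      show "\<Phi> 0 0 = 0" using \<open>F y z = 0\<close> by (simp add: \<Phi>_def Y_def Z_def)
    qed
    then show False using e by (simp add: \<Phi>_def Y_def Z_def y2_def z2_def)
  qed
qed

text \<open>With \<open>y i = \<i>\<close> the polynomial is affine in \<open>z i\<close>, and at
  real values of the other variables its root has imaginary part
  \<open>(a d - b c) / (c^2 + d^2)\<close>. Were this negative, it would stay negative after moving
  the other variables slightly off the real axis, and the root would contradict bistability.\<close>

lemma bistable_det:
  fixes y z :: "'a \<Rightarrow> real"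
  assumes J: "finite J" "i \<notin> J" and st: "bistable (insert i J) c"
    and nn: "\<And>S R. S \<subseteq> insert i J \<Longrightarrow> R \<subseteq> insert i J \<Longrightarrow> 0 \<le> c S R"
    and yz: "\<And>i. i \<in> J \<Longrightarrow> 0 < y i" "\<And>i. i \<in> J \<Longrightarrow> 0 < z i"
  shows "biaffine J (\<lambda>S R. c (insert i S) R) y z * biaffine J (\<lambda>S R. c S (insert i R)) y z
    \<le> biaffine J c y z * biaffine J (\<lambda>S R. c (insert i S) (insert i R)) y z" (is "?b * ?c \<le> ?a * ?d")
proof (rule ccontr)
  assume lt: "\<not> ?thesis"
  have "0 \<le> biaffine J A y z" if "\<And>S R. S \<subseteq> J \<Longrightarrow> R \<subseteq> J \<Longrightarrow> 0 \<le> A S R" for A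
    by (rule biaffine_nonneg) (simp_all add: that yz less_imp_le)
  then have nonneg: "0 \<le> ?a" "0 \<le> ?b" "0 \<le> ?c" "0 \<le> ?d"
    by (simp_all add: nn subset_insertI2 insert_mono)
  have "?c \<noteq> 0"
  proof
    assume "?c = 0"
    with lt have "\<not> 0 \<le> ?a * ?d" by simp
    with nonneg show False by simp
  qed
  define C where "C = (\<lambda>S R. complex_of_real (c S R))"
  define Y where "Y = (\<lambda>e j. of_real (y j) + \<i> * complex_of_real e)"
  define Z where "Z = (\<lambda>e j. of_real (z j) - \<i> * complex_of_real e)"
  define den where "den = (\<lambda>e. biaffine J (\<lambda>S R. C S (insert i R)) (Y e) (Z e)
    + biaffine J (\<lambda>S R. C (insert i S) (insert i R)) (Y e) (Z e) * \<i>)"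
  define num where "num = (\<lambda>e. biaffine J C (Y e) (Z e) + biaffine J (\<lambda>S R. C (insert i S) R) (Y e) (Z e) * \<i>)"
  have YZ0: "Y 0 = (\<lambda>j. of_real (y j))" "Z 0 = (\<lambda>j. of_real (z j))" by (simp_all add: Y_def Z_def)
  have den0: "den 0 = Complex ?c ?d" and num0: "num 0 = Complex ?a ?b"
    unfolding den_def num_def YZ0 C_def biaffine_of_real by (simp_all add: complex_eq_iff)
  have "den 0 \<noteq> 0" using \<open>?c \<noteq> 0\<close> by (simp add: den0 complex_eq_iff)
  have cont: "continuous_on UNIV den" "continuous_on UNIV num"
    unfolding den_def num_def Y_def Z_def by (intro continuous_intros continuous_on_biaffine)+
  then have lim: "(den \<longlongrightarrow> den 0) (at_right 0)" "(num \<longlongrightarrow> num 0) (at_right 0)"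
    unfolding continuous_on_def by (auto intro: tendsto_mono[OF at_le])
  then have "((\<lambda>e. Im (- num e / den e)) \<longlongrightarrow> Im (- num 0 / den 0)) (at_right 0)"
    using \<open>den 0 \<noteq> 0\<close> by (intro tendsto_intros)
  moreover have "Im (- num 0 / den 0) = (?a * ?d - ?b * ?c) / (?c\<^sup>2 + ?d\<^sup>2)"
    by (simp add: den0 num0 Im_divide diff_divide_distrib mult.commute)
  moreover have "\<dots> < 0"
    using lt \<open>?c \<noteq> 0\<close> by (intro divide_neg_pos) (auto simp: sum_power2_gt_zero_iff)
  ultimately have "\<forall>\<^sub>F e in at_right 0. Im (- num e / den e) < 0"
    using order_tendstoD(2) by metis
  moreover have "\<forall>\<^sub>F e in at_right 0. den e \<noteq> 0"
    using lim(1) \<open>den 0 \<noteq> 0\<close> tendsto_imp_eventually_ne by blast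
  moreover have "\<forall>\<^sub>F e in at_right (0::real). e > 0"
    by (simp add: eventually_at_right_less)
  ultimately have "\<forall>\<^sub>F e in at_right 0. Im (- num e / den e) < 0 \<and> den e \<noteq> 0 \<and> e > 0"
    by eventually_elim simp
  then obtain e where e: "Im (- num e / den e) < 0" "den e \<noteq> 0" "e > 0"
    using eventually_happens'[OF trivial_limit_at_right_real] by blast
  \<comment> \<open>All coordinates now lie in their half-planes, and \<open>z i\<close> is the root
    of \<open>num e + t * den e\<close>.\<close>
  let ?y = "(Y e)(i := \<i>)" and ?z = "(Z e)(i := - num e / den e)"
  have "biaffine (insert i J) C ?y ?z \<noteq> 0"
    using st e J(2) unfolding bistable_def C_def by (auto simp: Y_def Z_def)
  moreover have "biaffine (insert i J) C ?y ((Z e)(i := t)) = num e + t * den e" for t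
  proof -
    have "biaffine J A ?y ((Z e)(i := t)) = biaffine J A (Y e) (Z e)" for A
      by (rule biaffine_cong) (use J(2) in auto)
    then show ?thesis
      unfolding biaffine_insert[OF J] by (simp add: num_def den_def algebra_simps)
  qed
  ultimately show False using e(2) by simp
qed

text \<open>For \<open>0 <= a < 1\<close> this is the reciprocal of the capacity of
  \<open>1 + s\<close> at exponent \<open>a\<close>, the exponential of minus the binary entropy.
  The case \<open>a = 0\<close> is split off because \<open>0 powr 0 = 0\<close>; at
  \<open>a = 1\<close> the value is 0 instead of the limit 1, so exponents are kept below 1.\<close>

definition entropy_weight :: "real \<Rightarrow> real" where
  "entropy_weight a = (if a = 0 then 1 else a powr a) * (1 - a) powr (1 - a)"

lemma entropy_weight_nonneg: "0 \<le> entropy_weight a"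
  by (simp add: entropy_weight_def)

text \<open>Raising \<open>b\<close> and \<open>c\<close> until \<open>b c = a d\<close> makes the
  polynomial a product of a factor in \<open>y\<close> and one in \<open>z\<close>, without touching
  \<open>a + d\<close>. Testing the capacity at the minimizer of that product and applying weighted
  AM-GM to \<open>a / (1 - al)\<close> and \<open>d / al\<close> gives the bound.\<close>

lemma capacity_bilinear_pos:
  fixes a b c d K al :: real
  assumes nn: "0 < a" "0 \<le> b" "0 \<le> c" "0 < d" and det: "b * c \<le> a * d" and al: "0 \<le> al" "al < 1"
    and cap: "\<And>y z. 0 < y \<Longrightarrow> 0 < z \<Longrightarrow> K * (y * z) powr al \<le> a + b * y + c * z + d * (y * z)"
  shows "K * entropy_weight al \<le> a + d"
proof -
  \<comment> \<open>Enlarging one coefficient suffices unless both vanish; then \<open>a\<close> and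
    \<open>d\<close> themselves serve.\<close>
  obtain b' c' where bc: "b \<le> b'" "c \<le> c'" "b' * c' = a * d" "0 < b'" "0 < c'"
  proof -
    consider "c > 0" | "c = 0" "b > 0" | "c = 0" "b = 0" using nn by linarith
    then show ?thesis
    proof cases
      case 1
      then show ?thesis using nn det by (intro that[of "a * d / c" c]) (auto simp: field_simps)
    next
      case 2
      then show ?thesis using nn det by (intro that[of b "a * d / b"]) (auto simp: field_simps)
    next
      case 3
      then show ?thesis using nn by (intro that[of a d]) auto
    qed
  qed
  \<comment> \<open>The test points equalize the two factors \<open>1 + b' y / a\<close> and
    \<open>1 + c' z / a\<close>, both becoming \<open>1 + r\<close>.\<close>
  have main: "K * (r\<^sup>2 * a / d) powr al \<le> a * (1 + r)\<^sup>2" if r: "r > 0" for r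
  proof -
    let ?y = "r * a / b'" and ?z = "r * a / c'"
    have yz: "?y * ?z = r\<^sup>2 * a / d"
    proof -
      have "?y * ?z = r\<^sup>2 * a * a / (b' * c')" by (simp add: power2_eq_square)
      then show ?thesis using bc(3) nn by simp
    qed
    have "K * (?y * ?z) powr al \<le> a + b * ?y + c * ?z + d * (?y * ?z)"
      using r nn bc by (intro cap) auto
    also have "\<dots> \<le> a + b' * ?y + c' * ?z + d * (?y * ?z)"
      using r nn bc by (intro add_mono mult_right_mono) auto
    also have "\<dots> = a * (1 + r)\<^sup>2"
      unfolding yz using bc nn by (simp add: power2_eq_square algebra_simps)
    finally show ?thesis unfolding yz .
  qed
  show ?thesis
  proof (cases "al = 0")
    case True
    \<comment> \<open>At exponent 0 the minimizer degenerates to \<open>r = 0\<close>, which is not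
      an admissible test point, so it is approached from the right.\<close>
    have "((\<lambda>r. a * (1 + r)\<^sup>2) \<longlongrightarrow> a * (1 + 0)\<^sup>2) (at_right 0)"
      by (intro tendsto_intros)
    moreover have "\<forall>\<^sub>F r in at_right 0. K \<le> a * (1 + r)\<^sup>2"
    proof (rule eventually_at_rightI[of 0 1])
      fix r :: real assume "r \<in> {0<..<1}"
      then have "r > 0" by simp
      from main[OF this] this nn True show "K \<le> a * (1 + r)\<^sup>2" by simp
    qed simp
    ultimately have "K \<le> a * (1 + 0)\<^sup>2"
      using tendsto_lowerbound trivial_limit_at_right_real by blast
    then show ?thesis using True nn by (simp add: entropy_weight_def)
  next
    case False
    with al have al: "0 < al" "al < 1" by auto
    define X where "X = a / (1 - al)"
    define Y where "Y = d / al"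
    have XY: "X > 0" "Y > 0" using nn al by (auto simp: X_def Y_def)
    \<comment> \<open>The value \<open>r = al / (1 - al)\<close> minimizes
      \<open>(1 + r)^2 / r^(2 al)\<close>.\<close>
    have "K * ((al / (1 - al))\<^sup>2 * a / d) powr al \<le> a * (1 + al / (1 - al))\<^sup>2"
      using al by (intro main) auto
    moreover have "(al / (1 - al))\<^sup>2 * a / d = al / (1 - al) * X / Y"
      using al nn by (simp add: X_def Y_def power2_eq_square)
    moreover have "1 + al / (1 - al) = 1 / (1 - al)" using al by (simp add: field_simps)
    then have "a * (1 + al / (1 - al))\<^sup>2 = X / (1 - al)"
      by (simp add: X_def power2_eq_square)
    ultimately have "K * (al / (1 - al) * X / Y) powr al \<le> X / (1 - al)" by simp
    then have "K * (al / (1 - al) * X / Y) powr al * (Y powr al * X powr (- al) * (1 - al)) \<le>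
        X / (1 - al) * (Y powr al * X powr (- al) * (1 - al))"
      using al by (intro mult_right_mono) auto
    moreover have "X / (1 - al) * (Y powr al * X powr (- al) * (1 - al)) = X powr (1 - al) * Y powr al"
      using al XY by (simp add: powr_diff powr_minus field_simps)
    moreover have "(al / (1 - al) * X / Y) powr al * (Y powr al * X powr (- al) * (1 - al)) = entropy_weight al"
    proof -
      have "(al / (1 - al) * X / Y) powr al = al powr al / (1 - al) powr al * X powr al / Y powr al"
        using al XY by (simp add: powr_mult powr_divide)
      moreover have "(1 - al) powr (1 - al) = (1 - al) / (1 - al) powr al" "X powr (- al) = 1 / X powr al"
        using al by (simp_all add: powr_diff powr_minus_divide)
      moreover have "(1 - al) powr al \<noteq> 0" "X powr al \<noteq> 0" "Y powr al \<noteq> 0" using al XY by auto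
      ultimately show ?thesis using al by (simp add: entropy_weight_def)
    qed
    ultimately have "K * entropy_weight al \<le> X powr (1 - al) * Y powr al" by (simp add: mult.assoc)
    also have "\<dots> \<le> (1 - al) * X + al * Y" using al XY by (intro Youngs_inequality_0) auto
    also have "\<dots> = a + d" using al by (simp add: X_def Y_def)
    finally show ?thesis .
  qed
qed

text \<open>Adding \<open>e / 2\<close> to both \<open>a\<close> and \<open>d\<close> makes them
  positive, preserves the determinant condition and the capacity bound, and costs only
  \<open>e\<close> in the conclusion.\<close>

lemma capacity_bilinear:
  fixes a b c d K al :: real
  assumes nn: "0 \<le> a" "0 \<le> b" "0 \<le> c" "0 \<le> d" and det: "b * c \<le> a * d" and al: "0 \<le> al" "al < 1"
    and cap: "\<And>y z. 0 < y \<Longrightarrow> 0 < z \<Longrightarrow> K * (y * z) powr al \<le> a + b * y + c * z + d * (y * z)"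
  shows "K * entropy_weight al \<le> a + d"
proof (rule field_le_epsilon)
  fix e :: real assume e: "e > 0"
  have "K * entropy_weight al \<le> (a + e / 2) + (d + e / 2)"
  proof (rule capacity_bilinear_pos[of _ b c])
    have "a * d \<le> (a + e / 2) * (d + e / 2)" using nn e by (intro mult_mono) auto
    with det show "b * c \<le> (a + e / 2) * (d + e / 2)" by simp
    fix y z :: real assume yz: "0 < y" "0 < z"
    have "0 \<le> e / 2 * (y * z)" using yz e by simp
    with cap[OF yz] e show "K * (y * z) powr al \<le> a + e / 2 + b * y + c * z + (d + e / 2) * (y * z)"
      by (simp add: distrib_right)
  qed (use nn e al in auto)
  then show "K * entropy_weight al \<le> a + d + e" by simp
qed

text \<open>Each contraction turns the constant \<open>K\<close> into
  \<open>K * entropy_weight (al i)\<close> while keeping the diagonal sum, so the induction ends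
  with the diagonal sum as a single number.\<close>

theorem capacity_biaffine:
  fixes c :: "'a set \<Rightarrow> 'a set \<Rightarrow> real"
  assumes "finite I" and nn: "\<And>S R. S \<subseteq> I \<Longrightarrow> R \<subseteq> I \<Longrightarrow> 0 \<le> c S R" and st: "bistable I c"
    and al: "\<And>i. i \<in> I \<Longrightarrow> 0 \<le> al i \<and> al i < 1"
    and cap: "\<And>y z. (\<And>i. i \<in> I \<Longrightarrow> 0 < y i \<and> 0 < z i) \<Longrightarrow>
      K * (\<Prod>i\<in>I. (y i * z i) powr al i) \<le> biaffine I c y z"
  shows "K * (\<Prod>i\<in>I. entropy_weight (al i)) \<le> (\<Sum>S\<in>Pow I. c S S)"
  using assms
proof (induction I arbitrary: c K rule: finite_induct)
  case empty
  from empty.prems(4)[of "\<lambda>_. 1" "\<lambda>_. 1"] show ?case by (simp add: biaffine_def)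
next
  case (insert i J)
  define c' where "c' = (\<lambda>S R. c S R + c (insert i S) (insert i R))"
  let ?H = "entropy_weight (al i)"
  have cap': "K * ?H * (\<Prod>i\<in>J. (y i * z i) powr al i) \<le> biaffine J c' y z"
    if yz: "\<And>i. i \<in> J \<Longrightarrow> 0 < y i \<and> 0 < z i" for y z
  proof -
    let ?P = "\<Prod>i\<in>J. (y i * z i) powr al i"
    have "K * ?P * ?H \<le> biaffine J c y z + biaffine J (\<lambda>S R. c (insert i S) (insert i R)) y z"
    proof (rule capacity_bilinear)
      show "biaffine J (\<lambda>S R. c (insert i S) R) y z * biaffine J (\<lambda>S R. c S (insert i R)) y z
          \<le> biaffine J c y z * biaffine J (\<lambda>S R. c (insert i S) (insert i R)) y z"
        using insert.hyps insert.prems(1,2) yz by (intro bistable_det) auto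
      fix s t :: real assume st: "0 < s" "0 < t"
      let ?y = "y(i := s)" and ?z = "z(i := t)"
      have cong: "biaffine J A ?y ?z = biaffine J A y z" for A
        by (rule biaffine_cong) (use insert.hyps in auto)
      have "K * (\<Prod>i\<in>insert i J. (?y i * ?z i) powr al i) \<le> biaffine (insert i J) c ?y ?z"
        using yz st by (intro insert.prems) auto
      moreover have "(\<Prod>k\<in>J. (?y k * ?z k) powr al k) = ?P"
        using insert.hyps by (intro prod.cong) auto
      ultimately show "K * ?P * (s * t) powr al i \<le> biaffine J c y z +
         biaffine J (\<lambda>S R. c (insert i S) R) y z * s + biaffine J (\<lambda>S R. c S (insert i R)) y z * t +
         biaffine J (\<lambda>S R. c (insert i S) (insert i R)) y z * (s * t)"
        using insert.hyps unfolding biaffine_insert[OF insert.hyps] cong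
        by (simp add: ac_simps)
    next
      have "0 \<le> biaffine J A y z" if "\<And>S R. S \<subseteq> J \<Longrightarrow> R \<subseteq> J \<Longrightarrow> 0 \<le> A S R" for A
        by (rule biaffine_nonneg) (simp_all add: that yz less_imp_le)
      then show "0 \<le> biaffine J c y z" "0 \<le> biaffine J (\<lambda>S R. c (insert i S) R) y z"
        "0 \<le> biaffine J (\<lambda>S R. c S (insert i R)) y z"
        "0 \<le> biaffine J (\<lambda>S R. c (insert i S) (insert i R)) y z"
        by (simp_all add: insert.prems(1) subset_insertI2 insert_mono)
    qed (use insert.prems(3) in auto)
    then show ?thesis by (simp add: c'_def biaffine_add ac_simps)
  qed
  have nn': "0 \<le> c' S R" if "S \<subseteq> J" "R \<subseteq> J" for S R
    using that unfolding c'_def by (simp add: insert.prems(1) subset_insertI2 insert_mono)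
  have sum_eq: "(\<Sum>S\<in>Pow (insert i J). c S S) = (\<Sum>S\<in>Pow J. c' S S)"
    unfolding c'_def by (rule sum_Pow_insert[OF insert.hyps])
  have prod_eq: "K * (\<Prod>i\<in>insert i J. entropy_weight (al i)) = K * ?H * (\<Prod>i\<in>J. entropy_weight (al i))"
    using insert.hyps by simp
  show ?case
  proof (cases "bistable J c'")
    case True
    show ?thesis unfolding sum_eq prod_eq
      by (rule insert.IH[OF nn' True]) (use insert.prems cap' in auto)
  next
    case False
    \<comment> \<open>If stability is lost, the contraction vanishes at every positive point. The
      capacity bound at the all-ones point then forces the left side to be nonpositive, and the
      claim is trivial.\<close>
    then have "biaffine J c' (\<lambda>_. 1) (\<lambda>_. 1) = 0"
      using bistable_contract[OF insert.hyps insert.prems(2), of "\<lambda>_. 1" "\<lambda>_. 1"]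
      unfolding c'_def by auto
    then have "K * ?H \<le> 0" using cap'[of "\<lambda>_. 1" "\<lambda>_. 1"] by simp
    then have "K * ?H * (\<Prod>i\<in>J. entropy_weight (al i)) \<le> 0"
      by (rule mult_nonpos_nonneg) (simp add: prod_nonneg entropy_weight_nonneg)
    also have "\<dots> \<le> (\<Sum>S\<in>Pow J. c' S S)" by (intro sum_nonneg nn') auto
    finally show ?thesis unfolding sum_eq prod_eq .
  qed
qed

section \<open>Polarization\<close>

text \<open>The composition of the operators \<open>q \<mapsto> q + x\<^sub>j q'\<close>, \<open>j < N\<close>, expanded.\<close>

definition polar_op :: "(nat \<Rightarrow> complex) \<Rightarrow> nat \<Rightarrow> complex poly \<Rightarrow> complex poly" where
  "polar_op x N q = (\<Sum>A\<in>Pow {..<N}. smult (\<Prod>j\<in>A. x j) ((pderiv ^^ card A) q))"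

lemma smult_sum_right: "smult c (\<Sum>i\<in>A. f i) = (\<Sum>i\<in>A. smult c (f i))"
  by (induction A rule: infinite_finite_induct) (simp_all add: smult_add_right)

lemma pderiv_sum: "pderiv (\<Sum>i\<in>A. f i) = (\<Sum>i\<in>A. pderiv (f i))"
  using higher_pderiv_sum[of 1 f A] by simp

lemma polar_op_0: "polar_op x 0 q = q"
  by (simp add: polar_op_def)

lemma polar_op_Suc: "polar_op x (Suc N) q = polar_op x N q + smult (x N) (pderiv (polar_op x N q))"
proof -
  have "(\<Prod>j\<in>insert N A. x j) = x N * (\<Prod>j\<in>A. x j)" "card (insert N A) = Suc (card A)"
    if "A \<subseteq> {..<N}" for A
  proof -
    have "finite A" "N \<notin> A" using that finite_subset by auto
    then show "(\<Prod>j\<in>insert N A. x j) = x N * (\<Prod>j\<in>A. x j)" "card (insert N A) = Suc (card A)"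
      by simp_all
  qed
  then show ?thesis
    unfolding polar_op_def lessThan_Suc
    by (subst sum_Pow_insert) (simp_all add: sum.distrib smult_sum_right pderiv_sum pderiv_smult)
qed

definition esym :: "nat \<Rightarrow> nat \<Rightarrow> (nat \<Rightarrow> 'b) \<Rightarrow> 'b::comm_semiring_1" where
  "esym N k x = (\<Sum>A\<in>Pow {..<N}. if card A = k then \<Prod>j\<in>A. x j else 0)"

text \<open>Only the \<open>k\<close>-th derivative of the \<open>k\<close>-th power survives at 0;
  its value is the source of the factorials in the pairing.\<close>

lemma poly_polar_op_monom_0: "poly (polar_op x N (monom 1 k)) 0 = fact k * esym N k x"
proof -
  have "poly ((pderiv ^^ a) (monom 1 k)) 0 = (if a = k then fact k else 0 :: complex)" for a
    by (auto simp: poly_0_coeff_0 coeff_higher_pderiv pochhammer_fact)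
  then show ?thesis
    unfolding polar_op_def poly_sum esym_def sum_distrib_left by (intro sum.cong) auto
qed

text \<open>The operators act on variable \<open>i\<close> with \<open>v i\<close> parameters, and
  the result is evaluated at \<open>s\<close>. The use case is constant \<open>v\<close> and
  \<open>s = 0\<close>; the general form is what the induction on the number of operators
  needs.\<close>

definition polar_eval :: "'n::finite rpoly \<Rightarrow> ('n \<Rightarrow> nat) \<Rightarrow> ('n \<Rightarrow> nat \<Rightarrow> complex) \<Rightarrow> ('n \<Rightarrow> complex) \<Rightarrow> complex" where
  "polar_eval p v x s = (\<Sum>\<mu>\<in>Poly_Mapping.keys p. of_real (Poly_Mapping.lookup p \<mu>) *
     (\<Prod>i\<in>UNIV. poly (polar_op (x i) (v i) (monom 1 (Poly_Mapping.lookup \<mu> i))) (s i)))"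

text \<open>Removing one operator in a variable \<open>i0\<close> and freezing the other coordinates
  leaves a polynomial in one variable that is zero-free in the upper half-plane by induction;
  \<open>add_mult_pderiv_nonzero\<close> restores the operator.\<close>

lemma polar_eval_nonzero:
  fixes p :: "'n::finite rpoly"
  assumes st: "real_stable p" "p \<noteq> 0"
    and x: "\<And>i j. 0 < Im (x i j)" and s: "\<And>i. 0 < Im (s i)"
  shows "polar_eval p v x s \<noteq> 0"
  using s
proof (induction "\<Sum>i\<in>UNIV. v i" arbitrary: v s)
  case 0
  then have "v i = 0" for i by simp
  then have "polar_eval p v x s = eval_rpoly p (\<chi> i. s i)"
    by (simp add: polar_eval_def eval_rpoly_def monomial_at_def polar_op_0 poly_monom)
  moreover have "\<dots> \<noteq> 0" using st 0 by (simp add: real_stable_def)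
  ultimately show ?case by simp
next
  case (Suc m)
  from Suc.hyps(2) obtain i0 where "v i0 \<noteq> 0"
    by (metis Zero_not_Suc sum.neutral)
  then obtain k where k: "v i0 = Suc k" by (cases "v i0") auto
  define w where "w = v(i0 := k)"
  have "(\<Sum>i\<in>UNIV. v i) = v i0 + (\<Sum>i\<in>UNIV - {i0}. v i)" "(\<Sum>i\<in>UNIV. w i) = w i0 + (\<Sum>i\<in>UNIV - {i0}. w i)"
    by (simp_all add: sum.remove)
  moreover have "(\<Sum>i\<in>UNIV - {i0}. v i) = (\<Sum>i\<in>UNIV - {i0}. w i)"
    by (intro sum.cong) (auto simp: w_def)
  moreover have "w i0 = k" by (simp add: w_def)
  ultimately have wm: "m = (\<Sum>i\<in>UNIV. w i)" using Suc.hyps(2) k by linarith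
  let ?l = "Poly_Mapping.lookup"
  define rest where "rest = (\<lambda>\<mu>. \<Prod>i\<in>UNIV - {i0}. poly (polar_op (x i) (v i) (monom 1 (?l \<mu> i))) (s i))"
  define r where "r = (\<Sum>\<mu>\<in>Poly_Mapping.keys p. smult (of_real (?l p \<mu>) * rest \<mu>)
    (polar_op (x i0) k (monom 1 (?l \<mu> i0))))"
  have r: "poly r t = polar_eval p w x (s(i0 := t))" for t
  proof -
    have "(\<Prod>i\<in>UNIV. poly (polar_op (x i) (w i) (monom 1 (?l \<mu> i))) ((s(i0 := t)) i)) =
        poly (polar_op (x i0) k (monom 1 (?l \<mu> i0))) t * rest \<mu>" for \<mu>
    proof -
      have "(\<Prod>i\<in>UNIV - {i0}. poly (polar_op (x i) (w i) (monom 1 (?l \<mu> i))) ((s(i0 := t)) i)) = rest \<mu>"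
        unfolding rest_def by (intro prod.cong) (auto simp: w_def)
      then show ?thesis by (subst prod.remove[of _ i0]) (auto simp: w_def)
    qed
    then show ?thesis unfolding polar_eval_def r_def by (simp add: poly_sum ac_simps)
  qed
  have "poly (r + smult (x i0 k) (pderiv r)) (s i0) \<noteq> 0"
  proof (rule add_mult_pderiv_nonzero)
    fix t :: complex assume "Im t > 0"
    then have "\<And>i. 0 < Im ((s(i0 := t)) i)" using Suc.prems by simp
    from Suc.hyps(1)[OF wm this] show "poly r t \<noteq> 0" unfolding r .
  qed (use x Suc.prems in auto)
  moreover have "poly (r + smult (x i0 k) (pderiv r)) (s i0) = polar_eval p v x s"
  proof -
    have "(\<Prod>i\<in>UNIV. poly (polar_op (x i) (v i) (monom 1 (?l \<mu> i))) (s i)) =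
        poly (polar_op (x i0) (Suc k) (monom 1 (?l \<mu> i0))) (s i0) * rest \<mu>" for \<mu>
      unfolding rest_def by (subst prod.remove[of _ i0]) (auto simp: k)
    then show ?thesis
      unfolding polar_eval_def r_def
      by (simp add: polar_op_Suc poly_sum pderiv_sum pderiv_smult sum_distrib_left algebra_simps flip: sum.distrib)
  qed
  ultimately show ?case by simp
qed

lemma continuous_on_polar_eval:
  assumes "\<And>i j. continuous_on X (\<lambda>t. x t i j)" "\<And>i. continuous_on X (\<lambda>t. s t i)"
  shows "continuous_on X (\<lambda>t. polar_eval p v (x t) (s t))"
  unfolding polar_eval_def polar_op_def poly_sum poly_smult
  by (intro continuous_intros assms)

lemma holomorphic_on_polar_eval:
  assumes "\<And>i j. (\<lambda>t. x t i j) holomorphic_on X" 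
  shows "(\<lambda>t. polar_eval p v (x t) s) holomorphic_on X"
  unfolding polar_eval_def polar_op_def poly_sum poly_smult
  by (intro holomorphic_intros assms)

lemma polar_eval_of_real_0:
  "polar_eval p (\<lambda>_. N) (\<lambda>i j. of_real (x i j)) (\<lambda>_. 0) =
   of_real (\<Sum>\<mu>\<in>Poly_Mapping.keys p. Poly_Mapping.lookup p \<mu> *
     (\<Prod>i\<in>UNIV. fact (Poly_Mapping.lookup \<mu> i) * esym N (Poly_Mapping.lookup \<mu> i) (x i)))"
proof -
  have "esym N k (\<lambda>j. of_real (y j)) = complex_of_real (esym N k y)" for k y
    by (simp add: esym_def if_distrib cong: if_cong)
  then show ?thesis by (simp add: polar_eval_def poly_polar_op_monom_0)
qed

lemma esym_pos:
  fixes x :: "nat \<Rightarrow> real"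
  assumes "\<And>j. x j > 0" "k \<le> N"
  shows "esym N k x > 0"
  unfolding esym_def
proof (rule sum_pos2)
  show "{..<k} \<in> Pow {..<N}" using assms(2) by auto
qed (use assms in \<open>auto intro!: prod_pos prod_nonneg less_imp_le\<close>)

text \<open>The evaluation point \<open>s = 0\<close> is approached along \<open>s = \<i>u\<close>.\<close>

lemma polar_eval_0_nonzero:
  fixes p :: "'n::finite rpoly"
  assumes st: "real_stable p" "p \<noteq> 0" and nn: "nonneg_coeffs p"
    and N: "\<And>\<mu> i. \<mu> \<in> Poly_Mapping.keys p \<Longrightarrow> Poly_Mapping.lookup \<mu> i \<le> N"
    and x: "\<And>i j. 0 < Im (x i j)"
  shows "polar_eval p (\<lambda>_. N) x (\<lambda>_. 0) \<noteq> 0"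
proof
  assume zero: "polar_eval p (\<lambda>_. N) x (\<lambda>_. 0) = 0"
  let ?F = "\<lambda>x. polar_eval p (\<lambda>_. N) x (\<lambda>_. 0)"
  let ?one = "\<lambda>e (i::'n) (j::nat). complex_of_real 1 + \<i> * complex_of_real e"
  have "?F (?one e) = 0" if e: "e > 0" for e
  proof -
    define I where "I = (UNIV :: 'n set) \<times> {..<N}"
    define S where "S = {t. \<forall>q\<in>I. 0 < Im (x (fst q) (snd q) + t * (?one e (fst q) (snd q) - x (fst q) (snd q)))}"
    have S: "open S" "connected S"
      unfolding S_def by (intro convex_connected open_convex_Im_family; simp add: I_def)+
    \<comment> \<open>Only the finitely many entries with \<open>j < N\<close> matter, and only they
      are controlled by the domain \<open>S\<close>. The others are set to \<open>\<i>\<close>,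
      because \<open>polar_eval_nonzero\<close> asks for all of them in the upper
      half-plane.\<close>
    define X where "X = (\<lambda>t i j. if j < N then x i j + t * (?one e i j - x i j) else \<i>)"
    have X_eq: "polar_eval p (\<lambda>_. N) (X t) s = polar_eval p (\<lambda>_. N) (\<lambda>i j. x i j + t * (?one e i j - x i j)) s" for t s
    proof -
      have "polar_op (X t i) N q = polar_op (\<lambda>j. x i j + t * (?one e i j - x i j)) N q" for i q
        unfolding polar_op_def by (intro sum.cong refl arg_cong2[where f=smult] prod.cong) (auto simp: X_def)
      then show ?thesis by (simp add: polar_eval_def)
    qed
    define \<Phi> where "\<Phi> = (\<lambda>u t. polar_eval p (\<lambda>_. N) (X t) (\<lambda>_. \<i> * complex_of_real u))"
    have "\<Phi> 0 1 = 0"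
    proof (rule Hurwitz_family[OF S, where \<Phi>=\<Phi>])
      show "continuous_on ({0..1} \<times> S) (\<lambda>(u, t). \<Phi> u t)"
        unfolding \<Phi>_def X_eq case_prod_unfold
        by (intro continuous_intros continuous_on_polar_eval)
      show "\<Phi> u holomorphic_on S" for u
        unfolding \<Phi>_def X_eq by (intro holomorphic_intros holomorphic_on_polar_eval)
      show "\<Phi> u t \<noteq> 0" if "0 < u" "t \<in> S" for u t
        unfolding \<Phi>_def
        by (rule polar_eval_nonzero[OF st]) (use that in \<open>auto simp: X_def S_def I_def\<close>)
      show "0 \<in> S" "1 \<in> S" using x e by (auto simp: S_def)
      show "\<Phi> 0 0 = 0" using zero by (simp add: \<Phi>_def X_eq)
    qed
    then show ?thesis by (simp add: \<Phi>_def X_eq)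
  qed
  then have *: "?F (?one e) = 0" if "e > 0" for e using that by blast
  \<comment> \<open>A zero at \<open>x\<close> has spread to points arbitrarily near the all-ones
    point, hence to that point itself, where non-negative coefficients give a positive
    value.\<close>
  have "continuous_on UNIV (\<lambda>e. ?F (?one e))"
    by (intro continuous_intros continuous_on_polar_eval)
  then have "((\<lambda>e. ?F (?one e)) \<longlongrightarrow> ?F (?one 0)) (at 0)" unfolding continuous_on_def by blast
  then have "((\<lambda>e. ?F (?one e)) \<longlongrightarrow> ?F (?one 0)) (at_right 0)"
    by (rule tendsto_mono[rotated]) (simp add: at_le)
  moreover have "((\<lambda>e. ?F (?one e)) \<longlongrightarrow> 0) (at_right 0)"
    by (rule tendsto_eventually, rule eventually_at_rightI[of 0 1]) (simp_all only: * greaterThanLessThan_iff zero_less_one)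
  ultimately have "?F (?one 0) = 0" by (rule tendsto_unique[OF trivial_limit_at_right_real])
  then have "(\<Sum>\<mu>\<in>Poly_Mapping.keys p. Poly_Mapping.lookup p \<mu> *
     (\<Prod>i\<in>UNIV. fact (Poly_Mapping.lookup \<mu> i) * esym N (Poly_Mapping.lookup \<mu> i) (\<lambda>_. 1 :: real))) = 0"
    using polar_eval_of_real_0[of p N "\<lambda>_ _. 1"] by (simp del: of_real_sum of_real_mult of_real_prod)
  moreover have "0 < (\<Sum>\<mu>\<in>Poly_Mapping.keys p. Poly_Mapping.lookup p \<mu> *
     (\<Prod>i\<in>UNIV. fact (Poly_Mapping.lookup \<mu> i) * esym N (Poly_Mapping.lookup \<mu> i) (\<lambda>_. 1 :: real)))"
  proof (rule sum_pos)
    fix \<mu> assume \<mu>: "\<mu> \<in> Poly_Mapping.keys p"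
    then have "0 < Poly_Mapping.lookup p \<mu>"
      using nn by (metis in_keys_iff nonneg_coeffs_def order_less_le)
    then show "0 < Poly_Mapping.lookup p \<mu> *
     (\<Prod>i\<in>UNIV. fact (Poly_Mapping.lookup \<mu> i) * esym N (Poly_Mapping.lookup \<mu> i) (\<lambda>_. 1 :: real))"
      using N[OF \<mu>] by (intro mult_pos_pos prod_pos ballI conjI esym_pos) auto
  qed (use st in auto)
  ultimately show False by simp
qed

section \<open>Multilinear monomials sorted by multidegree\<close>

definition degrees :: "('n::finite \<times> nat) set \<Rightarrow> 'n \<Rightarrow>\<^sub>0 nat" where
  "degrees S = Abs_poly_mapping (\<lambda>i. card {j. (i, j) \<in> S})"

lemma lookup_degrees: "Poly_Mapping.lookup (degrees S) i = card {j. (i, j) \<in> S}"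
  by (simp add: degrees_def)

lemma sum_Pow_Times:
  fixes f :: "('n::finite \<times> nat) set \<Rightarrow> 'b::comm_monoid_add"
  shows "(\<Sum>S\<in>Pow (UNIV \<times> {..<N}). f S) = (\<Sum>A\<in>PiE UNIV (\<lambda>_. Pow {..<N}). f (Sigma UNIV A))"
  by (rule sum.reindex_bij_witness[where i="Sigma UNIV" and j="\<lambda>S i. {j. (i, j) \<in> S}"])
    (auto simp: PiE_def intro!: arg_cong[where f=f])

text \<open>A set of copies is a choice of one subset of copies for each variable, so the sets of
  multidegree \<open>\<mu>\<close> together contribute a product of elementary symmetric
  polynomials.\<close>

lemma sum_Pow_degrees:
  fixes x :: "'n::finite \<times> nat \<Rightarrow> 'b::comm_semiring_1"
  assumes M: "finite M" "\<And>\<mu>. \<mu> \<notin> M \<Longrightarrow> g \<mu> = 0"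
  shows "(\<Sum>S\<in>Pow (UNIV \<times> {..<N}). g (degrees S) * (\<Prod>q\<in>S. x q)) =
    (\<Sum>\<mu>\<in>M. g \<mu> * (\<Prod>i\<in>UNIV. esym N (Poly_Mapping.lookup \<mu> i) (\<lambda>j. x (i, j))))"
proof -
  let ?P = "PiE UNIV (\<lambda>_::'n. Pow {..<N})"
  let ?X = "\<lambda>A i. \<Prod>j\<in>A i. x (i, j)"
  have fin: "finite ?P" by (intro finite_PiE) auto
  have fA: "finite (A i)" if "A \<in> ?P" for A i
  proof -
    have "A i \<subseteq> {..<N}" using that by (auto simp: PiE_def Pi_def)
    then show ?thesis by (rule finite_subset) simp
  qed
  have esym: "(\<Prod>i\<in>UNIV. esym N (Poly_Mapping.lookup \<mu> i) (\<lambda>j. x (i, j))) =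
      (\<Sum>A\<in>?P. if degrees (Sigma UNIV A) = \<mu> then \<Prod>i\<in>UNIV. ?X A i else 0)" for \<mu>
  proof -
    have "(\<Prod>i\<in>UNIV. esym N (Poly_Mapping.lookup \<mu> i) (\<lambda>j. x (i, j))) =
        (\<Sum>A\<in>?P. \<Prod>i\<in>UNIV. if card (A i) = Poly_Mapping.lookup \<mu> i then ?X A i else 0)"
      unfolding esym_def by (rule prod_sum_PiE) auto
    also have "\<dots> = (\<Sum>A\<in>?P. if degrees (Sigma UNIV A) = \<mu> then \<Prod>i\<in>UNIV. ?X A i else 0)"
    proof (rule sum.cong[OF refl])
      fix A
      have "degrees (Sigma UNIV A) = \<mu> \<longleftrightarrow> (\<forall>i. card (A i) = Poly_Mapping.lookup \<mu> i)"
        by (auto simp: poly_mapping_eq_iff lookup_degrees fun_eq_iff)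
      then show "(\<Prod>i\<in>UNIV. if card (A i) = Poly_Mapping.lookup \<mu> i then ?X A i else 0) =
          (if degrees (Sigma UNIV A) = \<mu> then \<Prod>i\<in>UNIV. ?X A i else 0)"
        by (auto intro!: prod_zero)
    qed
    finally show ?thesis .
  qed
  have "(\<Sum>S\<in>Pow (UNIV \<times> {..<N}). g (degrees S) * (\<Prod>q\<in>S. x q)) =
      (\<Sum>A\<in>?P. g (degrees (Sigma UNIV A)) * (\<Prod>i\<in>UNIV. ?X A i))"
    unfolding sum_Pow_Times
    by (intro sum.cong refl arg_cong2[where f="(*)"]) (simp add: prod.Sigma fA)
  also have "\<dots> = (\<Sum>A\<in>?P. \<Sum>\<mu>\<in>M. g \<mu> * (if degrees (Sigma UNIV A) = \<mu> then \<Prod>i\<in>UNIV. ?X A i else 0))"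
    using M by (intro sum.cong refl) (auto simp: if_distrib sum.delta cong: if_cong)
  also have "\<dots> = (\<Sum>\<mu>\<in>M. g \<mu> * (\<Prod>i\<in>UNIV. esym N (Poly_Mapping.lookup \<mu> i) (\<lambda>j. x (i, j))))"
    unfolding esym sum_distrib_left by (rule sum.swap)
  finally show ?thesis .
qed

section \<open>Lower bounds for elementary symmetric polynomials\<close>

lemma esym_const: "esym N k (\<lambda>_. \<rho>) = of_nat (N choose k) * \<rho> ^ k"
proof -
  have "esym N k (\<lambda>_. \<rho>) = (\<Sum>A\<in>Pow {..<N}. if card A = k then \<rho> ^ k else 0)"
    unfolding esym_def by (intro sum.cong) auto
  also have "\<dots> = (\<Sum>A | A \<subseteq> {..<N} \<and> card A = k. \<rho> ^ k)"
    by (intro sum.mono_neutral_cong_right) (auto intro: finite_subset[of _ "Pow {..<N}"])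
  finally show ?thesis by (simp add: n_subsets)
qed

lemma card_subsets_containing:
  assumes "j < N"
  shows "card {A. A \<subseteq> {..<N} \<and> card A = Suc k \<and> j \<in> A} = (N - 1 choose k)"
proof -
  have "{A. A \<subseteq> {..<N} \<and> card A = Suc k \<and> j \<in> A} = insert j ` {B. B \<subseteq> {..<N} - {j} \<and> card B = k}"
  proof (intro equalityI subsetI)
    fix A assume A: "A \<in> {A. A \<subseteq> {..<N} \<and> card A = Suc k \<and> j \<in> A}"
    then have "finite A" using finite_subset by auto
    with A have "A = insert j (A - {j})" "A - {j} \<in> {B. B \<subseteq> {..<N} - {j} \<and> card B = k}" by auto
    then show "A \<in> insert j ` {B. B \<subseteq> {..<N} - {j} \<and> card B = k}" by blast
  next
    fix A assume "A \<in> insert j ` {B. B \<subseteq> {..<N} - {j} \<and> card B = k}"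
    then obtain B where B: "A = insert j B" "B \<subseteq> {..<N} - {j}" "card B = k" by auto
    then have "finite B" "j \<notin> B" using finite_subset by auto
    then show "A \<in> {A. A \<subseteq> {..<N} \<and> card A = Suc k \<and> j \<in> A}" using B assms by auto
  qed
  moreover have "inj_on (insert j) {B. B \<subseteq> {..<N} - {j} \<and> card B = k}"
    by (rule inj_on_inverseI[where g="\<lambda>A. A - {j}"]) auto
  ultimately show ?thesis using assms by (simp add: card_image n_subsets)
qed

text \<open>AM-GM over the products indexed by the \<open>k\<close>-subsets; by symmetry their
  geometric mean is a power of the full product.\<close>

lemma esym_ge:
  fixes x :: "nat \<Rightarrow> real"
  assumes x: "\<And>j. 0 < x j" and k: "k \<le> N" "0 < N"
  shows "real (N choose k) * (\<Prod>j<N. x j) powr (real k / real N) \<le> esym N k x"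
proof -
  define \<A> where "\<A> = {A. A \<subseteq> {..<N} \<and> card A = k}"
  have fin: "finite \<A>" unfolding \<A>_def by (rule finite_subset[of _ "Pow {..<N}"]) auto
  have card: "card \<A> = (N choose k)" by (simp add: \<A>_def n_subsets)
  have pos: "(N choose k) > 0" using k by simp
  then have ne: "\<A> \<noteq> {}" using card by auto
  have finA: "finite A" if "A \<in> \<A>" for A using that finite_subset[of A "{..<N}"] by (auto simp: \<A>_def)
  have "(\<Prod>A\<in>\<A>. \<Prod>j\<in>A. x j) = (\<Prod>A\<in>\<A>. \<Prod>j<N. if j \<in> A then x j else 1)"
    by (intro prod.cong refl prod.mono_neutral_cong_left) (auto simp: \<A>_def)
  also have "\<dots> = (\<Prod>j<N. \<Prod>A\<in>\<A>. if j \<in> A then x j else 1)"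
    by (rule prod.swap)
  also have "\<dots> = (\<Prod>j<N. x j ^ card {A\<in>\<A>. j \<in> A})"
  proof (rule prod.cong[OF refl])
    fix j
    have "(\<Prod>A\<in>\<A>. if j \<in> A then x j else 1) = (\<Prod>A\<in>{A\<in>\<A>. j \<in> A}. x j)"
      by (intro prod.mono_neutral_cong_right) (auto simp: fin)
    then show "(\<Prod>A\<in>\<A>. if j \<in> A then x j else 1) = x j ^ card {A\<in>\<A>. j \<in> A}" by simp
  qed
  finally have prod: "(\<Prod>A\<in>\<A>. \<Prod>j\<in>A. x j) = (\<Prod>j<N. x j ^ card {A\<in>\<A>. j \<in> A})" .
  \<comment> \<open>Double counting: each index lies in the fraction \<open>k / N\<close> of all
    \<open>k\<close>-subsets.\<close>
  have exponent: "real (card {A\<in>\<A>. j \<in> A}) = real (N choose k) * (real k / real N)" if "j < N" for j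
  proof (cases k)
    case 0
    have "j \<notin> A" if "A \<in> \<A>" for A
      using finA[OF that] that 0 by (simp add: \<A>_def)
    then have "{A\<in>\<A>. j \<in> A} = {}" by blast
    then have "card {A\<in>\<A>. j \<in> A} = 0" by (simp only: card.empty)
    then show ?thesis using 0 by simp
  next
    case (Suc l)
    then have "{A\<in>\<A>. j \<in> A} = {A. A \<subseteq> {..<N} \<and> card A = Suc l \<and> j \<in> A}" by (auto simp: \<A>_def)
    then have "card {A\<in>\<A>. j \<in> A} = (N - 1 choose l)" using card_subsets_containing[OF that] by simp
    moreover have "Suc l * (N choose Suc l) = N * (N - 1 choose l)"
      using binomial_absorption[of l "N"] by simp
    then have "real (Suc l) * real (N choose Suc l) = real N * real (N - 1 choose l)"
      by (metis of_nat_mult)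
    ultimately show ?thesis using k Suc by (simp add: field_simps)
  qed
  have "(\<Prod>A\<in>\<A>. \<Prod>j\<in>A. x j) = (\<Prod>j<N. x j powr (real (N choose k) * (real k / real N)))"
    unfolding prod using x exponent by (intro prod.cong refl) (simp flip: powr_realpow)
  also have "\<dots> = (\<Prod>j<N. x j) powr (real (N choose k) * (real k / real N))"
    using x by (simp add: prod_powr_distrib less_imp_le)
  finally have "(\<Prod>A\<in>\<A>. \<Prod>j\<in>A. x j) powr (1 / real (card \<A>)) = (\<Prod>j<N. x j) powr (real k / real N)"
    using pos by (simp add: powr_powr card)
  moreover have "(\<Prod>A\<in>\<A>. \<Prod>j\<in>A. x j) powr (1 / real (card \<A>)) \<le> (\<Sum>A\<in>\<A>. (\<Prod>j\<in>A. x j) / card \<A>)"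
    using x by (intro arith_geom_mean[OF fin ne] prod_nonneg) (simp add: less_imp_le)
  moreover have "(\<Sum>A\<in>\<A>. (\<Prod>j\<in>A. x j) / card \<A>) = esym N k x / real (N choose k)"
  proof -
    have "esym N k x = (\<Sum>A\<in>\<A>. \<Prod>j\<in>A. x j)"
      unfolding esym_def \<A>_def by (intro sum.mono_neutral_cong_right) auto
    then show ?thesis by (simp add: card sum_divide_distrib)
  qed
  ultimately show ?thesis using pos by (simp add: field_simps)
qed

section \<open>Entropy weights of many equal copies\<close>

lemma entropy_weight_power:
  assumes "0 < a" "a < real N"
  shows "real N powr a * entropy_weight (a / real N) ^ N = a powr a * (1 - a / real N) powr (real N - a)"
proof -
  let ?t = "1 - a / real N"
  have N: "0 < real N" and t: "0 < ?t" using assms by auto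
  have "entropy_weight (a / real N) ^ N = ((a / real N) powr (a / real N)) ^ N * (?t powr ?t) ^ N"
    using assms by (simp add: entropy_weight_def power_mult_distrib)
  also have "\<dots> = (a / real N) powr a * ?t powr (real N - a)"
    using assms N t by (simp add: powr_powr right_diff_distrib left_diff_distrib flip: powr_realpow)
  finally show ?thesis using assms N by (simp add: powr_divide)
qed

text \<open>The point is \<open>(1 - a / N)^(N - a) >= e^(-a)\<close>, which is the inequality
  \<open>ln s <= s - 1\<close> at \<open>s = 1 / (1 - a / N)\<close>. It holds for each
  \<open>N > a\<close>, so the constant appears before any limit is taken.\<close>

lemma self_powr_entropy_weight:
  assumes "0 \<le> a" "a < real N"
  shows "(if a = 0 then 1 else a powr a) * exp (- a) \<le> real N powr a * entropy_weight (a / real N) ^ N"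
proof (cases "a = 0")
  case True
  then show ?thesis using assms by (simp add: entropy_weight_def)
next
  case False
  with assms have a: "0 < a" by simp
  let ?t = "1 - a / real N"
  have t: "0 < ?t" using assms a by auto
  have "- ln ?t = ln (1 / ?t)" by (simp only: ln_inverse flip: inverse_eq_divide)
  also have "\<dots> \<le> 1 / ?t - 1" using t by (intro ln_le_minus_one) auto
  also have "\<dots> = a / (real N - a)" using a assms by (simp add: field_simps)
  finally have "- ln ?t \<le> a / (real N - a)" .
  then have "- a \<le> (real N - a) * ln ?t" using assms by (simp add: field_simps)
  then have "exp (- a) \<le> ?t powr (real N - a)" using t assms by (simp add: powr_def)
  then show ?thesis
    unfolding entropy_weight_power[OF a assms(2)] using False by (simp add: mult_left_mono)
qed

section \<open>The capacity inequality for pairs of real stable polynomials\<close>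

text \<open>The coefficient of the multilinear monomial \<open>S\<close> in the polarization of
  \<open>p\<close>, that is, in the operators of \<open>polar_op\<close> applied in every variable
  and evaluated at 0.\<close>

definition polar_coeff :: "'n::finite rpoly \<Rightarrow> ('n \<times> nat) set \<Rightarrow> real" where
  "polar_coeff p S = Poly_Mapping.lookup p (degrees S) * real (mfact (degrees S))"

lemma polar_coeff_nonneg: "nonneg_coeffs p \<Longrightarrow> 0 \<le> polar_coeff p S"
  by (simp add: polar_coeff_def nonneg_coeffs_def)

lemma sum_polar_coeff:
  fixes y :: "'n::finite \<times> nat \<Rightarrow> 'b::{real_algebra_1,comm_ring_1}"
  shows "(\<Sum>S\<in>Pow (UNIV \<times> {..<N}). of_real (polar_coeff p S) * (\<Prod>q\<in>S. y q)) =
    (\<Sum>\<mu>\<in>Poly_Mapping.keys p. of_real (Poly_Mapping.lookup p \<mu>) *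
     (\<Prod>i\<in>UNIV. fact (Poly_Mapping.lookup \<mu> i) * esym N (Poly_Mapping.lookup \<mu> i) (\<lambda>j. y (i, j))))"
  unfolding polar_coeff_def
  by (subst sum_Pow_degrees[where M="Poly_Mapping.keys p" and
        g="\<lambda>\<mu>. of_real (Poly_Mapping.lookup p \<mu> * real (mfact \<mu>))"])
    (simp_all add: in_keys_iff mfact_def prod.distrib mult.assoc)

lemma sum_polar_coeff_complex:
  "(\<Sum>S\<in>Pow (UNIV \<times> {..<N}). complex_of_real (polar_coeff p S) * (\<Prod>q\<in>S. y q)) =
   polar_eval p (\<lambda>_. N) (\<lambda>i j. y (i, j)) (\<lambda>_. 0)"
  by (simp add: sum_polar_coeff polar_eval_def poly_polar_op_monom_0)

lemma polar_coeff_stable: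
  fixes p :: "'n::finite rpoly"
  assumes "real_stable p" "p \<noteq> 0" "nonneg_coeffs p"
    "\<And>\<mu> i. \<mu> \<in> Poly_Mapping.keys p \<Longrightarrow> Poly_Mapping.lookup \<mu> i \<le> N"
    and y: "\<And>q. q \<in> UNIV \<times> {..<N} \<Longrightarrow> 0 < Im (y q)"
  shows "(\<Sum>S\<in>Pow (UNIV \<times> {..<N}). complex_of_real (polar_coeff p S) * (\<Prod>q\<in>S. y q)) \<noteq> 0"
proof -
  define y' where "y' = (\<lambda>q. if q \<in> (UNIV :: 'n set) \<times> {..<N} then y q else \<i>)"
  have "(\<Sum>S\<in>Pow (UNIV \<times> {..<N}). complex_of_real (polar_coeff p S) * (\<Prod>q\<in>S. y q)) =
      (\<Sum>S\<in>Pow (UNIV \<times> {..<N}). complex_of_real (polar_coeff p S) * (\<Prod>q\<in>S. y' q))"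
    by (intro sum.cong refl arg_cong2[where f="(*)"] prod.cong) (auto simp: y'_def)
  also have "\<dots> \<noteq> 0"
    unfolding sum_polar_coeff_complex
    by (rule polar_eval_0_nonzero) (use assms in \<open>auto simp: y'_def\<close>)
  finally show ?thesis .
qed

text \<open>The polynomial is a product of one factor in \<open>y\<close> and one in
  \<open>z\<close>. Conjugation carries the second to the upper half-plane because its coefficients
  are real, and scaling by \<open>\<rho> > 0\<close> preserves half-planes.\<close>

lemma bistable_polar_coeff:
  fixes p q :: "'n::finite rpoly"
  assumes p: "real_stable p" "p \<noteq> 0" "nonneg_coeffs p"
    "\<And>\<mu> i. \<mu> \<in> Poly_Mapping.keys p \<Longrightarrow> Poly_Mapping.lookup \<mu> i \<le> N"
    and q: "real_stable q" "q \<noteq> 0" "nonneg_coeffs q"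
    "\<And>\<mu> i. \<mu> \<in> Poly_Mapping.keys q \<Longrightarrow> Poly_Mapping.lookup \<mu> i \<le> N"
    and \<rho>: "\<rho> > 0"
  shows "bistable (UNIV \<times> {..<N}) (\<lambda>S R. polar_coeff p S * (polar_coeff q R * \<rho> ^ card R))"
  unfolding bistable_def
proof (intro allI impI)
  fix y z :: "'n \<times> nat \<Rightarrow> complex"
  let ?I = "(UNIV :: 'n set) \<times> {..<N}"
  assume yz: "\<forall>i\<in>?I. 0 < Im (y i) \<and> Im (z i) < 0"
  let ?z = "\<lambda>i. cnj (of_real \<rho> * z i)"
  have "biaffine ?I (\<lambda>S R. complex_of_real (polar_coeff p S * (polar_coeff q R * \<rho> ^ card R))) y z =
      (\<Sum>S\<in>Pow ?I. of_real (polar_coeff p S) * (\<Prod>i\<in>S. y i)) *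
      (\<Sum>R\<in>Pow ?I. of_real (polar_coeff q R) * (\<Prod>i\<in>R. of_real \<rho> * z i))"
    unfolding biaffine_def sum_product by (simp add: prod.distrib ac_simps)
  also have "(\<Sum>R\<in>Pow ?I. of_real (polar_coeff q R) * (\<Prod>i\<in>R. of_real \<rho> * z i)) =
      cnj (\<Sum>R\<in>Pow ?I. of_real (polar_coeff q R) * (\<Prod>i\<in>R. ?z i))"
    by simp
  finally show "biaffine ?I (\<lambda>S R. complex_of_real (polar_coeff p S * (polar_coeff q R * \<rho> ^ card R))) y z \<noteq> 0"
    using polar_coeff_stable[OF p, of y] polar_coeff_stable[OF q, of ?z] yz \<rho>
    by (simp add: mult_less_0_iff del: cnj_sum complex_cnj_mult cnj_prod)
qed

text \<open>The polarization at \<open>y\<close> is compared with \<open>p\<close> at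
  \<open>N\<close> times the geometric means of the copies. By \<open>esym_ge\<close>, the term of
  \<open>\<mu>\<close> loses at most the ratio of \<open>k! * (N choose k)\<close> to
  \<open>N^k\<close> in each variable, which \<open>\<delta>\<close> bounds from below.\<close>

lemma polar_coeff_capacity:
  fixes p :: "'n::finite rpoly" and \<alpha> :: "real ^ 'n"
  assumes nn: "nonneg_coeffs p"
    and cap: "\<And>x. x \<in> pos_orthant \<Longrightarrow> C * vec_powr x \<alpha> \<le> eval_rpoly p x"
    and \<delta>: "0 \<le> \<delta>" "\<And>\<mu>. \<mu> \<in> Poly_Mapping.keys p \<Longrightarrow> \<delta> \<le>
      (\<Prod>i\<in>UNIV. fact (Poly_Mapping.lookup \<mu> i) * real (N choose Poly_Mapping.lookup \<mu> i) / real N ^ Poly_Mapping.lookup \<mu> i)"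
    and N: "\<And>\<mu> i. \<mu> \<in> Poly_Mapping.keys p \<Longrightarrow> Poly_Mapping.lookup \<mu> i \<le> N" "0 < N"
    and y: "\<And>q. 0 < y q"
  shows "\<delta> * C * (\<Prod>i\<in>UNIV. real N powr \<alpha> $ i) * (\<Prod>q\<in>UNIV \<times> {..<N}. y q powr (\<alpha> $ fst q / real N))
    \<le> (\<Sum>S\<in>Pow (UNIV \<times> {..<N}). polar_coeff p S * (\<Prod>q\<in>S. y q))"
proof -
  let ?l = "Poly_Mapping.lookup"
  define g where "g = (\<lambda>i. (\<Prod>j<N. y (i, j)) powr (1 / real N))"
  have g: "0 < g i" for i unfolding g_def using y by (simp add: prod_pos less_imp_neq[symmetric])
  define x :: "real ^ 'n" where "x = (\<chi> i. real N * g i)"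
  have x: "x \<in> pos_orthant" using g N by (simp add: x_def pos_orthant_def)
  have "vec_powr x \<alpha> = (\<Prod>i\<in>UNIV. real N powr \<alpha> $ i * (\<Prod>j<N. y (i, j) powr (\<alpha> $ i / real N)))"
    unfolding vec_powr_def
  proof (rule prod.cong[OF refl])
    fix i
    have "g i powr \<alpha> $ i = (\<Prod>j<N. y (i, j)) powr (\<alpha> $ i / real N)"
      by (simp add: g_def powr_powr)
    also have "\<dots> = (\<Prod>j<N. y (i, j) powr (\<alpha> $ i / real N))"
      using y by (simp add: prod_powr_distrib less_imp_le)
    finally show "x $ i powr \<alpha> $ i = real N powr \<alpha> $ i * (\<Prod>j<N. y (i, j) powr (\<alpha> $ i / real N))"
      using g[of i] by (simp add: x_def powr_mult)
  qed
  then have "\<delta> * C * (\<Prod>i\<in>UNIV. real N powr \<alpha> $ i) * (\<Prod>q\<in>UNIV \<times> {..<N}. y q powr (\<alpha> $ fst q / real N)) =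
      \<delta> * (C * vec_powr x \<alpha>)"
    by (simp add: prod.distrib prod.cartesian_product case_prod_unfold mult.assoc)
  also have "\<dots> \<le> \<delta> * eval_rpoly p x"
    using cap[OF x] \<delta>(1) by (rule mult_left_mono)
  also have "\<dots> = (\<Sum>\<mu>\<in>Poly_Mapping.keys p. ?l p \<mu> * (\<delta> * (\<Prod>i\<in>UNIV. (real N * g i) ^ ?l \<mu> i)))"
    by (simp add: eval_rpoly_def monomial_at_def x_def sum_distrib_left ac_simps)
  also have "\<dots> \<le> (\<Sum>\<mu>\<in>Poly_Mapping.keys p. ?l p \<mu> *
     (\<Prod>i\<in>UNIV. fact (?l \<mu> i) * esym N (?l \<mu> i) (\<lambda>j. y (i, j))))"
  proof (rule sum_mono)
    fix \<mu> assume \<mu>: "\<mu> \<in> Poly_Mapping.keys p"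
    have "\<delta> * (\<Prod>i\<in>UNIV. (real N * g i) ^ ?l \<mu> i) \<le>
        (\<Prod>i\<in>UNIV. fact (?l \<mu> i) * real (N choose ?l \<mu> i) / real N ^ ?l \<mu> i) * (\<Prod>i\<in>UNIV. (real N * g i) ^ ?l \<mu> i)"
      using \<delta>(2)[OF \<mu>] g N by (intro mult_right_mono prod_nonneg) (auto intro: less_imp_le)
    also have "\<dots> = (\<Prod>i\<in>UNIV. fact (?l \<mu> i) * (real (N choose ?l \<mu> i) * g i ^ ?l \<mu> i))"
      unfolding prod.distrib[symmetric] using N by (simp add: power_mult_distrib)
    also have "\<dots> \<le> (\<Prod>i\<in>UNIV. fact (?l \<mu> i) * esym N (?l \<mu> i) (\<lambda>j. y (i, j)))"
    proof (intro prod_mono conjI mult_left_mono)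
      fix i
      have "g i ^ ?l \<mu> i = (\<Prod>j<N. y (i, j)) powr (real (?l \<mu> i) / real N)"
        using g[of i] by (simp add: g_def powr_powr flip: powr_realpow)
      then show "real (N choose ?l \<mu> i) * g i ^ ?l \<mu> i \<le> esym N (?l \<mu> i) (\<lambda>j. y (i, j))"
        using esym_ge[of "\<lambda>j. y (i, j)" "?l \<mu> i" N] y N \<mu> by simp
    qed (use g in \<open>simp_all add: less_imp_le\<close>)
    finally show "?l p \<mu> * (\<delta> * (\<Prod>i\<in>UNIV. (real N * g i) ^ ?l \<mu> i)) \<le>
        ?l p \<mu> * (\<Prod>i\<in>UNIV. fact (?l \<mu> i) * esym N (?l \<mu> i) (\<lambda>j. y (i, j)))"
      using nn by (intro mult_left_mono) (auto simp: nonneg_coeffs_def)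
  qed
  also have "\<dots> = (\<Sum>S\<in>Pow (UNIV \<times> {..<N}). polar_coeff p S * (\<Prod>q\<in>S. y q))"
    using sum_polar_coeff[where p=p and N=N and y=y] by simp
  finally show ?thesis .
qed

text \<open>\<open>capacity_biaffine\<close> for the product of the two polarizations, with
  \<open>\<alpha>_i / N\<close> as exponent at each copy. The factor \<open>\<delta>\<close> enters
  twice, once for the capacity of each polynomial.\<close>

lemma stable_pairing_ge_approx:
  fixes p q :: "'n::finite rpoly" and \<alpha> :: "real ^ 'n"
  assumes p: "real_stable p" "p \<noteq> 0" "nonneg_coeffs p"
    and q: "real_stable q" "q \<noteq> 0" "nonneg_coeffs q"
    and cap_p: "\<And>x. x \<in> pos_orthant \<Longrightarrow> C * vec_powr x \<alpha> \<le> eval_rpoly p x"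
    and cap_q: "\<And>x. x \<in> pos_orthant \<Longrightarrow> D * vec_powr x \<alpha> \<le> eval_rpoly q x"
    and CD: "0 \<le> C" "0 \<le> D" and \<alpha>: "\<And>i. 0 \<le> \<alpha> $ i" "\<And>i. \<alpha> $ i < real N"
    and N: "\<And>\<mu> i. \<mu> \<in> Poly_Mapping.keys p \<union> Poly_Mapping.keys q \<Longrightarrow> Poly_Mapping.lookup \<mu> i \<le> N" "0 < N"
    and \<delta>: "0 \<le> \<delta>" "\<And>\<mu>. \<mu> \<in> Poly_Mapping.keys p \<union> Poly_Mapping.keys q \<Longrightarrow> \<delta> \<le>
      (\<Prod>i\<in>UNIV. fact (Poly_Mapping.lookup \<mu> i) * real (N choose Poly_Mapping.lookup \<mu> i) / real N ^ Poly_Mapping.lookup \<mu> i)"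
  shows "\<delta>\<^sup>2 * (C * D * self_powr \<alpha> * exp_neg \<alpha>) \<le>
    (\<Sum>\<mu>\<in>Poly_Mapping.keys p. real (mfact \<mu>) * Poly_Mapping.lookup p \<mu> * Poly_Mapping.lookup q \<mu>)"
proof -
  let ?l = "Poly_Mapping.lookup"
  let ?I = "(UNIV :: 'n set) \<times> {..<N}"
  let ?NN = "\<Prod>i\<in>UNIV. real N powr \<alpha> $ i"
  define a where "a = (\<lambda>q::'n \<times> nat. \<alpha> $ fst q / real N)"
  define K where "K = \<delta>\<^sup>2 * (C * D) * ?NN"
  \<comment> \<open>The powers of \<open>1 / N\<close> rescale the variables of \<open>q\<close>;
    they offset the growth \<open>N^k\<close> of \<open>k! * (N choose k)\<close> in the diagonal
    sum.\<close>
  define c where "c = (\<lambda>S R. polar_coeff p S * (polar_coeff q R * (1 / real N) ^ card R))"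
  have "K * (\<Prod>i\<in>?I. entropy_weight (a i)) \<le> (\<Sum>S\<in>Pow ?I. c S S)"
  proof (rule capacity_biaffine[where c=c and al=a and I="?I"])
    show "bistable ?I c" unfolding c_def
      by (rule bistable_polar_coeff) (use p q N in auto)
    show "0 \<le> c S R" for S R
      using p q by (simp add: c_def polar_coeff_nonneg)
    show "0 \<le> a i \<and> a i < 1" for i using \<alpha> N by (simp add: a_def)
    fix y z :: "'n \<times> nat \<Rightarrow> real"
    assume yz: "\<And>i. i \<in> ?I \<Longrightarrow> 0 < y i \<and> 0 < z i"
    \<comment> \<open>Outside the index set \<open>y\<close> and \<open>z\<close> are unconstrained,
      while \<open>polar_coeff_capacity\<close> asks for positivity everywhere; the default 1
      changes no value inside.\<close>
    define y' where "y' = (\<lambda>i. if i \<in> ?I then y i else 1)"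
    define z' where "z' = (\<lambda>i. if i \<in> ?I then z i else 1)"
    have pos: "0 < y' i" "0 < z' i" for i using yz by (auto simp: y'_def z'_def)
    have lower_p: "\<delta> * C * ?NN * (\<Prod>i\<in>?I. y' i powr a i) \<le> (\<Sum>S\<in>Pow ?I. polar_coeff p S * (\<Prod>i\<in>S. y' i))"
      unfolding a_def by (rule polar_coeff_capacity) (use p cap_p \<delta> N pos in auto)
    have "\<delta> * D * ?NN * (\<Prod>i\<in>?I. (z' i / real N) powr a i) \<le>
        (\<Sum>R\<in>Pow ?I. polar_coeff q R * (\<Prod>i\<in>R. z' i / real N))"
      unfolding a_def by (rule polar_coeff_capacity) (use q cap_q \<delta> N pos in auto)
    \<comment> \<open>The \<open>N\<close> copies of variable \<open>i\<close> together turn the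
      rescaling into \<open>N\<close> to the power \<open>\<alpha>_i\<close>, so \<open>?NN\<close>
      cancels for \<open>q\<close>. Only the factor \<open>?NN\<close> of \<open>p\<close> remains
      in \<open>K\<close>, where the entropy weights consume it.\<close>
    moreover have "\<delta> * D * ?NN * (\<Prod>i\<in>?I. (z' i / real N) powr a i) = \<delta> * D * (\<Prod>i\<in>?I. z' i powr a i)"
    proof -
      have "(\<Prod>i\<in>?I. real N powr a i) = ?NN"
      proof -
        have "(\<Prod>i\<in>?I. real N powr a i) = (\<Prod>i\<in>UNIV. \<Prod>j<N. real N powr (\<alpha> $ i / real N))"
          unfolding prod.cartesian_product by (simp add: a_def case_prod_unfold)
        also have "\<dots> = ?NN" using N by (simp add: powr_powr flip: powr_realpow)
        finally show ?thesis .
      qed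
      moreover have "?NN > 0" using N by (simp add: prod_pos)
      ultimately show ?thesis
        using pos N by (simp add: powr_divide less_imp_le prod_dividef)
    qed
    ultimately have lower_q: "\<delta> * D * (\<Prod>i\<in>?I. z' i powr a i) \<le>
        (\<Sum>R\<in>Pow ?I. polar_coeff q R * (\<Prod>i\<in>R. z' i / real N))" by simp
    have "(\<delta> * C * ?NN * (\<Prod>i\<in>?I. y' i powr a i)) * (\<delta> * D * (\<Prod>i\<in>?I. z' i powr a i)) \<le>
        (\<Sum>S\<in>Pow ?I. polar_coeff p S * (\<Prod>i\<in>S. y' i)) * (\<Sum>R\<in>Pow ?I. polar_coeff q R * (\<Prod>i\<in>R. z' i / real N))"
    proof (rule mult_mono[OF lower_p lower_q])
      show "0 \<le> (\<Sum>S\<in>Pow ?I. polar_coeff p S * (\<Prod>i\<in>S. y' i))"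
        by (intro sum_nonneg mult_nonneg_nonneg prod_nonneg) (simp_all add: p polar_coeff_nonneg pos less_imp_le)
      show "0 \<le> \<delta> * D * (\<Prod>i\<in>?I. z' i powr a i)"
        by (intro mult_nonneg_nonneg prod_nonneg) (simp_all add: \<delta> CD)
    qed
    also have "\<dots> = biaffine ?I c y' z'"
      unfolding biaffine_def sum_product c_def
      by (simp add: prod.distrib divide_inverse ac_simps)
    also have "\<dots> = biaffine ?I c y z"
      by (rule biaffine_cong) (auto simp: y'_def z'_def)
    also have "(\<delta> * C * ?NN * (\<Prod>i\<in>?I. y' i powr a i)) * (\<delta> * D * (\<Prod>i\<in>?I. z' i powr a i)) =
        K * (\<Prod>i\<in>?I. (y' i * z' i) powr a i)"
      using pos by (simp add: K_def powr_mult less_imp_le prod.distrib power2_eq_square ac_simps)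
    also have "(\<Prod>i\<in>?I. (y' i * z' i) powr a i) = (\<Prod>i\<in>?I. (y i * z i) powr a i)"
      by (intro prod.cong) (auto simp: y'_def z'_def)
    finally show "K * (\<Prod>i\<in>?I. (y i * z i) powr a i) \<le> biaffine ?I c y z" .
  qed simp
  also have "(\<Sum>S\<in>Pow ?I. c S S) = (\<Sum>S\<in>Pow ?I. (?l p (degrees S) * ?l q (degrees S) * (real (mfact (degrees S)))\<^sup>2) *
      (\<Prod>i\<in>S. 1 / real N))"
    by (simp add: c_def polar_coeff_def power2_eq_square ac_simps)
  also have "\<dots> = (\<Sum>\<mu>\<in>Poly_Mapping.keys p. ?l p \<mu> * ?l q \<mu> * (real (mfact \<mu>))\<^sup>2 *
      (\<Prod>i\<in>UNIV. real (N choose ?l \<mu> i) * (1 / real N) ^ ?l \<mu> i))"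
    by (subst sum_Pow_degrees[where M="Poly_Mapping.keys p" and
      g="\<lambda>\<mu>. ?l p \<mu> * ?l q \<mu> * (real (mfact \<mu>))\<^sup>2"]) (simp_all add: in_keys_iff esym_const)
  also have "\<dots> \<le> (\<Sum>\<mu>\<in>Poly_Mapping.keys p. real (mfact \<mu>) * ?l p \<mu> * ?l q \<mu>)"
  proof (rule sum_mono)
    fix \<mu> assume "\<mu> \<in> Poly_Mapping.keys p"
    have "real (mfact \<mu>) * (\<Prod>i\<in>UNIV. real (N choose ?l \<mu> i) * (1 / real N) ^ ?l \<mu> i) =
        (\<Prod>i\<in>UNIV. real ((N choose ?l \<mu> i) * fact (?l \<mu> i)) / real (N ^ ?l \<mu> i))"
      by (simp add: mfact_def prod.distrib power_inverse divide_inverse ac_simps)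
    also have "\<dots> \<le> (\<Prod>i\<in>(UNIV :: 'n set). 1)"
      using N(2) by (intro prod_mono conjI divide_nonneg_nonneg) (auto simp: divide_le_eq_1 binomial_fact_pow simp del: of_nat_mult of_nat_power)
    finally have "real (mfact \<mu>) * (\<Prod>i\<in>UNIV. real (N choose ?l \<mu> i) * (1 / real N) ^ ?l \<mu> i) \<le> 1" by simp
    moreover have "0 \<le> real (mfact \<mu>) * ?l p \<mu> * ?l q \<mu>" using p q by (simp add: nonneg_coeffs_def)
    ultimately have "(real (mfact \<mu>) * ?l p \<mu> * ?l q \<mu>) *
        (real (mfact \<mu>) * (\<Prod>i\<in>UNIV. real (N choose ?l \<mu> i) * (1 / real N) ^ ?l \<mu> i)) \<le>
        (real (mfact \<mu>) * ?l p \<mu> * ?l q \<mu>) * 1"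
      by (intro mult_left_mono)
    then show "?l p \<mu> * ?l q \<mu> * (real (mfact \<mu>))\<^sup>2 *
        (\<Prod>i\<in>UNIV. real (N choose ?l \<mu> i) * (1 / real N) ^ ?l \<mu> i) \<le> real (mfact \<mu>) * ?l p \<mu> * ?l q \<mu>"
      by (simp add: power2_eq_square ac_simps)
  qed
  finally have "K * (\<Prod>i\<in>?I. entropy_weight (a i)) \<le> (\<Sum>\<mu>\<in>Poly_Mapping.keys p. real (mfact \<mu>) * ?l p \<mu> * ?l q \<mu>)" .
  moreover have "\<delta>\<^sup>2 * (C * D * self_powr \<alpha> * exp_neg \<alpha>) \<le> K * (\<Prod>i\<in>?I. entropy_weight (a i))"
  proof -
    have "(\<Prod>i\<in>?I. entropy_weight (a i)) = (\<Prod>i\<in>UNIV. \<Prod>j<N. entropy_weight (\<alpha> $ i / real N))"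
      unfolding prod.cartesian_product by (simp add: a_def case_prod_unfold)
    then have "?NN * (\<Prod>i\<in>?I. entropy_weight (a i)) = (\<Prod>i\<in>UNIV. real N powr \<alpha> $ i * entropy_weight (\<alpha> $ i / real N) ^ N)"
      by (simp add: prod.distrib)
    moreover have "self_powr \<alpha> * exp_neg \<alpha> \<le> \<dots>"
      unfolding self_powr_def exp_neg_def prod.distrib[symmetric]
      using \<alpha> by (intro prod_mono conjI self_powr_entropy_weight) auto
    ultimately have "self_powr \<alpha> * exp_neg \<alpha> \<le> ?NN * (\<Prod>i\<in>?I. entropy_weight (a i))" by simp
    then have "(\<delta>\<^sup>2 * (C * D)) * (self_powr \<alpha> * exp_neg \<alpha>) \<le> (\<delta>\<^sup>2 * (C * D)) * (?NN * (\<Prod>i\<in>?I. entropy_weight (a i)))"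
      using CD by (intro mult_left_mono) auto
    then show ?thesis by (simp add: K_def mult.assoc)
  qed
  ultimately show ?thesis by linarith
qed

section \<open>The limit of many copies\<close>

lemma fact_binomial_over_power_tendsto_1:
  "(\<lambda>N. fact k * real (N choose k) / real N ^ k) \<longlonglongrightarrow> 1"
proof -
  have "(\<lambda>N. \<Prod>l<k. (real N - real l) / real N) \<longlonglongrightarrow> (\<Prod>l<k. 1)"
  proof (rule tendsto_prod)
    fix l
    have "(\<lambda>N. 1 - real l / real N) \<longlonglongrightarrow> 1 - 0"
      by (intro tendsto_intros tendsto_divide_0[OF tendsto_const] filterlim_at_top_imp_at_infinity filterlim_real_sequentially)
    moreover have "\<forall>\<^sub>F N in sequentially. 1 - real l / real N = (real N - real l) / real N"
      using eventually_gt_at_top[of 0] by eventually_elim (simp add: diff_divide_distrib)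
    ultimately show "(\<lambda>N. (real N - real l) / real N) \<longlonglongrightarrow> 1"
      using Lim_transform_eventually by fastforce
  qed
  moreover have "(\<Prod>l<k. (real N - real l) / real N) = fact k * real (N choose k) / real N ^ k" for N
    by (simp add: binomial_gbinomial gbinomial_prod_rev prod_dividef atLeast0LessThan)
  ultimately show ?thesis by simp
qed

text \<open>For fixed \<open>\<delta> < 1\<close>, some \<open>N\<close> makes the ratios exceed
  \<open>\<delta>\<close> at the finitely many exponents of \<open>p\<close> and \<open>q\<close>.
  As neither side depends on \<open>N\<close>, \<open>\<delta>\<close> can then tend to 1.\<close>

theorem stable_pairing_ge:
  fixes p q :: "'n::finite rpoly" and \<alpha> :: "real ^ 'n"
  assumes p: "real_stable p" "p \<noteq> 0" "nonneg_coeffs p"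
    and q: "real_stable q" "q \<noteq> 0" "nonneg_coeffs q"
    and cap_p: "\<And>x. x \<in> pos_orthant \<Longrightarrow> C * vec_powr x \<alpha> \<le> eval_rpoly p x"
    and cap_q: "\<And>x. x \<in> pos_orthant \<Longrightarrow> D * vec_powr x \<alpha> \<le> eval_rpoly q x"
    and CD: "0 \<le> C" "0 \<le> D" and \<alpha>: "\<And>i. 0 \<le> \<alpha> $ i"
  shows "C * D * self_powr \<alpha> * exp_neg \<alpha> \<le>
    (\<Sum>\<mu>\<in>Poly_Mapping.keys p. real (mfact \<mu>) * Poly_Mapping.lookup p \<mu> * Poly_Mapping.lookup q \<mu>)" (is "?L \<le> ?R")
proof -
  let ?M = "Poly_Mapping.keys p \<union> Poly_Mapping.keys q"
  let ?r = "\<lambda>N \<mu>. \<Prod>i\<in>UNIV. fact (Poly_Mapping.lookup \<mu> i) * real (N choose Poly_Mapping.lookup \<mu> i) / real N ^ Poly_Mapping.lookup \<mu> i"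
  have "\<delta>\<^sup>2 * ?L \<le> ?R" if \<delta>: "0 < \<delta>" "\<delta> < 1" for \<delta>
  proof -
    have "(\<lambda>N. ?r N \<mu>) \<longlonglongrightarrow> (\<Prod>i\<in>(UNIV :: 'n set). 1)" for \<mu> :: "'n \<Rightarrow>\<^sub>0 nat"
      by (intro tendsto_prod fact_binomial_over_power_tendsto_1)
    then have "\<forall>\<^sub>F N in sequentially. \<delta> < ?r N \<mu>" for \<mu> :: "'n \<Rightarrow>\<^sub>0 nat"
      using \<delta> by (auto dest!: order_tendstoD(1)[where a=\<delta>])
    then have "\<forall>\<^sub>F N in sequentially. \<forall>\<mu>\<in>?M. \<delta> < ?r N \<mu>"
      by (intro eventually_ball_finite) auto
    moreover have "\<forall>\<^sub>F N in sequentially. \<forall>\<mu>\<in>?M. \<forall>i. Poly_Mapping.lookup \<mu> i \<le> N"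
      by (intro eventually_ball_finite eventually_all_finite eventually_ge_at_top ballI) auto
    moreover have "\<forall>\<^sub>F N in sequentially. \<alpha> $ i < real N" for i
      using filterlim_real_sequentially by (simp add: filterlim_at_top_dense)
    then have "\<forall>\<^sub>F N in sequentially. \<forall>i. \<alpha> $ i < real N"
      by (rule eventually_all_finite)
    ultimately have "\<forall>\<^sub>F N in sequentially. (\<forall>\<mu>\<in>?M. \<delta> < ?r N \<mu>) \<and>
        (\<forall>\<mu>\<in>?M. \<forall>i. Poly_Mapping.lookup \<mu> i \<le> N) \<and> (\<forall>i. \<alpha> $ i < real N) \<and> 0 < N"
      using eventually_gt_at_top[of 0] by eventually_elim simp
    then obtain N where N: "\<forall>\<mu>\<in>?M. \<delta> < ?r N \<mu>" "\<forall>\<mu>\<in>?M. \<forall>i. Poly_Mapping.lookup \<mu> i \<le> N"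
      "\<forall>i. \<alpha> $ i < real N" "0 < N"
      using eventually_happens'[OF sequentially_bot] by blast
    show ?thesis
      by (rule stable_pairing_ge_approx[OF p q cap_p cap_q CD \<alpha>, of N])
        (use N \<delta> in \<open>auto intro: less_imp_le\<close>)
  qed
  moreover have "((\<lambda>\<delta>. \<delta>\<^sup>2 * ?L) \<longlongrightarrow> 1\<^sup>2 * ?L) (at_left 1)"
    by (intro tendsto_intros)
  moreover have "\<forall>\<^sub>F \<delta> in at_left (1::real). \<delta> \<in> {0<..<1}"
    by (rule eventually_at_leftI[of 0]) auto
  ultimately have "1\<^sup>2 * ?L \<le> ?R"
    by (intro tendsto_upperbound[of "\<lambda>\<delta>. \<delta>\<^sup>2 * ?L" _ "at_left 1"]) (auto elim: eventually_mono)
  then show ?thesis by simp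
qed

section \<open>Evaluation as a ring homomorphism\<close>

lemma eval_rpoly_superset:
  fixes x :: "'a::{real_algebra_1,comm_ring_1} ^ 'n::finite"
  assumes "finite M" "Poly_Mapping.keys p \<subseteq> M"
  shows "eval_rpoly p x = (\<Sum>\<mu>\<in>M. of_real (Poly_Mapping.lookup p \<mu>) * monomial_at \<mu> x)"
  unfolding eval_rpoly_def
  by (rule sum.mono_neutral_left) (use assms in \<open>auto simp: in_keys_iff\<close>)

lemma eval_rpoly_add: "eval_rpoly (p + q) x = eval_rpoly p x + eval_rpoly q x"
proof -
  let ?M = "Poly_Mapping.keys p \<union> Poly_Mapping.keys q"
  have "eval_rpoly r x = (\<Sum>\<mu>\<in>?M. of_real (Poly_Mapping.lookup r \<mu>) * monomial_at \<mu> x)"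
    if "r = p \<or> r = q \<or> r = p + q" for r
    by (rule eval_rpoly_superset) (use that keys_add[of p q] in auto)
  then show ?thesis by (simp add: lookup_add distrib_right sum.distrib)
qed

lemma eval_rpoly_0: "eval_rpoly 0 x = 0"
  by (simp add: eval_rpoly_def)

lemma eval_rpoly_single: "eval_rpoly (Poly_Mapping.single \<mu> c) x = of_real c * monomial_at \<mu> x"
  by (simp add: eval_rpoly_def)

lemma eval_rpoly_sum: "eval_rpoly (\<Sum>i\<in>A. f i) x = (\<Sum>i\<in>A. eval_rpoly (f i) x)"
  by (induction A rule: infinite_finite_induct) (simp_all add: eval_rpoly_0 eval_rpoly_add)

lemma rpoly_sum_singles: "p = (\<Sum>\<mu>\<in>Poly_Mapping.keys p. Poly_Mapping.single \<mu> (Poly_Mapping.lookup p \<mu>))"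
  by (rule poly_mapping_eqI) (simp add: lookup_sum lookup_single when_def in_keys_iff)

lemma rpoly_mult_singles:
  fixes p q :: "'n::finite rpoly"
  shows "p * q = (\<Sum>\<mu>\<in>Poly_Mapping.keys p. \<Sum>\<nu>\<in>Poly_Mapping.keys q.
    Poly_Mapping.single (\<mu> + \<nu>) (Poly_Mapping.lookup p \<mu> * Poly_Mapping.lookup q \<nu>))"
  by (subst (1) rpoly_sum_singles[of p], subst (1) rpoly_sum_singles[of q]) (simp add: sum_product mult_single)

lemma monomial_at_add: "monomial_at (\<mu> + \<nu>) x = monomial_at \<mu> x * monomial_at \<nu> x"
  by (simp add: monomial_at_def lookup_add power_add prod.distrib)

lemma monomial_at_0: "monomial_at 0 x = 1"
  by (simp add: monomial_at_def)

lemma monomial_at_single: "monomial_at (Poly_Mapping.single i k) x = (x $ i) ^ k"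
proof -
  have "monomial_at (Poly_Mapping.single i k) x = (\<Prod>j\<in>UNIV. if i = j then (x $ j) ^ k else 1)"
    unfolding monomial_at_def by (intro prod.cong) (auto simp: lookup_single when_def)
  then show ?thesis by simp
qed

lemma eval_rpoly_mult: "eval_rpoly (p * q) x = eval_rpoly p x * eval_rpoly q x"
  unfolding rpoly_mult_singles eval_rpoly_sum eval_rpoly_single
  by (simp add: eval_rpoly_def sum_product monomial_at_add ac_simps)

lemma eval_rpoly_1: "eval_rpoly 1 x = 1"
  using eval_rpoly_single[of 0 1 x] by (simp add: monomial_at_0)

lemma eval_rpoly_power: "eval_rpoly (p ^ k) x = eval_rpoly p x ^ k"
  by (induction k) (simp_all add: eval_rpoly_1 eval_rpoly_mult)

lemma eval_rpoly_prod: "eval_rpoly (\<Prod>i\<in>A. f i) x = (\<Prod>i\<in>A. eval_rpoly (f i) x)"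
  by (induction A rule: infinite_finite_induct) (simp_all add: eval_rpoly_1 eval_rpoly_mult)

lemma nonneg_coeffs_sum: "(\<And>i. i \<in> A \<Longrightarrow> nonneg_coeffs (f i)) \<Longrightarrow> nonneg_coeffs (\<Sum>i\<in>A. f i)"
  by (auto simp: nonneg_coeffs_def lookup_sum intro!: sum_nonneg)

lemma nonneg_coeffs_single: "0 \<le> c \<Longrightarrow> nonneg_coeffs (Poly_Mapping.single \<mu> c)"
  by (auto simp: nonneg_coeffs_def lookup_single when_def)

lemma nonneg_coeffs_add: "nonneg_coeffs p \<Longrightarrow> nonneg_coeffs q \<Longrightarrow> nonneg_coeffs (p + q)"
  by (auto simp: nonneg_coeffs_def lookup_add)

lemma nonneg_coeffs_mult: "nonneg_coeffs p \<Longrightarrow> nonneg_coeffs q \<Longrightarrow> nonneg_coeffs (p * q)"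
  unfolding rpoly_mult_singles
  by (intro nonneg_coeffs_sum nonneg_coeffs_single) (auto simp: nonneg_coeffs_def)

lemma nonneg_coeffs_1: "nonneg_coeffs 1"
  using nonneg_coeffs_single[of 1 0] by simp

lemma nonneg_coeffs_power: "nonneg_coeffs p \<Longrightarrow> nonneg_coeffs (p ^ k)"
  by (induction k) (simp_all add: nonneg_coeffs_1 nonneg_coeffs_mult)

lemma nonneg_coeffs_prod: "(\<And>i. i \<in> A \<Longrightarrow> nonneg_coeffs (f i)) \<Longrightarrow> nonneg_coeffs (\<Prod>i\<in>A. f i)"
  by (induction A rule: infinite_finite_induct) (simp_all add: nonneg_coeffs_1 nonneg_coeffs_mult)

lemma eval_rpoly_of_real:
  "eval_rpoly p (\<chi> i. of_real (x $ i)) = (of_real (eval_rpoly p x) :: complex)"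
  by (simp add: eval_rpoly_def monomial_at_def)

lemma eval_rpoly_nonneg: "nonneg_coeffs p \<Longrightarrow> (\<And>i. 0 \<le> x $ i) \<Longrightarrow> 0 \<le> (eval_rpoly p x :: real)"
  unfolding eval_rpoly_def monomial_at_def
  by (intro sum_nonneg mult_nonneg_nonneg prod_nonneg zero_le_power) (simp_all add: nonneg_coeffs_def)

lemma eval_rpoly_mono:
  fixes x y :: "real ^ 'n::finite"
  assumes "nonneg_coeffs p" "\<And>i. 0 \<le> x $ i" "\<And>i. x $ i \<le> y $ i"
  shows "eval_rpoly p x \<le> eval_rpoly p y"
  unfolding eval_rpoly_def monomial_at_def
  by (intro sum_mono mult_left_mono prod_mono conjI power_mono zero_le_power)
    (use assms in \<open>auto simp: nonneg_coeffs_def\<close>)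

lemma continuous_on_eval_rpoly: "continuous_on X (eval_rpoly p :: complex ^ 'n::finite \<Rightarrow> complex)"
  unfolding eval_rpoly_def monomial_at_def by (intro continuous_intros)

section \<open>Approximation in the class \<open>LP_plus\<close>\<close>

text \<open>
  Capacity is only upper semicontinuous. Replacing \<open>q\<close> by \<open>q(x + e) \<Prod>\<^sub>i (1 + e x\<^sub>i)\<^sup>M\<close> keeps
  stability, does not decrease \<open>q\<close>, and makes the lower bound automatic outside a box depending
  only on \<open>e\<close> and a lower bound for \<open>q(e, \<dots>, e)\<close>.
\<close>

definition perturb :: "real \<Rightarrow> nat \<Rightarrow> 'n::finite rpoly \<Rightarrow> 'n rpoly" where
  "perturb e M q = (\<Sum>\<mu>\<in>Poly_Mapping.keys q. Poly_Mapping.single 0 (Poly_Mapping.lookup q \<mu>) *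
      (\<Prod>i\<in>UNIV. (Poly_Mapping.single (Poly_Mapping.single i 1) 1 + Poly_Mapping.single 0 e) ^ Poly_Mapping.lookup \<mu> i)) *
    (\<Prod>i\<in>UNIV. (1 + Poly_Mapping.single (Poly_Mapping.single i 1) e) ^ M)"

lemma eval_perturb:
  "eval_rpoly (perturb e M q) x = eval_rpoly q (\<chi> i. x $ i + of_real e) * (\<Prod>i\<in>UNIV. (1 + of_real e * x $ i) ^ M)"
  unfolding perturb_def
  by (simp add: eval_rpoly_mult eval_rpoly_sum eval_rpoly_prod eval_rpoly_power eval_rpoly_add
      eval_rpoly_single eval_rpoly_1 monomial_at_single monomial_at_0)
    (simp add: eval_rpoly_def monomial_at_def)

lemma nonneg_coeffs_perturb: "nonneg_coeffs q \<Longrightarrow> 0 \<le> e \<Longrightarrow> nonneg_coeffs (perturb e M q)"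
  unfolding perturb_def
  by (intro nonneg_coeffs_mult nonneg_coeffs_sum nonneg_coeffs_prod nonneg_coeffs_power
      nonneg_coeffs_add nonneg_coeffs_single nonneg_coeffs_1) (auto simp: nonneg_coeffs_def)

text \<open>A real shift preserves the upper half-plane, and \<open>1 + e * x\<close> vanishes at no
  non-real point.\<close>

lemma real_stable_perturb:
  fixes q :: "'n::finite rpoly"
  assumes "real_stable q" "q \<noteq> 0" "0 \<le> e"
  shows "real_stable (perturb e M q)"
  unfolding real_stable_def
proof (intro disjI2 allI impI)
  fix z :: "complex ^ 'n" assume z: "\<forall>i. 0 < Im (z $ i)"
  have "1 + of_real e * z $ i \<noteq> 0" for i
  proof
    assume *: "1 + of_real e * z $ i = 0"
    then have "Im (1 + of_real e * z $ i) = 0" by simp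
    then have "e = 0" using z by (simp add: less_imp_neq[symmetric])
    with * show False by simp
  qed
  moreover have "eval_rpoly q (\<chi> i. z $ i + of_real e) \<noteq> 0"
    using assms z by (auto simp: real_stable_def)
  ultimately show "eval_rpoly (perturb e M q) z \<noteq> 0" by (simp add: eval_perturb)
qed

lemma vec_powr_pos: "x \<in> pos_orthant \<Longrightarrow> 0 < vec_powr x \<alpha>"
  unfolding vec_powr_def pos_orthant_def by (intro prod_pos) (metis mem_Collect_eq order_less_irrefl powr_gt_zero)

lemma vec_powr_mono:
  fixes x y \<alpha> :: "real ^ 'n::finite"
  assumes "x \<in> pos_orthant" "\<And>i. x $ i \<le> y $ i" "\<And>i. 0 \<le> \<alpha> $ i"
  shows "vec_powr x \<alpha> \<le> vec_powr y \<alpha>"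
  unfolding vec_powr_def
  by (intro prod_mono conjI powr_mono2) (use assms in \<open>auto simp: pos_orthant_def less_imp_le\<close>)

lemma norm_vec_le_card:
  fixes z :: "complex ^ 'n::finite"
  assumes "\<And>i. norm (z $ i) \<le> B"
  shows "norm z \<le> real CARD('n) * B"
proof -
  have "norm z \<le> (\<Sum>i\<in>UNIV. norm (z $ i))"
    unfolding norm_vec_def by (rule L2_set_le_sum) simp
  also have "\<dots> \<le> (\<Sum>i\<in>(UNIV :: 'n set). B)" by (intro sum_mono assms)
  finally show ?thesis by simp
qed

text \<open>Inside the box of side \<open>R\<close>, uniform convergence gives the bound up to the
  fraction \<open>\<delta>\<close>. Outside it only \<open>q(x + e) >= q(e, ..., e)\<close> is used,
  and the added factors outgrow the monomial; this part needs no convergence at large points, so one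
  \<open>k\<close> serves all \<open>x\<close>.\<close>

lemma capacity_perturb_eventually:
  fixes q :: "nat \<Rightarrow> 'n::finite rpoly" and \<alpha> :: "real ^ 'n" and f :: "complex ^ 'n \<Rightarrow> complex"
  assumes q: "\<And>k. nonneg_coeffs (q k)"
    and lim: "\<And>K. compact K \<Longrightarrow> uniform_limit K (\<lambda>k. eval_rpoly (q k)) f sequentially"
    and real: "\<And>x. x \<in> pos_orthant \<Longrightarrow> f (\<chi> i. of_real (x $ i)) = of_real (F x)"
    and cap: "\<And>x. x \<in> pos_orthant \<Longrightarrow> D * vec_powr x \<alpha> \<le> F x"
    and D: "0 < D" and \<alpha>: "\<And>i. 0 \<le> \<alpha> $ i" and M: "\<And>i. \<alpha> $ i + 1 \<le> real M"
    and e: "0 < e" and \<delta>: "0 < \<delta>" "\<delta> < 1"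
  shows "\<forall>\<^sub>F k in sequentially. \<forall>x\<in>pos_orthant. (1 - \<delta>) * D * vec_powr x \<alpha> \<le> eval_rpoly (perturb e M (q k)) x"
proof -
  define ee :: "real ^ 'n" where "ee = (\<chi> i. e)"
  have ee: "ee \<in> pos_orthant" using e by (simp add: ee_def pos_orthant_def)
  \<comment> \<open>Half of the limit at \<open>(e, ..., e)\<close>, so that it bounds the
    approximants there from below once the error is at most \<open>\<eta>\<close>.\<close>
  define \<eta> where "\<eta> = F ee / 2"
  have Fee: "0 < F ee" using cap[OF ee] mult_pos_pos[OF D vec_powr_pos[OF ee, of \<alpha>]] by linarith
  define E where "E = vec_powr ee \<alpha>"
  have E: "0 < E" unfolding E_def by (rule vec_powr_pos[OF ee])
  \<comment> \<open>Chosen so that a single factor \<open>1 + e * R\<close> makes up for the ratio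
    \<open>D / (\<eta> * E)\<close>.\<close>
  define R where "R = D / (\<eta> * E * e)"
  have \<eta>: "0 < \<eta>" using Fee by (simp add: \<eta>_def)
  have R: "0 < R" "D \<le> \<eta> * E * (1 + e * R)"
    using D \<eta> E e by (auto simp: R_def distrib_left)
  define B where "B = real CARD('n) * (R + e)"
  \<comment> \<open>The first bound keeps the error below the fraction \<open>\<delta>\<close> of
    the monomial bound, which is at least \<open>D * E\<close> at points \<open>x + e\<close>; the
    second keeps the value at \<open>(e, ..., e)\<close> above \<open>\<eta>\<close>.\<close>
  define \<tau> where "\<tau> = min (\<delta> * D * E) \<eta>"
  have \<tau>: "0 < \<tau>" using \<delta> D E \<eta> by (simp add: \<tau>_def)
  have "\<forall>\<^sub>F k in sequentially. \<forall>z\<in>cball 0 B. dist (eval_rpoly (q k) z) (f z) < \<tau>"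
    using uniform_limitD[OF lim[OF compact_cball] \<tau>] .
  then show ?thesis
  proof eventually_elim
    case (elim k)
    have close: "F x - \<tau> \<le> eval_rpoly (q k) x" if x: "x \<in> pos_orthant" "\<And>i. x $ i \<le> R + e" for x :: "real ^ 'n"
    proof -
      have "norm (\<chi> i. complex_of_real (x $ i)) \<le> B"
        unfolding B_def by (rule norm_vec_le_card) (use x in \<open>auto simp: pos_orthant_def less_imp_le\<close>)
      then have "dist (eval_rpoly (q k) (\<chi> i. complex_of_real (x $ i))) (f (\<chi> i. of_real (x $ i))) < \<tau>"
        using elim by simp
      then have "norm (complex_of_real (eval_rpoly (q k) x - F x)) < \<tau>"
        unfolding eval_rpoly_of_real real[OF x(1)] by (simp add: dist_norm)
      then have "\<bar>eval_rpoly (q k) x - F x\<bar> < \<tau>" unfolding norm_of_real .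
      then show ?thesis by linarith
    qed
    show ?case
    proof
      fix x :: "real ^ 'n" assume x: "x \<in> pos_orthant"
      define xe :: "real ^ 'n" where "xe = (\<chi> i. x $ i + e)"
      have xe: "xe \<in> pos_orthant" using x e by (simp add: xe_def pos_orthant_def add_pos_pos)
      have x0: "0 < x $ i" for i using x by (simp add: pos_orthant_def)
      have eval: "eval_rpoly (perturb e M (q k)) x = eval_rpoly (q k) xe * (\<Prod>i\<in>UNIV. (1 + e * x $ i) ^ M)"
        by (simp add: eval_perturb xe_def)
      have ge1: "1 \<le> 1 + e * x $ i" for i using e x0[of i] by simp
      show "(1 - \<delta>) * D * vec_powr x \<alpha> \<le> eval_rpoly (perturb e M (q k)) x"
      proof (cases "\<forall>i. x $ i \<le> R")
        case True
        have "vec_powr ee \<alpha> \<le> vec_powr xe \<alpha>"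
          by (rule vec_powr_mono[OF ee]) (use x0 \<alpha> in \<open>auto simp: ee_def xe_def less_imp_le\<close>)
        then have "\<delta> * D * E \<le> \<delta> * D * vec_powr xe \<alpha>" unfolding E_def using \<delta> D by simp
        moreover have "\<tau> \<le> \<delta> * D * E" by (simp add: \<tau>_def)
        moreover have "F xe - \<tau> \<le> eval_rpoly (q k) xe"
          by (rule close[OF xe]) (use True in \<open>simp add: xe_def\<close>)
        ultimately have "(1 - \<delta>) * (D * vec_powr xe \<alpha>) \<le> eval_rpoly (q k) xe"
          using cap[OF xe] by (simp add: algebra_simps)
        moreover have "vec_powr x \<alpha> \<le> vec_powr xe \<alpha>"
          by (rule vec_powr_mono[OF x]) (use e \<alpha> in \<open>auto simp: xe_def\<close>)
        then have "(1 - \<delta>) * (D * vec_powr x \<alpha>) \<le> (1 - \<delta>) * (D * vec_powr xe \<alpha>)"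
          using \<delta> D by (intro mult_left_mono) auto
        moreover have "eval_rpoly (q k) xe * 1 \<le> eval_rpoly (q k) xe * (\<Prod>i\<in>UNIV. (1 + e * x $ i) ^ M)"
          using ge1 q xe by (intro mult_left_mono prod_ge_1 one_le_power eval_rpoly_nonneg)
            (auto simp: pos_orthant_def less_imp_le)
        ultimately show ?thesis unfolding eval by (simp add: mult.assoc)
      next
        case False
        then obtain i0 where i0: "R < x $ i0" by (auto simp: not_le)
        have "F ee - \<tau> \<le> eval_rpoly (q k) ee"
          by (rule close[OF ee]) (use R in \<open>simp add: ee_def\<close>)
        moreover have "\<tau> \<le> \<eta>" by (simp add: \<tau>_def)
        moreover have "eval_rpoly (q k) ee \<le> eval_rpoly (q k) xe"
          by (rule eval_rpoly_mono[OF q]) (use e x0 in \<open>auto simp: ee_def xe_def less_imp_le\<close>)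
        ultimately have q_ge: "\<eta> \<le> eval_rpoly (q k) xe" by (simp add: \<eta>_def)
        \<comment> \<open>Since \<open>M >= \<alpha>_i + 1\<close>, the powers in each variable
          cover \<open>(e * x_i)\<close> to the power \<open>\<alpha>_i\<close> and leave one spare
          factor; the spare factor at \<open>i0\<close> exceeds \<open>1 + e * R\<close>.\<close>
        have "E * vec_powr x \<alpha> * (1 + e * R) \<le> E * vec_powr x \<alpha> * (\<Prod>i\<in>UNIV. 1 + e * x $ i)"
        proof (rule mult_left_mono)
          have "1 + e * R \<le> (1 + e * x $ i0) * 1" using i0 e by simp
          also have "\<dots> \<le> (1 + e * x $ i0) * (\<Prod>i\<in>UNIV - {i0}. 1 + e * x $ i)"
            using ge1 ge1[of i0] by (intro mult_left_mono prod_ge_1) auto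
          also have "\<dots> = (\<Prod>i\<in>UNIV. 1 + e * x $ i)" by (simp add: prod.remove)
          finally show "1 + e * R \<le> (\<Prod>i\<in>UNIV. 1 + e * x $ i)" .
          show "0 \<le> E * vec_powr x \<alpha>" using E vec_powr_pos[OF x, of \<alpha>] by simp
        qed
        also have "E * vec_powr x \<alpha> * (\<Prod>i\<in>UNIV. 1 + e * x $ i) =
            (\<Prod>i\<in>UNIV. (e * x $ i) powr \<alpha> $ i * (1 + e * x $ i))"
          using e x0 by (simp add: E_def vec_powr_def ee_def prod.distrib powr_mult less_imp_le)
        also have "\<dots> \<le> (\<Prod>i\<in>UNIV. (1 + e * x $ i) ^ M)"
        proof (rule prod_mono, intro conjI)
          fix i
          have pos: "0 < 1 + e * x $ i" using ge1[of i] by linarith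
          show "0 \<le> (e * x $ i) powr \<alpha> $ i * (1 + e * x $ i)" using pos by simp
          have "(e * x $ i) powr \<alpha> $ i * (1 + e * x $ i) \<le> (1 + e * x $ i) powr \<alpha> $ i * (1 + e * x $ i)"
            using e x0[of i] \<alpha> pos by (intro mult_right_mono powr_mono2) auto
          also have "\<dots> = (1 + e * x $ i) powr (\<alpha> $ i + 1)" using pos by (simp add: powr_add)
          also have "\<dots> \<le> (1 + e * x $ i) powr real M" using ge1 M by (intro powr_mono) auto
          also have "\<dots> = (1 + e * x $ i) ^ M" using pos by (simp add: powr_realpow)
          finally show "(e * x $ i) powr \<alpha> $ i * (1 + e * x $ i) \<le> (1 + e * x $ i) ^ M" .
        qed
        finally have "\<eta> * (E * vec_powr x \<alpha> * (1 + e * R)) \<le> eval_rpoly (perturb e M (q k)) x"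
          unfolding eval using q_ge \<eta> E R e vec_powr_pos[OF x, of \<alpha>]
          by (intro mult_mono) (auto intro!: mult_nonneg_nonneg add_nonneg_nonneg)
        moreover have "D * vec_powr x \<alpha> \<le> \<eta> * E * (1 + e * R) * vec_powr x \<alpha>"
          using R vec_powr_pos[OF x, of \<alpha>] by (intro mult_right_mono) auto
        moreover have "(1 - \<delta>) * (D * vec_powr x \<alpha>) \<le> 1 * (D * vec_powr x \<alpha>)"
          using \<delta> D vec_powr_pos[OF x, of \<alpha>] by (intro mult_right_mono) auto
        ultimately show ?thesis by (simp add: ac_simps)
      qed
    qed
  qed
qed

text \<open>A diagonal choice: for the perturbation size \<open>e j\<close>, an index
  \<open>k j\<close> is taken at which the capacity bound holds and \<open>q (k j)\<close> is within
  \<open>e j\<close> of \<open>f\<close> on the ball of radius \<open>j\<close>. The perturbation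
  disappears in the limit, while the capacity bound is retained.\<close>

lemma LP_plus_approx:
  fixes \<alpha> :: "real ^ 'n::finite"
  assumes f: "f \<in> LP_plus"
    and real: "\<And>x. x \<in> pos_orthant \<Longrightarrow> f (\<chi> i. of_real (x $ i)) = of_real (F x)"
    and cap: "\<And>x. x \<in> pos_orthant \<Longrightarrow> D * vec_powr x \<alpha> \<le> F x"
    and D: "0 < D" and \<alpha>: "\<And>i. 0 \<le> \<alpha> $ i"
  obtains r :: "nat \<Rightarrow> 'n rpoly" where
    "\<And>k. real_stable (r k)" "\<And>k. r k \<noteq> 0" "\<And>k. nonneg_coeffs (r k)"
    "\<And>z. (\<lambda>k. eval_rpoly (r k) z) \<longlonglongrightarrow> f z"
    "\<And>k x. x \<in> pos_orthant \<Longrightarrow> (1 - inverse (real (k + 2))) * D * vec_powr x \<alpha> \<le> eval_rpoly (r k) x"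
proof -
  from f obtain q where q: "\<And>k. real_stable (q k)" "\<And>k. nonneg_coeffs (q k)"
    and lim: "\<And>K. compact K \<Longrightarrow> uniform_limit K (\<lambda>k. eval_rpoly (q k)) f sequentially"
    unfolding LP_plus_def by blast
  obtain M :: nat where M: "\<And>i. \<alpha> $ i + 1 \<le> real M"
  proof -
    obtain M :: nat where "(\<Sum>i\<in>UNIV. \<alpha> $ i) + 1 \<le> real M" using real_arch_simple by blast
    moreover have "\<alpha> $ i \<le> (\<Sum>i\<in>UNIV. \<alpha> $ i)" for i by (rule member_le_sum) (use \<alpha> in auto)
    ultimately have "\<alpha> $ i + 1 \<le> real M" for i by (smt (verit))
    then show ?thesis using that by blast
  qed
  \<comment> \<open>The shift by 2 keeps \<open>1 - e j\<close> strictly positive from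
    \<open>j = 0\<close> on, which is used below to exclude the zero polynomial.\<close>
  define e where "e = (\<lambda>j. inverse (real (j + 2)))"
  have e: "0 < e j" "e j < 1" for j by (auto simp: e_def field_simps)
  have "\<exists>k. (\<forall>x\<in>pos_orthant. (1 - e j) * D * vec_powr x \<alpha> \<le> eval_rpoly (perturb (e j) M (q k)) x) \<and>
      (\<forall>z\<in>cball 0 (real j). dist (eval_rpoly (q k) z) (f z) < e j)" for j
  proof -
    have "\<forall>\<^sub>F k in sequentially. \<forall>x\<in>pos_orthant. (1 - e j) * D * vec_powr x \<alpha> \<le> eval_rpoly (perturb (e j) M (q k)) x"
      by (rule capacity_perturb_eventually[OF q(2) lim real cap D \<alpha> M]) (use e in auto)
    moreover have "\<forall>\<^sub>F k in sequentially. \<forall>z\<in>cball 0 (real j). dist (eval_rpoly (q k) z) (f z) < e j"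
      using uniform_limitD[OF lim[OF compact_cball] e(1)] .
    ultimately show ?thesis
      using eventually_happens'[OF sequentially_bot eventually_conj] by blast
  qed
  then obtain k where k: "\<And>j x. x \<in> pos_orthant \<Longrightarrow> (1 - e j) * D * vec_powr x \<alpha> \<le> eval_rpoly (perturb (e j) M (q (k j))) x"
    "\<And>j z. z \<in> cball 0 (real j) \<Longrightarrow> dist (eval_rpoly (q (k j)) z) (f z) < e j"
    by metis
  define r where "r = (\<lambda>j. perturb (e j) M (q (k j)))"
  have r_nz: "r j \<noteq> 0" for j
  proof
    assume "r j = 0"
    define x :: "real ^ 'n" where "x = (\<chi> i. 1)"
    have x: "x \<in> pos_orthant" by (simp add: x_def pos_orthant_def)
    have "0 < (1 - e j) * D * vec_powr x \<alpha>" using e[of j] D vec_powr_pos[OF x] by simp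
    with k(1)[OF x, of j] \<open>r j = 0\<close> show False by (simp add: r_def eval_rpoly_0)
  qed
  have q_nz: "q (k j) \<noteq> 0" for j using r_nz[of j] by (auto simp: r_def perturb_def)
  have e_lim: "e \<longlonglongrightarrow> 0"
    unfolding e_def using LIMSEQ_ignore_initial_segment[OF lim_inverse_n, of 2] by simp
  have f_cont: "continuous_on UNIV f"
  proof -
    have cball: "continuous_on (cball 0 B) f" for B
      by (rule uniform_limit_theorem[OF _ lim[OF compact_cball]]) (simp_all add: continuous_on_eval_rpoly)
    have "continuous_on (ball 0 B) f" for B by (rule continuous_on_subset[OF cball ball_subset_cball])
    then have "continuous_on (\<Union>B. ball 0 B) f"
      by (intro continuous_on_open_UN) auto
    moreover have "(\<Union>B. ball (0 :: complex ^ 'n) B) = UNIV"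
      by (auto simp: mem_ball) (metis lt_ex gt_ex)
    ultimately show ?thesis by simp
  qed
  have conv: "(\<lambda>j. eval_rpoly (r j) z) \<longlonglongrightarrow> f z" for z
  proof -
    \<comment> \<open>The shift in \<open>perturb\<close> moves the evaluation point with
      \<open>j\<close>, so convergence at \<open>z\<close> alone is not enough. The points
      \<open>w j\<close> are bounded, hence eventually inside the ball of radius \<open>j\<close>,
      and continuity of \<open>f\<close> takes them back to \<open>z\<close>.\<close>
    define w where "w = (\<lambda>j. \<chi> i. z $ i + complex_of_real (e j))"
    have "(\<lambda>j. \<chi> i. z $ i + complex_of_real (e j)) \<longlonglongrightarrow> (\<chi> i. z $ i + complex_of_real 0)"
      by (intro tendsto_vec_lambda tendsto_intros e_lim)
    then have w: "w \<longlonglongrightarrow> z" by (simp add: w_def)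
    then have fw: "(\<lambda>j. f (w j)) \<longlonglongrightarrow> f z"
      using f_cont by (simp add: continuous_on_eq_continuous_at isCont_tendsto_compose)
    obtain B where B: "\<And>j. norm (w j) \<le> B"
      using Bseq_def convergent_imp_Bseq convergentI[OF w] by metis
    have "\<forall>\<^sub>F j in sequentially. dist (eval_rpoly (q (k j)) (w j)) (f (w j)) < e j"
    proof -
      obtain J :: nat where J: "B \<le> real J" using real_arch_simple by blast
      show ?thesis using eventually_ge_at_top[of J]
      proof eventually_elim
        case (elim j)
        then have "norm (w j) \<le> real j" using B[of j] J by linarith
        then show ?case by (intro k(2)) simp
      qed
    qed
    then have "(\<lambda>j. dist (eval_rpoly (q (k j)) (w j)) (f (w j))) \<longlonglongrightarrow> 0"
      by (intro tendsto_sandwich[OF _ _ tendsto_const e_lim]) (auto elim: eventually_mono)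
    then have "(\<lambda>j. eval_rpoly (q (k j)) (w j) - f (w j)) \<longlonglongrightarrow> 0"
      by (simp add: dist_norm tendsto_norm_zero_iff)
    from tendsto_add[OF this fw] have "(\<lambda>j. eval_rpoly (q (k j)) (w j)) \<longlonglongrightarrow> f z" by simp
    moreover have "(\<lambda>j. \<Prod>i\<in>UNIV. (1 + complex_of_real (e j) * z $ i) ^ M) \<longlonglongrightarrow>
        (\<Prod>i\<in>UNIV. (1 + complex_of_real 0 * z $ i) ^ M)"
      by (intro tendsto_intros e_lim)
    ultimately have "(\<lambda>j. eval_rpoly (q (k j)) (w j) * (\<Prod>i\<in>UNIV. (1 + complex_of_real (e j) * z $ i) ^ M)) \<longlonglongrightarrow> f z * 1"
      by (intro tendsto_mult) simp_all
    then show ?thesis by (simp add: r_def eval_perturb w_def)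
  qed
  show thesis
  proof (rule that[of r])
    show "real_stable (r j)" for j
      unfolding r_def using q q_nz e by (intro real_stable_perturb) (auto intro: less_imp_le)
    show "nonneg_coeffs (r j)" for j
      unfolding r_def using q e by (intro nonneg_coeffs_perturb) (auto intro: less_imp_le)
    show "(1 - inverse (real (j + 2))) * D * vec_powr x \<alpha> \<le> eval_rpoly (r j) x" if "x \<in> pos_orthant" for j x
      using k(1)[OF that, of j] by (simp add: r_def e_def)
  qed (fact r_nz conv)+
qed

section \<open>Convergence of coefficients\<close>

text \<open>Orthogonality of the characters of the integers modulo \<open>m\<close>: for distinct
  \<open>a\<close>, \<open>b\<close> below \<open>m\<close> the sum is geometric, with an
  \<open>m\<close>-th root of unity other than 1 as its ratio.\<close>

lemma sum_cis_multiples: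
  fixes a b m :: nat
  assumes m: "0 < m"
  shows "norm (\<Sum>j<m. cis (2 * pi * real j * (real a - real b) / real m)) \<le> real m"
    and "a = b \<Longrightarrow> (\<Sum>j<m. cis (2 * pi * real j * (real a - real b) / real m)) = of_nat m"
    and "a \<noteq> b \<Longrightarrow> a < m \<Longrightarrow> b < m \<Longrightarrow> (\<Sum>j<m. cis (2 * pi * real j * (real a - real b) / real m)) = 0"
proof -
  let ?s = "\<Sum>j<m. cis (2 * pi * real j * (real a - real b) / real m)"
  show "norm ?s \<le> real m"
    using sum_norm_le[of "{..<m}" "\<lambda>j. cis (2 * pi * real j * (real a - real b) / real m)" "\<lambda>_. 1"] by simp
  show "?s = of_nat m" if "a = b" using that by simp
  assume ab: "a \<noteq> b" "a < m" "b < m"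
  define w where "w = cis (2 * pi * (real a - real b) / real m)"
  have "?s = (\<Sum>j<m. w ^ j)"
    unfolding w_def Complex.DeMoivre by (intro sum.cong refl arg_cong[where f=cis]) (simp add: field_simps)
  moreover have "w ^ m = 1"
  proof -
    have "w ^ m = cis (2 * pi * (real a - real b))"
      unfolding w_def Complex.DeMoivre using m by simp
    also have "\<dots> = 1" by (rule cis_multiple_2pi) simp
    finally show ?thesis .
  qed
  moreover have "w \<noteq> 1"
  proof
    assume "w = 1"
    then have "cos (2 * pi * (real a - real b) / real m) = 1" by (simp add: w_def complex_eq_iff)
    then obtain n :: int where "2 * pi * (real a - real b) / real m = of_int n * 2 * pi"
      using cos_one_2pi_int by auto
    then have "(2 * pi) * (real a - real b) = (2 * pi) * (of_int n * real m)" using m by (simp add: field_simps)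
    then have "real a - real b = of_int n * real m" by (simp only: mult_cancel_left) simp
    then have eq: "int a - int b = n * int m" by (metis of_int_diff of_int_eq_iff of_int_mult of_int_of_nat_eq)
    then have "int m dvd int a - int b" by simp
    moreover have "\<bar>int a - int b\<bar> < int m" using ab by linarith
    ultimately have "int a - int b = 0" using zdvd_not_zless by (metis abs_of_nat dvd_imp_le_int not_less)
    then show False using ab by simp
  qed
  ultimately show "?s = 0" by (simp add: geometric_sum)
qed

text \<open>
  A discrete version of Cauchy's coefficient formula: averaging over products of \<open>m\<close>-th roots of
  unity recovers the coefficient of \<open>\<mu>\<close> up to those of exponents congruent to \<open>\<mu>\<close> modulo \<open>m\<close>.
\<close>

definition torus_coeff :: "nat \<Rightarrow> ('n::finite \<Rightarrow>\<^sub>0 nat) \<Rightarrow> (complex ^ 'n \<Rightarrow> complex) \<Rightarrow> complex" where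
  "torus_coeff m \<mu> f = (\<Sum>j\<in>PiE UNIV (\<lambda>_. {..<m}). f (\<chi> i. cis (2 * pi * real (j i) / real m)) *
     (\<Prod>i\<in>UNIV. cis (- (2 * pi * real (j i) * real (Poly_Mapping.lookup \<mu> i) / real m)) / of_nat m))"

lemma torus_coeff_monomial:
  fixes \<mu> \<nu> :: "'n::finite \<Rightarrow>\<^sub>0 nat"
  shows "torus_coeff m \<mu> (monomial_at \<nu>) =
    (\<Prod>i\<in>UNIV. (\<Sum>j<m. cis (2 * pi * real j * (real (Poly_Mapping.lookup \<nu> i) - real (Poly_Mapping.lookup \<mu> i)) / real m)) / of_nat m)"
proof -
  let ?l = "Poly_Mapping.lookup"
  have "torus_coeff m \<mu> (monomial_at \<nu>) = (\<Sum>j\<in>PiE UNIV (\<lambda>_. {..<m}). \<Prod>i\<in>UNIV.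
      cis (2 * pi * real (j i) * (real (?l \<nu> i) - real (?l \<mu> i)) / real m) / of_nat m)"
    unfolding torus_coeff_def monomial_at_def prod.distrib[symmetric]
  proof (intro sum.cong refl prod.cong)
    fix j :: "'n \<Rightarrow> nat" and i
    have "real (?l \<nu> i) * (2 * pi * real (j i) / real m) + - (2 * pi * real (j i) * real (?l \<mu> i) / real m) =
        2 * pi * real (j i) * (real (?l \<nu> i) - real (?l \<mu> i)) / real m"
      by (simp add: right_diff_distrib diff_divide_distrib)
    then show "(\<chi> i. cis (2 * pi * real (j i) / real m)) $ i ^ ?l \<nu> i *
        (cis (- (2 * pi * real (j i) * real (?l \<mu> i) / real m)) / of_nat m) =
        cis (2 * pi * real (j i) * (real (?l \<nu> i) - real (?l \<mu> i)) / real m) / of_nat m"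
      by (simp add: Complex.DeMoivre cis_mult)
  qed
  also have "\<dots> = (\<Prod>i\<in>UNIV. \<Sum>j<m. cis (2 * pi * real j * (real (?l \<nu> i) - real (?l \<mu> i)) / real m) / of_nat m)"
    by (rule prod_sum_PiE[symmetric]) auto
  finally show ?thesis by (simp add: sum_divide_distrib)
qed

lemma has_sum_sum_finite:
  fixes F :: "'b \<Rightarrow> 'a \<Rightarrow> 'c::topological_comm_monoid_add"
  assumes "finite A" "\<And>a. a \<in> A \<Longrightarrow> (F a has_sum s a) U"
  shows "((\<lambda>x. \<Sum>a\<in>A. F a x) has_sum (\<Sum>a\<in>A. s a)) U"
  using assms by (induction A rule: finite_induct) (auto intro!: has_sum_add)

text \<open>Only exponents with some entry at least \<open>m\<close> can cause an error. For these
  the monomial at \<open>(2, ..., 2)\<close> is at least \<open>2^m\<close>, so the value of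
  \<open>f\<close> at that point divided by \<open>2^m\<close> bounds the whole error.\<close>

lemma torus_coeff_near_coeff:
  fixes f :: "complex ^ 'n::finite \<Rightarrow> complex"
  assumes c: "\<And>\<nu>. 0 \<le> c \<nu>"
    and f: "\<And>z. ((\<lambda>\<nu>. of_real (c \<nu>) * monomial_at \<nu> z) has_sum f z) UNIV"
    and m: "0 < m" "\<And>i. Poly_Mapping.lookup \<mu> i < m"
  shows "norm (torus_coeff m \<mu> f - of_real (c \<mu>)) \<le> Re (f (\<chi> i. 2)) / 2 ^ m"
proof -
  let ?l = "Poly_Mapping.lookup"
  have "((\<lambda>\<nu>. of_real (c \<nu>) * torus_coeff m \<mu> (monomial_at \<nu>)) has_sum torus_coeff m \<mu> f) UNIV"
  proof -
    have "((\<lambda>\<nu>. \<Sum>j\<in>PiE UNIV (\<lambda>_. {..<m}).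
        of_real (c \<nu>) * monomial_at \<nu> (\<chi> i. cis (2 * pi * real (j i) / real m)) *
        (\<Prod>i\<in>UNIV. cis (- (2 * pi * real (j i) * real (?l \<mu> i) / real m)) / of_nat m))
        has_sum torus_coeff m \<mu> f) UNIV"
      unfolding torus_coeff_def
      by (intro has_sum_sum_finite has_sum_cmult_left f finite_PiE) auto
    then show ?thesis
      by (simp add: torus_coeff_def sum_distrib_left mult.assoc)
  qed
  moreover have "((\<lambda>\<nu>. if \<nu> = \<mu> then of_real (c \<mu>) else 0) has_sum complex_of_real (c \<mu>)) UNIV"
    using has_sum_cong_neutral[of UNIV "{\<mu>}" "\<lambda>\<nu>. if \<nu> = \<mu> then complex_of_real (c \<mu>) else 0" "\<lambda>\<nu>. of_real (c \<mu>)"]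
      has_sum_finite[of "{\<mu>}" "\<lambda>\<nu>. complex_of_real (c \<mu>)"] by simp
  then have "((\<lambda>\<nu>. - (if \<nu> = \<mu> then of_real (c \<mu>) else 0)) has_sum - complex_of_real (c \<mu>)) UNIV"
    by (simp only: has_sum_uminus minus_minus)
  ultimately have "((\<lambda>\<nu>. of_real (c \<nu>) * torus_coeff m \<mu> (monomial_at \<nu>) + - (if \<nu> = \<mu> then of_real (c \<mu>) else 0))
      has_sum (torus_coeff m \<mu> f + - of_real (c \<mu>))) UNIV" (is "(?D has_sum _) UNIV")
    by (rule has_sum_add)
  moreover have g: "((\<lambda>\<nu>. c \<nu> * (\<Prod>i\<in>UNIV. 2 ^ ?l \<nu> i) / 2 ^ m) has_sum Re (f (\<chi> i. 2)) / 2 ^ m) UNIV" (is "(?g has_sum _) UNIV")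
  proof -
    have mon: "monomial_at \<nu> (\<chi> i. 2) = complex_of_real (\<Prod>i\<in>UNIV. 2 ^ ?l \<nu> i)" for \<nu>
      by (simp add: monomial_at_def)
    have "((\<lambda>\<nu>. Re (of_real (c \<nu>) * monomial_at \<nu> (\<chi> i. 2))) has_sum Re (f (\<chi> i. 2))) UNIV"
      by (rule has_sum_Re[OF f])
    then have "((\<lambda>\<nu>. c \<nu> * (\<Prod>i\<in>UNIV. 2 ^ ?l \<nu> i)) has_sum Re (f (\<chi> i. 2))) UNIV"
      unfolding mon of_real_mult[symmetric] Re_complex_of_real .
    from has_sum_cmult_left[OF this, of "1 / 2 ^ m"] show ?thesis by simp
  qed
  moreover have bound: "norm (?D \<nu>) \<le> ?g \<nu>" for \<nu>
  proof (cases "\<nu> = \<mu>")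
    case True
    have "torus_coeff m \<mu> (monomial_at \<mu>) = 1"
      unfolding torus_coeff_monomial using m by (simp add: sum_cis_multiples(2))
    then show ?thesis using True c by (simp add: prod_nonneg)
  next
    case False
    then obtain i0 where i0: "?l \<nu> i0 \<noteq> ?l \<mu> i0" by (auto simp: poly_mapping_eq_iff fun_eq_iff)
    show ?thesis
    proof (cases "\<forall>i. ?l \<nu> i < m")
      case True
      then have "torus_coeff m \<mu> (monomial_at \<nu>) = 0"
        unfolding torus_coeff_monomial
        by (intro prod_zero bexI[of _ i0]) (use i0 m in \<open>simp_all add: sum_cis_multiples(3)\<close>)
      then show ?thesis using False c by (simp add: prod_nonneg)
    next
      case False
      then obtain i1 where i1: "m \<le> ?l \<nu> i1" by (auto simp: not_less)
      have "norm (torus_coeff m \<mu> (monomial_at \<nu>)) \<le> 1"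
        unfolding torus_coeff_monomial prod_norm[symmetric]
        by (intro prod_le_1 conjI) (use m sum_cis_multiples(1)[OF m(1)] in \<open>simp_all add: norm_divide\<close>)
      then have "norm (?D \<nu>) \<le> c \<nu> * 1"
        using \<open>\<nu> \<noteq> \<mu>\<close> c[of \<nu>] by (simp add: norm_mult mult_left_le)
      also have "\<dots> \<le> c \<nu> * ((\<Prod>i\<in>UNIV. 2 ^ ?l \<nu> i) / 2 ^ m)"
      proof (rule mult_left_mono[OF _ c])
        have "(2::real) ^ m * 1 \<le> 2 ^ ?l \<nu> i1 * (\<Prod>i\<in>UNIV - {i1}. 2 ^ ?l \<nu> i)"
          using i1 by (intro mult_mono power_increasing prod_ge_1) auto
        also have "\<dots> = (\<Prod>i\<in>UNIV. 2 ^ ?l \<nu> i)" by (simp add: prod.remove)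
        finally show "1 \<le> (\<Prod>i\<in>UNIV. 2 ^ ?l \<nu> i) / (2::real) ^ m" by simp
      qed
      finally show ?thesis by simp
    qed
  qed
  ultimately have D: "infsum ?D UNIV = torus_coeff m \<mu> f - of_real (c \<mu>)" "infsum ?g UNIV = Re (f (\<chi> i. 2)) / 2 ^ m"
    by (auto dest: infsumI)
  have abs: "(\<lambda>\<nu>. norm (?D \<nu>)) summable_on UNIV"
    by (rule Infinite_Sum.abs_summable_on_comparison_test'[OF has_sum_imp_summable[OF g] bound])
  have "norm (infsum ?D UNIV) \<le> infsum (\<lambda>\<nu>. norm (?D \<nu>)) UNIV"
    by (rule norm_infsum_bound[OF abs])
  also have "\<dots> \<le> infsum ?g UNIV"
    by (rule infsum_mono[OF abs has_sum_imp_summable[OF g] bound])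
  finally show ?thesis unfolding D .
qed

lemma has_sum_eval_rpoly:
  fixes z :: "complex ^ 'n::finite"
  shows "((\<lambda>\<nu>. of_real (Poly_Mapping.lookup p \<nu>) * monomial_at \<nu> z) has_sum eval_rpoly p z) UNIV"
proof -
  have "((\<lambda>\<nu>. of_real (Poly_Mapping.lookup p \<nu>) * monomial_at \<nu> z) has_sum eval_rpoly p z) (Poly_Mapping.keys p)"
    unfolding eval_rpoly_def by (rule has_sum_finite) simp
  then show ?thesis
    by (subst has_sum_cong_neutral[where T="Poly_Mapping.keys p"]) (auto simp: in_keys_iff)
qed

text \<open>The values of the approximants at \<open>(2, ..., 2)\<close> are eventually bounded, so
  one \<open>m\<close> makes the error of the discrete formula small for all large \<open>k\<close>.
  For that \<open>m\<close> the formula involves finitely many points, where pointwise convergence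
  applies.\<close>

lemma lookup_tendsto_coeff:
  fixes f :: "complex ^ 'n::finite \<Rightarrow> complex" and r :: "nat \<Rightarrow> 'n rpoly"
  assumes c: "\<And>\<nu>. 0 \<le> c \<nu>"
    and f: "\<And>z. ((\<lambda>\<nu>. of_real (c \<nu>) * monomial_at \<nu> z) has_sum f z) UNIV"
    and r: "\<And>k. nonneg_coeffs (r k)" "\<And>z. (\<lambda>k. eval_rpoly (r k) z) \<longlonglongrightarrow> f z"
  shows "(\<lambda>k. Poly_Mapping.lookup (r k) \<mu>) \<longlonglongrightarrow> c \<mu>"
proof (rule LIMSEQ_I)
  fix \<epsilon> :: real assume \<epsilon>: "0 < \<epsilon>"
  define two :: "complex ^ 'n" where "two = (\<chi> i. 2)"
  define B where "B = \<bar>Re (f two)\<bar> + 1"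
  obtain m0 :: nat where m0: "B * (1 / 2) ^ m0 < \<epsilon> / 3"
  proof -
    have "(\<lambda>m. B * (1 / 2) ^ m) \<longlonglongrightarrow> B * 0"
      by (intro tendsto_intros LIMSEQ_realpow_zero) auto
    then have "\<forall>\<^sub>F m in sequentially. B * (1 / 2) ^ m < \<epsilon> / 3"
      using \<epsilon> by (intro order_tendstoD) auto
    then show ?thesis using that eventually_happens'[OF sequentially_bot] by blast
  qed
  define m where "m = m0 + (\<Sum>i\<in>UNIV. Poly_Mapping.lookup \<mu> i) + 1"
  have m: "0 < m" "Poly_Mapping.lookup \<mu> i < m" for i
    using member_le_sum[of i UNIV "Poly_Mapping.lookup \<mu>"] by (auto simp: m_def)
  have "B * (1 / 2) ^ m \<le> B * (1 / 2) ^ m0"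
    by (intro mult_left_mono power_decreasing) (auto simp: m_def B_def)
  then have "B * (1 / 2) ^ m < \<epsilon> / 3" using m0 by linarith
  then have small: "B / 2 ^ m < \<epsilon> / 3" by (simp add: power_one_over)
  have lim: "(\<lambda>k. torus_coeff m \<mu> (eval_rpoly (r k))) \<longlonglongrightarrow> torus_coeff m \<mu> f"
    unfolding torus_coeff_def by (intro tendsto_intros r(2))
  have "\<forall>\<^sub>F k in sequentially. norm (torus_coeff m \<mu> (eval_rpoly (r k)) - torus_coeff m \<mu> f) < \<epsilon> / 3"
    unfolding dist_norm[symmetric] by (rule tendstoD[OF lim]) (use \<epsilon> in simp)
  moreover have "\<forall>\<^sub>F k in sequentially. Re (eval_rpoly (r k) two) < B"
    using order_tendstoD(2)[OF tendsto_Re[OF r(2)[of two]], of B] by (simp add: B_def)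
  ultimately have "\<forall>\<^sub>F k in sequentially. norm (Poly_Mapping.lookup (r k) \<mu> - c \<mu>) < \<epsilon>"
  proof eventually_elim
    case (elim k)
    let ?tr = "torus_coeff m \<mu> (eval_rpoly (r k))" and ?tf = "torus_coeff m \<mu> f"
    have "norm (?tr - of_real (Poly_Mapping.lookup (r k) \<mu>)) \<le> Re (eval_rpoly (r k) two) / 2 ^ m"
      unfolding two_def
      by (rule torus_coeff_near_coeff[OF _ has_sum_eval_rpoly m]) (use r(1) in \<open>simp add: nonneg_coeffs_def\<close>)
    also have "\<dots> \<le> B / 2 ^ m" using elim(2) by (simp add: divide_right_mono)
    finally have 1: "norm (?tr - of_real (Poly_Mapping.lookup (r k) \<mu>)) < \<epsilon> / 3" using small by linarith
    have "norm (?tf - of_real (c \<mu>)) \<le> Re (f two) / 2 ^ m"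
      unfolding two_def by (rule torus_coeff_near_coeff[OF c f m])
    also have "\<dots> \<le> B / 2 ^ m" by (simp add: divide_right_mono B_def)
    finally have 2: "norm (?tf - of_real (c \<mu>)) < \<epsilon> / 3" using small by linarith
    have "norm (complex_of_real (Poly_Mapping.lookup (r k) \<mu> - c \<mu>)) =
        norm ((?tr - ?tf) - (?tr - of_real (Poly_Mapping.lookup (r k) \<mu>)) + (?tf - of_real (c \<mu>)))" by simp
    also have "\<dots> \<le> norm ((?tr - ?tf) - (?tr - of_real (Poly_Mapping.lookup (r k) \<mu>))) + norm (?tf - of_real (c \<mu>))"
      by (rule norm_triangle_ineq)
    also have "\<dots> \<le> norm (?tr - ?tf) + norm (?tr - of_real (Poly_Mapping.lookup (r k) \<mu>)) + norm (?tf - of_real (c \<mu>))"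
      using norm_triangle_ineq4 by (intro add_right_mono)
    also have "\<dots> < \<epsilon>" using elim(1) 1 2 by linarith
    finally show ?case unfolding norm_of_real by simp
  qed
  then show "\<exists>no. \<forall>n\<ge>no. norm (Poly_Mapping.lookup (r n) \<mu> - c \<mu>) < \<epsilon>"
    by (simp add: eventually_sequentially)
qed

text \<open>The sum runs over the exponents of \<open>p\<close> alone, so coefficientwise
  convergence of the approximants passes to the limit. The case \<open>D = 0\<close> is separate
  because \<open>LP_plus_approx\<close> needs a positive capacity bound.\<close>

theorem stable_LP_plus_pairing_ge:
  fixes p :: "'n::finite rpoly" and \<alpha> :: "real ^ 'n" and f :: "complex ^ 'n \<Rightarrow> complex"
  assumes p: "real_stable p" "p \<noteq> 0" "nonneg_coeffs p"
    and cap_p: "\<And>x. x \<in> pos_orthant \<Longrightarrow> C * vec_powr x \<alpha> \<le> eval_rpoly p x" and C: "0 \<le> C"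
    and LP: "f \<in> LP_plus" and c: "\<And>\<nu>. 0 \<le> c \<nu>"
    and f: "\<And>z. ((\<lambda>\<nu>. of_real (c \<nu>) * monomial_at \<nu> z) has_sum f z) UNIV"
    and real: "\<And>x. x \<in> pos_orthant \<Longrightarrow> f (\<chi> i. of_real (x $ i)) = of_real (F x)"
    and cap_f: "\<And>x. x \<in> pos_orthant \<Longrightarrow> D * vec_powr x \<alpha> \<le> F x" and D: "0 \<le> D"
    and \<alpha>: "\<And>i. 0 \<le> \<alpha> $ i"
  shows "C * D * self_powr \<alpha> * exp_neg \<alpha> \<le>
    (\<Sum>\<mu>\<in>Poly_Mapping.keys p. real (mfact \<mu>) * Poly_Mapping.lookup p \<mu> * c \<mu>)"
proof (cases "D = 0")
  case True
  then show ?thesis using p c by (auto simp: nonneg_coeffs_def intro!: sum_nonneg mult_nonneg_nonneg)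
next
  case False
  with D have "0 < D" by simp
  then obtain r where r: "\<And>k. real_stable (r k)" "\<And>k. r k \<noteq> 0" "\<And>k. nonneg_coeffs (r k)"
    "\<And>z. (\<lambda>k. eval_rpoly (r k) z) \<longlonglongrightarrow> f z"
    "\<And>k x. x \<in> pos_orthant \<Longrightarrow> (1 - inverse (real (k + 2))) * D * vec_powr x \<alpha> \<le> eval_rpoly (r k) x"
    using LP_plus_approx[OF LP real cap_f _ \<alpha>] by metis
  have "C * ((1 - inverse (real (k + 2))) * D) * self_powr \<alpha> * exp_neg \<alpha> \<le>
      (\<Sum>\<mu>\<in>Poly_Mapping.keys p. real (mfact \<mu>) * Poly_Mapping.lookup p \<mu> * Poly_Mapping.lookup (r k) \<mu>)" for k
  proof (rule stable_pairing_ge[OF p r(1-3) cap_p r(5) C _ \<alpha>])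
    have "inverse (real (k + 2)) \<le> 1" by (simp add: inverse_eq_divide)
    then show "0 \<le> (1 - inverse (real (k + 2))) * D" using D by simp
  qed
  moreover have "(\<lambda>k. C * ((1 - inverse (real (k + 2))) * D) * self_powr \<alpha> * exp_neg \<alpha>) \<longlonglongrightarrow>
      C * ((1 - 0) * D) * self_powr \<alpha> * exp_neg \<alpha>"
    by (intro tendsto_intros LIMSEQ_ignore_initial_segment[OF lim_inverse_n])
  moreover have "(\<lambda>k. \<Sum>\<mu>\<in>Poly_Mapping.keys p. real (mfact \<mu>) * Poly_Mapping.lookup p \<mu> * Poly_Mapping.lookup (r k) \<mu>) \<longlonglongrightarrow>
      (\<Sum>\<mu>\<in>Poly_Mapping.keys p. real (mfact \<mu>) * Poly_Mapping.lookup p \<mu> * c \<mu>)"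
    by (intro tendsto_intros lookup_tendsto_coeff[OF c f r(3,4)])
  ultimately have "C * ((1 - 0) * D) * self_powr \<alpha> * exp_neg \<alpha> \<le>
      (\<Sum>\<mu>\<in>Poly_Mapping.keys p. real (mfact \<mu>) * Poly_Mapping.lookup p \<mu> * c \<mu>)"
    by (intro tendsto_le[OF sequentially_bot]) auto
  then show ?thesis by simp
qed

section \<open>Capacity and the Newton polytope\<close>

lemma Cap_lower:
  assumes "\<And>x. x \<in> pos_orthant \<Longrightarrow> C * vec_powr x \<alpha> \<le> f x"
  shows "C \<le> Cap \<alpha> f"
  unfolding Cap_def
proof (rule cINF_greatest)
  have "(\<chi> i. 1) \<in> (pos_orthant :: (real ^ 'a) set)" by (simp add: pos_orthant_def)
  then show "(pos_orthant :: (real ^ 'a) set) \<noteq> {}" by blast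
  show "C \<le> f x / vec_powr x \<alpha>" if "x \<in> pos_orthant" for x
    using assms[OF that] vec_powr_pos[OF that, of \<alpha>] by (simp add: field_simps)
qed

lemma Cap_upper:
  assumes "\<And>x. x \<in> pos_orthant \<Longrightarrow> 0 \<le> f x" and x: "x \<in> pos_orthant"
  shows "Cap \<alpha> f * vec_powr x \<alpha> \<le> f x"
proof -
  have "Cap \<alpha> f \<le> f x / vec_powr x \<alpha>"
    unfolding Cap_def
  proof (rule cINF_lower[OF _ x])
    show "bdd_below ((\<lambda>x. f x / vec_powr x \<alpha>) ` pos_orthant)"
      by (intro bdd_belowI2[where m=0] divide_nonneg_pos assms vec_powr_pos)
  qed
  then show ?thesis using vec_powr_pos[OF x, of \<alpha>] by (simp add: field_simps)
qed

lemma eval_rpoly_nonneg_pos_orthant: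
  "nonneg_coeffs p \<Longrightarrow> x \<in> pos_orthant \<Longrightarrow> 0 \<le> (eval_rpoly p x :: real)"
  by (rule eval_rpoly_nonneg) (auto simp: pos_orthant_def less_imp_le)

lemma vec_powr_eq_exp:
  assumes "x \<in> pos_orthant"
  shows "vec_powr x \<alpha> = exp (\<Sum>i\<in>UNIV. \<alpha> $ i * ln (x $ i))"
proof -
  have "x $ i \<noteq> 0" for i using assms by (auto simp: pos_orthant_def less_imp_neq[THEN not_sym])
  then show ?thesis by (simp add: vec_powr_def powr_def exp_sum)
qed

text \<open>Jensen: if \<open>\<alpha>\<close> is a convex combination of exponents, the monomial of
  \<open>\<alpha>\<close> is at most the weighted mean of the monomials of \<open>p\<close>, hence
  at most their sum. The least coefficient of \<open>p\<close> then bounds the capacity from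
  below.\<close>

lemma Cap_pos_if_Newt:
  fixes p :: "'n::finite rpoly"
  assumes nn: "nonneg_coeffs p" and \<alpha>: "\<alpha> \<in> Newt p"
  shows "0 < Cap \<alpha> (eval_rpoly p)"
proof -
  let ?l = "Poly_Mapping.lookup"
  define v where "v = (\<lambda>\<mu>::'n \<Rightarrow>\<^sub>0 nat. (\<chi> i. real (?l \<mu> i)) :: real ^ 'n)"
  have inj: "inj v" by (auto simp: inj_on_def v_def vec_eq_iff poly_mapping_eq_iff fun_eq_iff)
  have "\<alpha> \<in> convex hull (v ` Poly_Mapping.keys p)" using \<alpha> by (simp add: Newt_def v_def)
  then obtain u where u: "\<And>y. y \<in> v ` Poly_Mapping.keys p \<Longrightarrow> 0 \<le> u y" "sum u (v ` Poly_Mapping.keys p) = 1"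
    "(\<Sum>y\<in>v ` Poly_Mapping.keys p. u y *\<^sub>R y) = \<alpha>"
    by (auto simp: convex_hull_finite)
  define w where "w = (\<lambda>\<mu>. u (v \<mu>))"
  have w: "0 \<le> w \<mu>" if "\<mu> \<in> Poly_Mapping.keys p" for \<mu> using u(1) that by (simp add: w_def)
  have w1: "(\<Sum>\<mu>\<in>Poly_Mapping.keys p. w \<mu>) = 1"
    using u(2) by (simp add: sum.reindex[OF inj_on_subset[OF inj subset_UNIV]] w_def o_def)
  have w\<alpha>: "(\<Sum>\<mu>\<in>Poly_Mapping.keys p. w \<mu> *\<^sub>R v \<mu>) = \<alpha>"
    using u(3) by (simp add: sum.reindex[OF inj_on_subset[OF inj subset_UNIV]] w_def o_def)
  have ne: "Poly_Mapping.keys p \<noteq> {}" using w1 by auto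
  define c where "c = Min (?l p ` Poly_Mapping.keys p)"
  have "0 < ?l p \<mu>" if "\<mu> \<in> Poly_Mapping.keys p" for \<mu>
    using that nn by (metis in_keys_iff nonneg_coeffs_def order_less_le)
  then have c: "0 < c" using ne by (simp add: c_def)
  have "c * vec_powr x \<alpha> \<le> eval_rpoly p x" if x: "x \<in> pos_orthant" for x
  proof -
    let ?L = "\<lambda>y. \<Sum>i\<in>UNIV. y $ i * ln (x $ i)"
    have mon: "exp (?L (v \<mu>)) = monomial_at \<mu> x" for \<mu>
    proof -
      have "exp (?L (v \<mu>)) = vec_powr x (v \<mu>)" by (rule vec_powr_eq_exp[OF x, symmetric])
      also have "\<dots> = monomial_at \<mu> x"
        unfolding vec_powr_def monomial_at_def v_def
        by (intro prod.cong) (use x in \<open>auto simp: pos_orthant_def powr_realpow\<close>)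
      finally show ?thesis .
    qed
    have "?L \<alpha> = (\<Sum>\<mu>\<in>Poly_Mapping.keys p. w \<mu> *\<^sub>R ?L (v \<mu>))"
    proof -
      have "?L \<alpha> = (\<Sum>i\<in>UNIV. \<Sum>\<mu>\<in>Poly_Mapping.keys p. w \<mu> * (v \<mu> $ i * ln (x $ i)))"
        unfolding w\<alpha>[symmetric] by (simp add: sum_distrib_right mult.assoc)
      also have "\<dots> = (\<Sum>\<mu>\<in>Poly_Mapping.keys p. \<Sum>i\<in>UNIV. w \<mu> * (v \<mu> $ i * ln (x $ i)))"
        by (rule sum.swap)
      finally show ?thesis by (simp add: sum_distrib_left)
    qed
    then have "vec_powr x \<alpha> = exp (\<Sum>\<mu>\<in>Poly_Mapping.keys p. w \<mu> *\<^sub>R ?L (v \<mu>))"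
      by (simp only: vec_powr_eq_exp[OF x])
    also have "\<dots> \<le> (\<Sum>\<mu>\<in>Poly_Mapping.keys p. w \<mu> * exp (?L (v \<mu>)))"
      by (rule convex_on_sum[OF _ ne exp_convex w1]) (auto intro: w)
    also have "\<dots> \<le> (\<Sum>\<mu>\<in>Poly_Mapping.keys p. 1 * exp (?L (v \<mu>)))"
    proof (intro sum_mono mult_right_mono)
      fix \<mu> assume "\<mu> \<in> Poly_Mapping.keys p"
      then have "w \<mu> \<le> (\<Sum>\<mu>\<in>Poly_Mapping.keys p. w \<mu>)" by (intro member_le_sum) (auto intro: w)
      then show "w \<mu> \<le> 1" by (simp add: w1)
    qed simp
    finally have "c * vec_powr x \<alpha> \<le> (\<Sum>\<mu>\<in>Poly_Mapping.keys p. c * monomial_at \<mu> x)"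
      using c by (simp add: mon sum_distrib_left[symmetric])
    also have "\<dots> \<le> eval_rpoly p x"
      unfolding eval_rpoly_def monomial_at_def
      by (intro sum_mono mult_right_mono prod_nonneg)
        (use x in \<open>auto simp: c_def pos_orthant_def less_imp_le\<close>)
    finally show ?thesis .
  qed
  then show ?thesis using c Cap_lower order_less_le_trans by blast
qed

section \<open>Approximate exponentials\<close>

text \<open>
  The polynomial \<open>\<Prod>\<^sub>i (1 + z\<^sub>i x\<^sub>i / N)\<^sup>N\<close>; formally, \<open>T\<close> maps its limit \<open>exp (z \<bullet> x)\<close> to the symbol.
\<close>

definition exp_rpoly :: "nat \<Rightarrow> real ^ 'n::finite \<Rightarrow> 'n rpoly" where
  "exp_rpoly N z = (\<Sum>k\<in>PiE UNIV (\<lambda>_. {..N}). Poly_Mapping.single (Abs_poly_mapping k)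
     (\<Prod>i\<in>UNIV. real (N choose k i) * (z $ i / real N) ^ k i))"

lemma Abs_poly_mapping_eq_iff:
  fixes k k' :: "'n::finite \<Rightarrow> nat"
  shows "Abs_poly_mapping k = Abs_poly_mapping k' \<longleftrightarrow> k = k'"
  by (metis finite lookup_Abs_poly_mapping)

lemma eval_exp_rpoly:
  "eval_rpoly (exp_rpoly N z) x = (\<Prod>i\<in>UNIV. (1 + of_real (z $ i / real N) * x $ i) ^ N)"
proof -
  have "eval_rpoly (exp_rpoly N z) x = (\<Sum>k\<in>PiE UNIV (\<lambda>_. {..N}). \<Prod>i\<in>UNIV.
      of_nat (N choose k i) * (of_real (z $ i / real N) * x $ i) ^ k i)"
    unfolding exp_rpoly_def eval_rpoly_sum eval_rpoly_single monomial_at_def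
    by (simp add: prod.distrib power_mult_distrib mult.assoc)
  also have "\<dots> = (\<Prod>i\<in>UNIV. \<Sum>j\<le>N. of_nat (N choose j) * (of_real (z $ i / real N) * x $ i) ^ j)"
    by (rule prod_sum_PiE[symmetric]) auto
  also have "\<dots> = (\<Prod>i\<in>UNIV. (1 + of_real (z $ i / real N) * x $ i) ^ N)"
    by (intro prod.cong refl) (simp add: binomial_ring[of _ 1] add.commute[of 1])
  finally show ?thesis .
qed

lemma nonneg_coeffs_exp_rpoly: "(\<And>i. 0 \<le> z $ i) \<Longrightarrow> nonneg_coeffs (exp_rpoly N z)"
  unfolding exp_rpoly_def
  by (intro nonneg_coeffs_sum nonneg_coeffs_single prod_nonneg mult_nonneg_nonneg zero_le_power) auto

lemma real_stable_exp_rpoly: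
  fixes z :: "real ^ 'n::finite"
  assumes "\<And>i. 0 < z $ i" "0 < N"
  shows "real_stable (exp_rpoly N z)"
  unfolding real_stable_def
proof (intro disjI2 allI impI)
  fix x :: "complex ^ 'n" assume x: "\<forall>i. 0 < Im (x $ i)"
  have "1 + of_real (z $ i / real N) * x $ i \<noteq> 0" for i
  proof
    assume "1 + of_real (z $ i / real N) * x $ i = 0"
    then have "Im (1 + of_real (z $ i / real N) * x $ i) = 0" by simp
    moreover have "Im (1 + of_real (z $ i / real N) * x $ i) = z $ i / real N * Im (x $ i)" by simp
    moreover have "0 < z $ i / real N * Im (x $ i)" using assms x by simp
    ultimately show False by linarith
  qed
  then show "eval_rpoly (exp_rpoly N z) x \<noteq> 0" unfolding eval_exp_rpoly by simp
qed

text \<open>The corners of the cube of side \<open>N\<close> are exponents with positive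
  coefficients, and \<open>\<alpha>\<close> lies in their convex hull.\<close>

lemma Newt_exp_rpoly:
  fixes z \<alpha> :: "real ^ 'n::finite"
  assumes z: "\<And>i. 0 < z $ i" and N: "0 < N" and \<alpha>: "\<And>i. 0 \<le> \<alpha> $ i" "\<And>i. \<alpha> $ i \<le> real N"
  shows "\<alpha> \<in> Newt (exp_rpoly N z)"
proof -
  let ?V = "{x :: real ^ 'n. \<forall>i. x $ i = 0 \<or> x $ i = 1}"
  have V: "{x :: real ^ 'n. \<forall>i\<in>Basis. x \<bullet> i = 0 \<or> x \<bullet> i = 1} = ?V"
    by (simp add: Basis_vec_def inner_axis)
  have "(1 / real N) *\<^sub>R \<alpha> \<in> cbox 0 One"
    unfolding Cart_1[symmetric] using \<alpha> N by (simp add: mem_box_cart)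
  then have "(1 / real N) *\<^sub>R \<alpha> \<in> convex hull ?V"
    by (simp only: unit_interval_convex_hull V)
  then have "real N *\<^sub>R ((1 / real N) *\<^sub>R \<alpha>) \<in> convex hull ((\<lambda>x. real N *\<^sub>R x) ` ?V)"
    unfolding convex_hull_scaling by (rule imageI)
  moreover have "(\<lambda>x. real N *\<^sub>R x) ` ?V \<subseteq>
      (\<lambda>\<mu>. \<chi> i. real (Poly_Mapping.lookup \<mu> i)) ` Poly_Mapping.keys (exp_rpoly N z)"
  proof (clarify)
    fix x :: "real ^ 'n" assume x: "\<forall>i. x $ i = 0 \<or> x $ i = 1"
    define k where "k = (\<lambda>i. if x $ i = 0 then 0 else N)"
    have kP: "k \<in> PiE UNIV (\<lambda>_. {..N})" by (auto simp: k_def)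
    have "Poly_Mapping.lookup (exp_rpoly N z) (Abs_poly_mapping k) =
        (\<Sum>k'\<in>PiE UNIV (\<lambda>_. {..N}). if k' = k then \<Prod>i\<in>UNIV. real (N choose k i) * (z $ i / real N) ^ k i else 0)"
      unfolding exp_rpoly_def lookup_sum
      by (intro sum.cong refl) (auto simp: lookup_single when_def Abs_poly_mapping_eq_iff)
    also have "\<dots> = (\<Prod>i\<in>UNIV. real (N choose k i) * (z $ i / real N) ^ k i)"
      using kP by (subst sum.delta) (auto intro: finite_PiE)
    also have "\<dots> > 0" using z N by (intro prod_pos) (auto simp: k_def)
    finally have "Abs_poly_mapping k \<in> Poly_Mapping.keys (exp_rpoly N z)" by (simp add: in_keys_iff)
    moreover have "real N *\<^sub>R x = (\<chi> i. real (Poly_Mapping.lookup (Abs_poly_mapping k) i))"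
      using x by (auto simp: vec_eq_iff k_def)
    ultimately show "real N *\<^sub>R x \<in> (\<lambda>\<mu>. \<chi> i. real (Poly_Mapping.lookup \<mu> i)) ` Poly_Mapping.keys (exp_rpoly N z)"
      by blast
  qed
  ultimately have "real N *\<^sub>R ((1 / real N) *\<^sub>R \<alpha>) \<in> Newt (exp_rpoly N z)"
    unfolding Newt_def using hull_mono by blast
  then show ?thesis using N by simp
qed

section \<open>Capacity of the approximate exponentials\<close>

lemma one_plus_ge_entropy_weight:
  assumes "0 \<le> b" "b < 1" "0 < s"
  shows "s powr b \<le> entropy_weight b * (1 + s)"
proof (cases "b = 0")
  case True
  then show ?thesis using assms by (simp add: entropy_weight_def)
next
  case False
  with assms have b: "0 < b" "b < 1" by auto
  have "(1 / (1 - b)) powr (1 - b) * (s / b) powr b \<le> (1 - b) * (1 / (1 - b)) + b * (s / b)"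
    using b assms by (intro Youngs_inequality_0) auto
  also have "\<dots> = 1 + s" using b by simp
  finally show ?thesis
    using b assms by (simp add: entropy_weight_def powr_divide divide_simps mult.commute split: if_splits)
qed

text \<open>This is the product that \<open>N\<close> copies of each variable produce in the lower
  bound of \<open>stable_pairing_ge_approx\<close>. Here it bounds the capacity of
  \<open>exp_rpoly\<close> from the other side, which is why the two bounds meet in the
  limit.\<close>

definition tightness_factor :: "nat \<Rightarrow> real ^ 'n::finite \<Rightarrow> real" where
  "tightness_factor N \<alpha> = (\<Prod>i\<in>UNIV. real N powr \<alpha> $ i * entropy_weight (\<alpha> $ i / real N) ^ N)"

lemma entropy_weight_pos: "0 \<le> b \<Longrightarrow> b < 1 \<Longrightarrow> 0 < entropy_weight b"
  by (simp add: entropy_weight_def)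

lemma tightness_factor_pos:
  fixes \<alpha> :: "real ^ 'n::finite"
  assumes "0 < N" "\<And>i. 0 \<le> \<alpha> $ i" "\<And>i. \<alpha> $ i < real N"
  shows "0 < tightness_factor N \<alpha>"
  unfolding tightness_factor_def
  by (intro prod_pos ballI mult_pos_pos zero_less_power entropy_weight_pos) (use assms in auto)

text \<open>The polynomial factors over the variables, and each factor is the \<open>N\<close>-th
  power of \<open>1 + s\<close> with \<open>s = z_i x_i / N\<close>;
  \<open>one_plus_ge_entropy_weight\<close> applies at exponent
  \<open>\<alpha>_i / N\<close>.\<close>

lemma Cap_exp_rpoly_ge:
  fixes z \<alpha> :: "real ^ 'n::finite"
  assumes z: "z \<in> pos_orthant" and N: "0 < N" and \<alpha>: "\<And>i. 0 \<le> \<alpha> $ i" "\<And>i. \<alpha> $ i < real N"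
  shows "vec_powr z \<alpha> / tightness_factor N \<alpha> \<le> Cap \<alpha> (eval_rpoly (exp_rpoly N z))"
proof (rule Cap_lower)
  fix x :: "real ^ 'n" assume x: "x \<in> pos_orthant"
  have pos: "0 < z $ i" "0 < x $ i" for i using x z by (auto simp: pos_orthant_def)
  have "vec_powr z \<alpha> * vec_powr x \<alpha> = (\<Prod>i\<in>UNIV. (z $ i * x $ i) powr \<alpha> $ i)"
    using pos by (simp add: vec_powr_def powr_mult less_imp_le prod.distrib)
  also have "\<dots> \<le> (\<Prod>i\<in>UNIV. real N powr \<alpha> $ i * entropy_weight (\<alpha> $ i / real N) ^ N * (1 + z $ i / real N * x $ i) ^ N)"
  proof (rule prod_mono, intro conjI)
    fix i
    let ?s = "z $ i / real N * x $ i"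
    have s: "0 < ?s" using pos[of i] N by simp
    have "?s powr (\<alpha> $ i / real N) \<le> entropy_weight (\<alpha> $ i / real N) * (1 + ?s)"
      using \<alpha> N s by (intro one_plus_ge_entropy_weight) auto
    then have "(?s powr (\<alpha> $ i / real N)) ^ N \<le> (entropy_weight (\<alpha> $ i / real N) * (1 + ?s)) ^ N"
      by (intro power_mono) auto
    moreover have "(?s powr (\<alpha> $ i / real N)) ^ N = ?s powr \<alpha> $ i"
    proof -
      have "(?s powr (\<alpha> $ i / real N)) ^ N = (?s powr (\<alpha> $ i / real N)) powr real N"
        using s N by (subst powr_realpow) auto
      then show ?thesis using N by (simp only: powr_powr) simp
    qed
    moreover have "(z $ i * x $ i) powr \<alpha> $ i = real N powr \<alpha> $ i * ?s powr \<alpha> $ i"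
    proof -
      have "z $ i * x $ i = real N * ?s" using N by simp
      then show ?thesis using s N by (simp only: powr_mult)
    qed
    ultimately show "(z $ i * x $ i) powr \<alpha> $ i \<le>
        real N powr \<alpha> $ i * entropy_weight (\<alpha> $ i / real N) ^ N * (1 + ?s) ^ N"
      by (simp add: power_mult_distrib mult.assoc mult_left_mono)
  qed simp
  also have "\<dots> = tightness_factor N \<alpha> * eval_rpoly (exp_rpoly N z) x"
    by (simp add: tightness_factor_def eval_exp_rpoly prod.distrib)
  finally show "vec_powr z \<alpha> / tightness_factor N \<alpha> * vec_powr x \<alpha> \<le> eval_rpoly (exp_rpoly N z) x"
    using tightness_factor_pos[OF N \<alpha>] by (simp add: field_simps)
qed

text \<open>For positive entries the exponent \<open>N - a\<close> is split: the \<open>N\<close>-th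
  power of \<open>1 - a / N\<close> tends to \<open>e^(-a)\<close>, and its power \<open>-a\<close>
  tends to 1.\<close>

lemma tightness_factor_tendsto:
  fixes \<alpha> :: "real ^ 'n::finite"
  assumes \<alpha>: "\<And>i. 0 \<le> \<alpha> $ i"
  shows "(\<lambda>N. tightness_factor N \<alpha>) \<longlonglongrightarrow> exp_neg \<alpha> * self_powr \<alpha>"
  unfolding tightness_factor_def exp_neg_def self_powr_def prod.distrib[symmetric]
proof (rule tendsto_prod)
  fix i
  let ?a = "\<alpha> $ i"
  show "(\<lambda>N. real N powr ?a * entropy_weight (?a / real N) ^ N) \<longlonglongrightarrow> exp (- ?a) * (if ?a = 0 then 1 else ?a powr ?a)"
  proof (cases "?a = 0")
    case True
    have "\<forall>\<^sub>F N in sequentially. 1 = real N powr ?a * entropy_weight (?a / real N) ^ N"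
      using eventually_gt_at_top[of 0] by eventually_elim (simp add: True entropy_weight_def)
    from Lim_transform_eventually[OF tendsto_const this] True show ?thesis by simp
  next
    case False
    with \<alpha> have a: "0 < ?a" by (simp add: order_less_le)
    have "(\<lambda>N. 1 - ?a / real N) \<longlonglongrightarrow> 1 - 0"
      by (intro tendsto_intros tendsto_divide_0[OF tendsto_const] filterlim_at_top_imp_at_infinity filterlim_real_sequentially)
    then have "(\<lambda>N. (1 - ?a / real N) powr (- ?a)) \<longlonglongrightarrow> (1 - 0) powr (- ?a)"
      by (intro tendsto_intros) auto
    moreover have "(\<lambda>N. (1 - ?a / real N) ^ N) \<longlonglongrightarrow> exp (- ?a)"
      using tendsto_exp_limit_sequentially[of "- ?a"] by simp
    ultimately have "(\<lambda>N. ?a powr ?a * ((1 - ?a / real N) ^ N * (1 - ?a / real N) powr (- ?a))) \<longlonglongrightarrow>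
        ?a powr ?a * (exp (- ?a) * (1 - 0) powr (- ?a))"
      by (intro tendsto_mult tendsto_const)
    moreover have "\<forall>\<^sub>F N in sequentially. ?a < real N"
      using filterlim_real_sequentially by (simp add: filterlim_at_top_dense)
    then have "\<forall>\<^sub>F N in sequentially. ?a powr ?a * ((1 - ?a / real N) ^ N * (1 - ?a / real N) powr (- ?a)) =
        real N powr ?a * entropy_weight (?a / real N) ^ N"
    proof eventually_elim
      case (elim N)
      have "0 < 1 - ?a / real N" using elim a by auto
      then show ?case
        unfolding entropy_weight_power[OF a elim] by (simp add: powr_diff powr_minus_divide powr_realpow)
    qed
    ultimately show ?thesis using False Lim_transform_eventually by (fastforce simp: mult.commute)
  qed
qed

section \<open>Operators and their symbols\<close>

lemma lookup_scaleR: "Poly_Mapping.lookup (c *\<^sub>R p) \<mu> = c * Poly_Mapping.lookup (p :: 'a \<Rightarrow>\<^sub>0 real) \<mu>"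
proof -
  have "finite {i. c *\<^sub>R Poly_Mapping.lookup p i \<noteq> 0}"
    by (rule finite_subset[OF _ finite_lookup[of p]]) auto
  then show ?thesis unfolding scaleR_poly_mapping_def by simp
qed

lemma eval_rpoly_scaleR: "eval_rpoly (c *\<^sub>R p) x = of_real c * eval_rpoly p x"
proof -
  have "c *\<^sub>R p = Poly_Mapping.single 0 c * p"
    by (rule poly_mapping_eqI) (simp add: lookup_scaleR lookup_mult lookup_single when_mult Sum_any_when_independent)
  then show ?thesis by (simp add: eval_rpoly_mult eval_rpoly_single monomial_at_0)
qed

lemma mfact_pos: "0 < mfact \<mu>"
  by (simp add: mfact_def prod_pos)

context
  fixes T :: "'n::finite rpoly \<Rightarrow> 'm::finite rpoly"
  assumes lin: "linear T"
    and T_nonneg: "\<And>p. nonneg_coeffs p \<Longrightarrow> nonneg_coeffs (T p)"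
    and conv: "\<And>(x :: real ^ 'm) (z :: complex ^ 'n). (\<forall>j. 0 \<le> x $ j) \<Longrightarrow>
      (\<lambda>\<mu>. Symb_term T \<mu> z x) summable_on UNIV"
    and LP: "\<And>x :: real ^ 'm. (\<forall>j. 0 \<le> x $ j) \<Longrightarrow> (\<lambda>z :: complex ^ 'n. Symb T z x) \<in> LP_plus"
begin

lemma eval_T_sum_singles:
  "eval_rpoly (T (\<Sum>k\<in>A. Poly_Mapping.single (\<mu> k) (c k))) x =
    (\<Sum>k\<in>A. c k * eval_rpoly (T (Poly_Mapping.single (\<mu> k) 1)) (x :: real ^ 'm))"
proof -
  have "Poly_Mapping.single (\<mu> k) (c k) = c k *\<^sub>R Poly_Mapping.single (\<mu> k) 1" for k
    by (rule poly_mapping_eqI) (simp add: lookup_scaleR lookup_single when_def)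
  then have "T (\<Sum>k\<in>A. Poly_Mapping.single (\<mu> k) (c k)) = (\<Sum>k\<in>A. c k *\<^sub>R T (Poly_Mapping.single (\<mu> k) 1))"
    by (simp add: linear_sum[OF lin] linear_cmul[OF lin])
  then show ?thesis by (simp add: eval_rpoly_sum eval_rpoly_scaleR)
qed

definition symb_coeff :: "real ^ 'm \<Rightarrow> ('n \<Rightarrow>\<^sub>0 nat) \<Rightarrow> real" where
  "symb_coeff x \<mu> = eval_rpoly (T (Poly_Mapping.single \<mu> 1)) x / real (mfact \<mu>)"

lemma Symb_term_eq: "Symb_term T \<mu> z x = of_real (symb_coeff x \<mu>) * monomial_at \<mu> z"
  by (simp add: Symb_term_def symb_coeff_def)

lemma symb_coeff_nonneg:
  assumes "\<forall>j. 0 \<le> (x :: real ^ 'm) $ j"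
  shows "0 \<le> symb_coeff x \<mu>"
  unfolding symb_coeff_def
  by (intro divide_nonneg_nonneg eval_rpoly_nonneg T_nonneg nonneg_coeffs_single) (use assms in auto)

lemma Symb_has_sum:
  fixes z :: "complex ^ 'n" and x :: "real ^ 'm"
  assumes "\<forall>j. 0 \<le> x $ j"
  shows "((\<lambda>\<mu>. of_real (symb_coeff x \<mu>) * monomial_at \<mu> z) has_sum Symb T z x) UNIV"
  unfolding Symb_def Symb_term_eq[symmetric] using conv[OF assms] by (rule has_sum_infsum)

text \<open>The capacity uses the symbol as a real infinite sum, membership in
  \<open>LP_plus\<close> the complex one. Complex summability gives real summability by taking real
  parts, after which the two sums agree.\<close>

lemma Symb_of_real:
  fixes z :: "real ^ 'n" and x :: "real ^ 'm"
  assumes x: "\<forall>j. 0 \<le> x $ j"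
  shows "((\<lambda>\<mu>. symb_coeff x \<mu> * monomial_at \<mu> z) has_sum Symb T z x) UNIV"
    and "Symb T (\<chi> i. complex_of_real (z $ i)) x = of_real (Symb T z x)"
proof -
  let ?z = "\<chi> i. complex_of_real (z $ i)"
  have term_eq: "of_real (symb_coeff x \<mu>) * monomial_at \<mu> ?z = complex_of_real (symb_coeff x \<mu> * monomial_at \<mu> z)" for \<mu>
    by (simp add: monomial_at_def)
  have hs: "((\<lambda>\<mu>. complex_of_real (symb_coeff x \<mu> * monomial_at \<mu> z)) has_sum Symb T ?z x) UNIV"
    using Symb_has_sum[OF x, of ?z] by (simp only: term_eq)
  then have re: "((\<lambda>\<mu>. symb_coeff x \<mu> * monomial_at \<mu> z) has_sum Re (Symb T ?z x)) UNIV"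
    using has_sum_Re[OF hs] by simp
  then have eq: "Symb T z x = Re (Symb T ?z x)"
    unfolding Symb_def[of T z] Symb_term_eq by (simp add: infsumI)
  show "((\<lambda>\<mu>. symb_coeff x \<mu> * monomial_at \<mu> z) has_sum Symb T z x) UNIV"
    using re eq by simp
  have "((\<lambda>\<mu>. complex_of_real (symb_coeff x \<mu> * monomial_at \<mu> z)) has_sum of_real (Re (Symb T ?z x))) UNIV"
    using re by (simp only: has_sum_of_real_iff)
  then show "Symb T ?z x = of_real (Symb T z x)"
    using hs has_sum_unique eq by metis
qed

section \<open>Capacity of the symbol and of the image polynomial\<close>

lemma Symb_nonneg:
  assumes "z \<in> pos_orthant" "x \<in> pos_orthant"
  shows "0 \<le> (Symb T z x :: real)"
proof -
  have x: "\<forall>j. 0 \<le> x $ j" using assms by (simp add: pos_orthant_def less_imp_le)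
  have "0 \<le> symb_coeff x \<mu> * monomial_at \<mu> z" for \<mu>
    unfolding monomial_at_def using assms(1)
    by (intro mult_nonneg_nonneg symb_coeff_nonneg[OF x] prod_nonneg zero_le_power)
      (simp add: pos_orthant_def less_imp_le)
  then show ?thesis by (rule has_sum_nonneg[OF Symb_of_real(1)[OF x]])
qed

lemma Cap2_nonneg: "0 \<le> Cap2 \<alpha> \<beta> (Symb T)"
  unfolding Cap2_def
proof (rule cINF_greatest)
  have "((\<chi> i. 1, \<chi> i. 1) :: (real ^ 'n) \<times> (real ^ 'm)) \<in> pos_orthant \<times> pos_orthant" by (simp add: pos_orthant_def)
  then show "(pos_orthant \<times> pos_orthant :: ((real ^ 'n) \<times> (real ^ 'm)) set) \<noteq> {}" by blast
qed (auto intro!: divide_nonneg_nonneg mult_nonneg_nonneg Symb_nonneg less_imp_le[OF vec_powr_pos])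

lemma Cap2_le:
  assumes z: "z \<in> pos_orthant" and x: "x \<in> pos_orthant"
  shows "Cap2 \<alpha> \<beta> (Symb T) \<le> Symb T z x / (vec_powr z \<alpha> * vec_powr x \<beta>)"
proof -
  have "bdd_below ((\<lambda>(z, x). Symb T z x / (vec_powr z \<alpha> * vec_powr x \<beta>)) ` (pos_orthant \<times> pos_orthant))"
    by (rule bdd_belowI2[where m=0])
      (auto intro!: divide_nonneg_nonneg mult_nonneg_nonneg Symb_nonneg less_imp_le[OF vec_powr_pos])
  from cINF_lower[OF this, of "(z, x)"] show ?thesis using z x by (simp add: Cap2_def)
qed

text \<open>For fixed \<open>x\<close> the symbol, as a function of \<open>z\<close>, has capacity
  at least \<open>Cap2\<close> times the monomial \<open>x^\<beta>\<close>. The factor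
  \<open>\<mu>!\<close> of the pairing cancels the \<open>1 / \<mu>!\<close> of the symbol, so the
  pairing with \<open>p\<close> is the value of \<open>T p\<close> at \<open>x\<close>.\<close>

lemma Cap_image_ge:
  fixes \<alpha> :: "real ^ 'n" and \<beta> :: "real ^ 'm"
  assumes p: "real_stable p" "nonneg_coeffs p" "\<alpha> \<in> Newt p" and \<alpha>: "\<And>i. 0 \<le> \<alpha> $ i"
  shows "exp_neg \<alpha> * self_powr \<alpha> * Cap2 \<alpha> \<beta> (Symb T) * Cap \<alpha> (eval_rpoly p) \<le> Cap \<beta> (eval_rpoly (T p))"
proof (rule Cap_lower)
  fix x :: "real ^ 'm" assume x: "x \<in> pos_orthant"
  then have x0: "\<forall>j. 0 \<le> x $ j" by (simp add: pos_orthant_def less_imp_le)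
  let ?D = "Cap2 \<alpha> \<beta> (Symb T) * vec_powr x \<beta>"
  have "p \<noteq> 0" using p(3) by (auto simp: Newt_def)
  have "Cap \<alpha> (eval_rpoly p) * ?D * self_powr \<alpha> * exp_neg \<alpha> \<le>
      (\<Sum>\<mu>\<in>Poly_Mapping.keys p. real (mfact \<mu>) * Poly_Mapping.lookup p \<mu> * symb_coeff x \<mu>)"
  proof (rule stable_LP_plus_pairing_ge[OF p(1) \<open>p \<noteq> 0\<close> p(2) _ _ LP[OF x0] symb_coeff_nonneg[OF x0]
        Symb_has_sum[OF x0] Symb_of_real(2)[OF x0] _ _ \<alpha>])
    show "Cap \<alpha> (eval_rpoly p) * vec_powr y \<alpha> \<le> eval_rpoly p y" if "y \<in> pos_orthant" for y
      using that p by (intro Cap_upper eval_rpoly_nonneg_pos_orthant)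
    show "0 \<le> Cap \<alpha> (eval_rpoly p)" using Cap_pos_if_Newt[OF p(2,3)] by simp
    show "0 \<le> ?D" using Cap2_nonneg vec_powr_pos[OF x, of \<beta>] by simp
    show "?D * vec_powr z \<alpha> \<le> Symb T z x" if "z \<in> pos_orthant" for z
      using Cap2_le[OF that x, of \<alpha> \<beta>] vec_powr_pos[OF x, of \<beta>] vec_powr_pos[OF that, of \<alpha>]
      by (simp add: field_simps)
  qed
  also have "(\<Sum>\<mu>\<in>Poly_Mapping.keys p. real (mfact \<mu>) * Poly_Mapping.lookup p \<mu> * symb_coeff x \<mu>) =
      (\<Sum>\<mu>\<in>Poly_Mapping.keys p. Poly_Mapping.lookup p \<mu> * eval_rpoly (T (Poly_Mapping.single \<mu> 1)) x)"
  proof (intro sum.cong refl)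
    fix \<mu>
    show "real (mfact \<mu>) * Poly_Mapping.lookup p \<mu> * symb_coeff x \<mu> =
        Poly_Mapping.lookup p \<mu> * eval_rpoly (T (Poly_Mapping.single \<mu> 1)) x"
      using mfact_pos[of \<mu>] by (simp add: symb_coeff_def)
  qed
  also have "\<dots> = eval_rpoly (T p) x"
    using eval_T_sum_singles[of "\<lambda>\<mu>. \<mu>" "Poly_Mapping.lookup p" "Poly_Mapping.keys p" x]
    by (simp flip: rpoly_sum_singles)
  finally show "exp_neg \<alpha> * self_powr \<alpha> * Cap2 \<alpha> \<beta> (Symb T) * Cap \<alpha> (eval_rpoly p) * vec_powr x \<beta> \<le> eval_rpoly (T p) x"
    by (simp add: ac_simps)
qed

text \<open>Since \<open>(N choose k) / N^k <= 1 / k!\<close>, the left side is termwise below a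
  partial sum of the symbol, whose remaining terms are non-negative. The bound holds for each
  \<open>N\<close>, so \<open>T\<close> need not be interchanged with the limit.\<close>

lemma eval_T_exp_rpoly_le:
  assumes z: "z \<in> pos_orthant" and x: "x \<in> pos_orthant" and N: "0 < N"
  shows "eval_rpoly (T (exp_rpoly N z)) x \<le> Symb T z x"
proof -
  have x0: "\<forall>j. 0 \<le> x $ j" using x by (simp add: pos_orthant_def less_imp_le)
  have z0: "0 \<le> z $ i" for i using z by (simp add: pos_orthant_def less_imp_le)
  let ?P = "PiE UNIV (\<lambda>_ :: 'n. {..N})"
  have "eval_rpoly (T (exp_rpoly N z)) x = (\<Sum>k\<in>?P. (\<Prod>i\<in>UNIV. real (N choose k i) * (z $ i / real N) ^ k i) *
      eval_rpoly (T (Poly_Mapping.single (Abs_poly_mapping k) 1)) x)"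
    unfolding exp_rpoly_def by (rule eval_T_sum_singles)
  also have "\<dots> \<le> (\<Sum>k\<in>?P. symb_coeff x (Abs_poly_mapping k) * monomial_at (Abs_poly_mapping k) z)"
  proof (rule sum_mono)
    fix k :: "'n \<Rightarrow> nat"
    let ?t = "eval_rpoly (T (Poly_Mapping.single (Abs_poly_mapping k) 1)) x"
    have "(\<Prod>i\<in>UNIV. real (N choose k i) * (z $ i / real N) ^ k i) \<le> (\<Prod>i\<in>UNIV. z $ i ^ k i / fact (k i))"
    proof (rule prod_mono, intro conjI)
      fix i
      show "0 \<le> real (N choose k i) * (z $ i / real N) ^ k i" using z0 by simp
      have "real ((N choose k i) * fact (k i)) \<le> real (N ^ k i)"
        unfolding of_nat_le_iff by (rule binomial_fact_pow)
      then have "real (N choose k i) / real N ^ k i \<le> 1 / fact (k i)"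
        using N by (simp add: field_simps)
      then have "z $ i ^ k i * (real (N choose k i) / real N ^ k i) \<le> z $ i ^ k i * (1 / fact (k i))"
        using z0 by (intro mult_left_mono) auto
      then show "real (N choose k i) * (z $ i / real N) ^ k i \<le> z $ i ^ k i / fact (k i)"
        by (simp add: power_divide mult.commute)
    qed
    then have "(\<Prod>i\<in>UNIV. real (N choose k i) * (z $ i / real N) ^ k i) * ?t \<le> (\<Prod>i\<in>UNIV. z $ i ^ k i / fact (k i)) * ?t"
      using x by (intro mult_right_mono eval_rpoly_nonneg_pos_orthant T_nonneg nonneg_coeffs_single) auto
    also have "\<dots> = symb_coeff x (Abs_poly_mapping k) * monomial_at (Abs_poly_mapping k) z"
      by (simp add: symb_coeff_def monomial_at_def mfact_def prod_dividef)
    finally show "(\<Prod>i\<in>UNIV. real (N choose k i) * (z $ i / real N) ^ k i) * ?t \<le>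
        symb_coeff x (Abs_poly_mapping k) * monomial_at (Abs_poly_mapping k) z" .
  qed
  also have "\<dots> = (\<Sum>\<mu>\<in>Abs_poly_mapping ` ?P. symb_coeff x \<mu> * monomial_at \<mu> z)"
    by (subst sum.reindex) (auto simp: inj_on_def Abs_poly_mapping_eq_iff)
  also have "\<dots> \<le> Symb T z x"
  proof (rule finite_sum_le_has_sum[OF Symb_of_real(1)[OF x0]])
    show "finite (Abs_poly_mapping ` ?P)" by (intro finite_imageI finite_PiE) auto
    show "0 \<le> symb_coeff x \<mu> * monomial_at \<mu> z" for \<mu>
      unfolding monomial_at_def
      by (intro mult_nonneg_nonneg symb_coeff_nonneg[OF x0] prod_nonneg zero_le_power z0)
  qed auto
  finally show ?thesis .
qed

lemma ratio_exp_rpoly_le: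
  fixes \<alpha> :: "real ^ 'n" and \<beta> :: "real ^ 'm"
  assumes z: "z \<in> pos_orthant" and x: "x \<in> pos_orthant" and N: "0 < N"
    and \<alpha>: "\<And>i. 0 \<le> \<alpha> $ i" "\<And>i. \<alpha> $ i < real N"
  shows "Cap \<beta> (eval_rpoly (T (exp_rpoly N z))) / Cap \<alpha> (eval_rpoly (exp_rpoly N z)) \<le>
    Symb T z x / (vec_powr z \<alpha> * vec_powr x \<beta>) * tightness_factor N \<alpha>"
proof -
  let ?p = "exp_rpoly N z"
  have nn: "nonneg_coeffs ?p"
    by (rule nonneg_coeffs_exp_rpoly) (use z in \<open>simp add: pos_orthant_def less_imp_le\<close>)
  have "Cap \<beta> (eval_rpoly (T ?p)) * vec_powr x \<beta> \<le> eval_rpoly (T ?p) x"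
    using x nn by (intro Cap_upper eval_rpoly_nonneg_pos_orthant T_nonneg)
  also have "\<dots> \<le> Symb T z x" by (rule eval_T_exp_rpoly_le[OF z x N])
  finally have num: "Cap \<beta> (eval_rpoly (T ?p)) \<le> Symb T z x / vec_powr x \<beta>"
    using vec_powr_pos[OF x, of \<beta>] by (simp add: field_simps)
  have den_pos: "0 < vec_powr z \<alpha> / tightness_factor N \<alpha>"
    using vec_powr_pos[OF z] tightness_factor_pos[OF N \<alpha>] by simp
  have "Cap \<beta> (eval_rpoly (T ?p)) / Cap \<alpha> (eval_rpoly ?p) \<le> (Symb T z x / vec_powr x \<beta>) / (vec_powr z \<alpha> / tightness_factor N \<alpha>)"
  proof (rule frac_le[OF _ num den_pos Cap_exp_rpoly_ge[OF z N \<alpha>]])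
    show "0 \<le> Symb T z x / vec_powr x \<beta>"
      using Symb_nonneg[OF z x] vec_powr_pos[OF x, of \<beta>] by simp
  qed
  then show ?thesis by (simp add: mult.commute)
qed

end

theorem theorem4p12:
  fixes T :: "'n::finite rpoly \<Rightarrow> 'm::finite rpoly"
    and \<alpha> :: "real ^ 'n" and \<beta> :: "real ^ 'm"
  assumes T_linear: "linear T"
    and T_nonneg: "\<And>p. nonneg_coeffs p \<Longrightarrow> nonneg_coeffs (T p)"
    and Symb_convergent: "\<And>(x :: real ^ 'm) (z :: complex ^ 'n). (\<forall>j. 0 \<le> x $ j) \<Longrightarrow>
           (\<lambda>\<mu>. Symb_term T \<mu> z x) summable_on UNIV"
    and Symb_LP: "\<And>x :: real ^ 'm. (\<forall>j. 0 \<le> x $ j) \<Longrightarrow>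
           (\<lambda>z :: complex ^ 'n. Symb T z x) \<in> LP_plus"
    and \<alpha>_nonneg: "\<forall>i. 0 \<le> \<alpha> $ i"
    and \<beta>_nonneg: "\<forall>j. 0 \<le> \<beta> $ j"
  shows "(\<forall>p. real_stable p \<and> nonneg_coeffs p \<and> \<alpha> \<in> Newt p \<longrightarrow>
            Cap \<beta> (eval_rpoly (T p)) / Cap \<alpha> (eval_rpoly p)
              \<ge> exp_neg \<alpha> * self_powr \<alpha> * Cap2 \<alpha> \<beta> (Symb T)) \<and>
         (INF p\<in>{p. real_stable p \<and> nonneg_coeffs p \<and> \<alpha> \<in> Newt p}.
            Cap \<beta> (eval_rpoly (T p)) / Cap \<alpha> (eval_rpoly p))
              = exp_neg \<alpha> * self_powr \<alpha> * Cap2 \<alpha> \<beta> (Symb T)"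
proof -
  note T = T_linear T_nonneg Symb_convergent Symb_LP
  let ?A = "{p. real_stable p \<and> nonneg_coeffs p \<and> \<alpha> \<in> Newt p}"
  let ?ratio = "\<lambda>p. Cap \<beta> (eval_rpoly (T p)) / Cap \<alpha> (eval_rpoly p)"
  let ?c = "exp_neg \<alpha> * self_powr \<alpha>"
  have \<alpha>: "0 \<le> \<alpha> $ i" for i using \<alpha>_nonneg by simp
  have c: "0 < ?c"
    unfolding exp_neg_def self_powr_def by (intro mult_pos_pos prod_pos) auto
  have ge: "?c * Cap2 \<alpha> \<beta> (Symb T) \<le> ?ratio p" if "p \<in> ?A" for p
    using that Cap_image_ge[OF T, of p \<alpha> \<beta>] \<alpha> Cap_pos_if_Newt[of p \<alpha>] by (simp add: pos_le_divide_eq)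
  have bdd: "bdd_below (?ratio ` ?A)"
    using ge by (intro bdd_belowI2[where m="?c * Cap2 \<alpha> \<beta> (Symb T)"])
  have large: "\<forall>\<^sub>F N in sequentially. 0 < N \<and> (\<forall>i. \<alpha> $ i < real N)"
  proof -
    have "\<forall>\<^sub>F N in sequentially. \<alpha> $ i < real N" for i
      using filterlim_real_sequentially by (simp add: filterlim_at_top_dense)
    then show ?thesis
      by (intro eventually_conj eventually_gt_at_top eventually_all_finite)
  qed
  have in_A: "exp_rpoly N z \<in> ?A" if "z \<in> pos_orthant" "0 < N" "\<forall>i. \<alpha> $ i < real N" for N z
    using that \<alpha> by (auto simp: pos_orthant_def less_imp_le
        intro!: real_stable_exp_rpoly nonneg_coeffs_exp_rpoly Newt_exp_rpoly)
  have le: "(INF p\<in>?A. ?ratio p) \<le> Symb T z x / (vec_powr z \<alpha> * vec_powr x \<beta>) * ?c"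
    if z: "z \<in> pos_orthant" and x: "x \<in> pos_orthant" for z x
  proof (rule tendsto_lowerbound[OF _ _ sequentially_bot])
    show "(\<lambda>N. Symb T z x / (vec_powr z \<alpha> * vec_powr x \<beta>) * tightness_factor N \<alpha>) \<longlonglongrightarrow>
        Symb T z x / (vec_powr z \<alpha> * vec_powr x \<beta>) * ?c"
      by (intro tendsto_mult tendsto_const tightness_factor_tendsto \<alpha>)
    show "\<forall>\<^sub>F N in sequentially. (INF p\<in>?A. ?ratio p) \<le>
        Symb T z x / (vec_powr z \<alpha> * vec_powr x \<beta>) * tightness_factor N \<alpha>"
      using large
    proof eventually_elim
      case (elim N)
      have "(INF p\<in>?A. ?ratio p) \<le> ?ratio (exp_rpoly N z)"
        using elim by (intro cINF_lower[OF bdd] in_A z) auto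
      also have "\<dots> \<le> Symb T z x / (vec_powr z \<alpha> * vec_powr x \<beta>) * tightness_factor N \<alpha>"
        using elim \<alpha> by (intro ratio_exp_rpoly_le[OF T z x]) auto
      finally show ?case .
    qed
  qed
  have ones: "(\<chi> i. 1) \<in> (pos_orthant :: (real ^ 'n) set)" "(\<chi> i. 1) \<in> (pos_orthant :: (real ^ 'm) set)"
    by (simp_all add: pos_orthant_def)
  have "(INF p\<in>?A. ?ratio p) / ?c \<le> Cap2 \<alpha> \<beta> (Symb T)"
    unfolding Cap2_def
  proof (rule cINF_greatest)
    show "(pos_orthant \<times> pos_orthant :: ((real ^ 'n) \<times> (real ^ 'm)) set) \<noteq> {}"
      using ones by blast
    fix zx :: "(real ^ 'n) \<times> (real ^ 'm)" assume "zx \<in> pos_orthant \<times> pos_orthant"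
    then obtain z x where zx: "zx = (z, x)" "z \<in> pos_orthant" "x \<in> pos_orthant" by auto
    then show "(INF p\<in>?A. ?ratio p) / ?c \<le> (case zx of (z, x) \<Rightarrow> Symb T z x / (vec_powr z \<alpha> * vec_powr x \<beta>))"
      using le[OF zx(2,3)] c by (simp add: pos_divide_le_eq)
  qed
  then have "(INF p\<in>?A. ?ratio p) \<le> ?c * Cap2 \<alpha> \<beta> (Symb T)"
    using c by (simp add: pos_divide_le_eq mult.commute)
  moreover have "?c * Cap2 \<alpha> \<beta> (Symb T) \<le> (INF p\<in>?A. ?ratio p)"
  proof (rule cINF_greatest[OF _ ge])
    \<comment> \<open>A real infimum over an empty set would carry no information, so an admissible
      polynomial must be exhibited; the one for \<open>z = (1, ..., 1)\<close> and large
      \<open>N\<close> serves.\<close>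
    obtain N where "0 < N" "\<forall>i. \<alpha> $ i < real N"
      using eventually_happens'[OF sequentially_bot large] by blast
    then show "?A \<noteq> {}" using in_A[OF ones(1)] by blast
  qed
  ultimately show ?thesis using ge by auto
qed

end
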